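(* Let $\Gamma=(K,I,J,g,q)$ be an absorbing game with finite state space $K$, compact action sets $I$ and $J$, and separately continuous transition and payoff functions. Then $\Gamma$ has an $\infty$-asymptotic value; that is, for all $\epsilon>0$ there exists $\alpha>0$ such that for all $\pi\in\Delta(\mathbb{N}^* )$ with $\sup_{m\ge1}\pi_m\le\alpha$, one has $\|v_\pi-v_\infty\|_\infty\le\epsilon$.
   Context: Notation: $\mathbb{N}^*=\{1,2,\dots\}$; $\Delta(C)$ is the set of probability measures on $C$; $\Delta(\mathbb{N}^* )$ is the set of sequences $\pi=(\pi_m)_{m\ge1}$ of nonnegative reals with $\sum_{m\ge1}\pi_m=1$; $\|\cdot\|_\infty$ is the supremum norm on $\mathbb{R}^K$. Stochastic game: A zero-sum stochastic game $\Gamma$ consists of a finite nonempty state space $K$, nonempty action sets $I$ (Player 1) and $J$ (Player 2), a payoff function $g:K\times I\times J\to[0,1]$ and a transition function $q:K\times I\times J\to\Delta(K)$. Given an initial state $k_1\in K$, at each stage $m\ge1$ the players simultaneously and independently choose $i_m\in I$, $j_m\in J$; the stage payoff (to Player 1) is $g_m=g(k_m,i_m,j_m)$; the next state $k_{m+1}$ is drawn from $q(k_m,i_m,j_m)$, and $(k_{m+1},i_m,j_m)$ is publicly announced. Histories before stage $m$ form $H_m=(K\times I\times J)^{m-1}\times K$. A behavioral strategy of Player 1 (resp. 2) is a (measurable) map $\sigma:\bigcup_{m\ge1}H_m\to\Delta(I)$ (resp. $\tau:\bigcup_{m\ge1}H_m\to\Delta(J)$); the sets of these are $\Sigma$, $\mathcal{T}$.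 A triple $(k_1,\sigma,\tau)$ induces a probability on infinite plays, with expectation $\mathbb{E}^{k_1}_{\sigma,\tau}$. Separate continuity: for each $k,k'\in K$, the functions $g(k,\cdot,\cdot)$ and $q(k,\cdot,\cdot)(k')$ are continuous in $i\in I$ for each fixed $j\in J$, and continuous in $j\in J$ for each fixed $i\in I$. Absorbing game: A state is absorbing if, once it is reached, the game remains in it forever and the payoff there does not depend on the actions. An absorbing game is a stochastic game with at most one nonabsorbing state. Values: For $\pi\in\Delta(\mathbb{N}^* )$, $v_\pi(k_1)$ is the value of the zero-sum game with strategy sets $\Sigma,\mathcal{T}$ and payoff $\gamma^{k_1}_\pi(\sigma,\tau)=\mathbb{E}^{k_1}_{\sigma,\tau}\left(\sum_{m\ge1}\pi_m g_m\right)$, i.e. the common value of $\sup_\sigma\inf_\tau$ and $\inf_\tau\sup_\sigma$ of $\gamma^{k_1}_\pi$. For $\lambda\in(0,1]$, $v_\lambda$ is $v_\pi$ with $\pi_m=\lambda(1-\lambda)^{m-1}$, and $\gamma_n$ denotes $\gamma_\pi$ with $\pi_m=\frac1n1_{m\le n}$. It is known (Mertens–Neyman–Rosenberg) that such an absorbing game has a uniform value $v_\infty:K\to[0,1]$, meaning that for all $k_1\in K$ and $\epsilon>0$ there exist $(\sigma^*,\tau^* )\in\Sigma\times\mathcal{T}$ and $\bar n\in\mathbb{N}^*$ such that for all $n\ge\bar n$ and all $(\sigma,\tau)\in\Sigma\times\mathcal{T}$, $\gamma_n^{k_1}(\sigma^*,\tau)\ge v_\infty(k_1)-\epsilon$ and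 $\gamma_n^{k_1}(\sigma,\tau^* )\le v_\infty(k_1)+\epsilon$; in particular $v_\infty=\lim_{\lambda\to0}v_\lambda$. *)

theory Defs
  imports "HOL-Probability.Probability"
begin

text \<open>The state space is a type of class \<open>finite\<close>; the action sets are sets.\<close>

record ('k, 'i, 'j) stoch_game =
  actions1 :: "'i set"
  actions2 :: "'j set"
  payoff :: "'k \<Rightarrow> 'i \<Rightarrow> 'j \<Rightarrow> real"
  trans_law :: "'k \<Rightarrow> 'i \<Rightarrow> 'j \<Rightarrow> 'k pmf"

definition action_space1 :: "('k, 'i::topological_space, 'j) stoch_game \<Rightarrow> 'i measure" where
  "action_space1 G = restrict_space borel (actions1 G)"

definition action_space2 :: "('k, 'i, 'j::topological_space) stoch_game \<Rightarrow> 'j measure" where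
  "action_space2 G = restrict_space borel (actions2 G)"

text \<open>Joint measurability of payoff and transition is what makes the law of a play meaningful.
  It follows from separate continuity if the action sets are compact metric spaces
  (\<open>measurable_separately_continuous\<close> below), but not in general topological spaces.\<close>

definition stochastic_game ::
    "('k::finite, 'i::topological_space, 'j::topological_space) stoch_game \<Rightarrow> bool" where
  "stochastic_game G \<longleftrightarrow>
     actions1 G \<noteq> {} \<and> actions2 G \<noteq> {} \<and>
     (\<forall>k. \<forall>i\<in>actions1 G. \<forall>j\<in>actions2 G. payoff G k i j \<in> {0..1}) \<and>
     (\<forall>k. (\<lambda>(i, j). payoff G k i j) \<in> borel_measurable (action_space1 G \<Otimes>\<^sub>M action_space2 G)) \<and>
     (\<forall>k k'. (\<lambda>(i, j). pmf (trans_law G k i j) k')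
        \<in> borel_measurable (action_space1 G \<Otimes>\<^sub>M action_space2 G))"

definition separately_continuous ::
    "('k, 'i::topological_space, 'j::topological_space) stoch_game \<Rightarrow> bool" where
  "separately_continuous G \<longleftrightarrow>
     (\<forall>k. \<forall>j\<in>actions2 G. continuous_on (actions1 G) (\<lambda>i. payoff G k i j)) \<and>
     (\<forall>k. \<forall>i\<in>actions1 G. continuous_on (actions2 G) (\<lambda>j. payoff G k i j)) \<and>
     (\<forall>k k'. \<forall>j\<in>actions2 G. continuous_on (actions1 G) (\<lambda>i. pmf (trans_law G k i j) k')) \<and>
     (\<forall>k k'. \<forall>i\<in>actions1 G. continuous_on (actions2 G) (\<lambda>j. pmf (trans_law G k i j) k'))"

definition absorbing :: "('k, 'i, 'j) stoch_game \<Rightarrow> 'k \<Rightarrow> bool" where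
  "absorbing G k \<longleftrightarrow>
     (\<forall>i\<in>actions1 G. \<forall>j\<in>actions2 G. trans_law G k i j = return_pmf k) \<and>
     (\<exists>c. \<forall>i\<in>actions1 G. \<forall>j\<in>actions2 G. payoff G k i j = c)"

definition absorbing_game :: "('k::finite, 'i, 'j) stoch_game \<Rightarrow> bool" where
  "absorbing_game G \<longleftrightarrow> card {k. \<not> absorbing G k} \<le> 1"


text \<open>Stages are numbered from 0. Coordinate \<open>n\<close> of a play is the triple
  (state, action of Player 1, action of Player 2) of stage \<open>n\<close>; a history at stage \<open>n\<close> consists
  of the first \<open>n\<close> triples and the current state.\<close>

definition stage_space ::
    "('k, 'i::topological_space, 'j::topological_space) stoch_game \<Rightarrow> ('k \<times> 'i \<times> 'j) measure" where
  "stage_space G = count_space UNIV \<Otimes>\<^sub>M (action_space1 G \<Otimes>\<^sub>M action_space2 G)"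

definition history_space ::
    "('k, 'i::topological_space, 'j::topological_space) stoch_game \<Rightarrow> nat
      \<Rightarrow> ((nat \<Rightarrow> 'k \<times> 'i \<times> 'j) \<times> 'k) measure" where
  "history_space G n = PiM {0..<n} (\<lambda>_. stage_space G) \<Otimes>\<^sub>M count_space UNIV"

definition strategies1 ::
    "('k, 'i::topological_space, 'j::topological_space) stoch_game
      \<Rightarrow> (nat \<Rightarrow> (nat \<Rightarrow> 'k \<times> 'i \<times> 'j) \<times> 'k \<Rightarrow> 'i measure) set" where
  "strategies1 G = {\<sigma>. \<forall>n. \<sigma> n \<in> history_space G n \<rightarrow>\<^sub>M prob_algebra (action_space1 G)}"

definition strategies2 ::
    "('k, 'i::topological_space, 'j::topological_space) stoch_game
      \<Rightarrow> (nat \<Rightarrow> (nat \<Rightarrow> 'k \<times> 'i \<times> 'j) \<times> 'k \<Rightarrow> 'j measure) set" where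
  "strategies2 G = {\<tau>. \<forall>n. \<tau> n \<in> history_space G n \<rightarrow>\<^sub>M prob_algebra (action_space2 G)}"

definition state_law ::
    "('k, 'i, 'j) stoch_game \<Rightarrow> 'k \<Rightarrow> nat \<Rightarrow> (nat \<Rightarrow> 'k \<times> 'i \<times> 'j) \<Rightarrow> 'k pmf" where
  "state_law G k1 n \<omega> =
     (case n of 0 \<Rightarrow> return_pmf k1 | Suc m \<Rightarrow> (case \<omega> m of (k, i, j) \<Rightarrow> trans_law G k i j))"

text \<open>Conditional law of the triple of stage \<open>n\<close> given the first \<open>n\<close> triples.\<close>

definition play_kernel ::
    "('k, 'i::topological_space, 'j::topological_space) stoch_game \<Rightarrow> 'k
      \<Rightarrow> (nat \<Rightarrow> (nat \<Rightarrow> 'k \<times> 'i \<times> 'j) \<times> 'k \<Rightarrow> 'i measure)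
      \<Rightarrow> (nat \<Rightarrow> (nat \<Rightarrow> 'k \<times> 'i \<times> 'j) \<times> 'k \<Rightarrow> 'j measure)
      \<Rightarrow> nat \<Rightarrow> (nat \<Rightarrow> 'k \<times> 'i \<times> 'j) \<Rightarrow> ('k \<times> 'i \<times> 'j) measure" where
  "play_kernel G k1 \<sigma> \<tau> n \<omega> =
     measure_pmf (state_law G k1 n \<omega>) \<bind>
       (\<lambda>k. distr (\<sigma> n (\<omega>, k) \<Otimes>\<^sub>M \<tau> n (\<omega>, k)) (stage_space G) (\<lambda>(i, j). (k, i, j)))"

text \<open>The law of the infinite play is the Ionescu-Tulcea limit of these kernels
  (\<open>Ionescu_Tulcea_play_kernel\<close> below).\<close>

definition play_measure ::
    "('k, 'i::topological_space, 'j::topological_space) stoch_game \<Rightarrow> 'k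
      \<Rightarrow> (nat \<Rightarrow> (nat \<Rightarrow> 'k \<times> 'i \<times> 'j) \<times> 'k \<Rightarrow> 'i measure)
      \<Rightarrow> (nat \<Rightarrow> (nat \<Rightarrow> 'k \<times> 'i \<times> 'j) \<times> 'k \<Rightarrow> 'j measure)
      \<Rightarrow> (nat \<Rightarrow> 'k \<times> 'i \<times> 'j) measure" where
  "play_measure G k1 \<sigma> \<tau> =
     projective_family.lim UNIV
       (Ionescu_Tulcea.CI (play_kernel G k1 \<sigma> \<tau>) (\<lambda>_. stage_space G)) (\<lambda>_. stage_space G)"

text \<open>Weights are indexed like stages: \<open>\<pi> m\<close> is the weight of the \<open>(m + 1)\<close>-st stage.\<close>

definition weights :: "(nat \<Rightarrow> real) set" where
  "weights = {\<pi>. (\<forall>m. 0 \<le> \<pi> m) \<and> \<pi> sums 1}"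

definition expected_payoff ::
    "('k, 'i::topological_space, 'j::topological_space) stoch_game \<Rightarrow> (nat \<Rightarrow> real) \<Rightarrow> 'k
      \<Rightarrow> (nat \<Rightarrow> (nat \<Rightarrow> 'k \<times> 'i \<times> 'j) \<times> 'k \<Rightarrow> 'i measure)
      \<Rightarrow> (nat \<Rightarrow> (nat \<Rightarrow> 'k \<times> 'i \<times> 'j) \<times> 'k \<Rightarrow> 'j measure) \<Rightarrow> real" where
  "expected_payoff G \<pi> k1 \<sigma> \<tau> =
     (\<integral>\<omega>. (\<Sum>m. \<pi> m * (case \<omega> m of (k, i, j) \<Rightarrow> payoff G k i j)) \<partial>play_measure G k1 \<sigma> \<tau>)"

definition is_value ::
    "('k, 'i::topological_space, 'j::topological_space) stoch_game \<Rightarrow> (nat \<Rightarrow> real) \<Rightarrow> 'k \<Rightarrow> real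
      \<Rightarrow> bool" where
  "is_value G \<pi> k1 v \<longleftrightarrow>
     (SUP \<sigma>\<in>strategies1 G. INF \<tau>\<in>strategies2 G. expected_payoff G \<pi> k1 \<sigma> \<tau>) = v \<and>
     (INF \<tau>\<in>strategies2 G. SUP \<sigma>\<in>strategies1 G. expected_payoff G \<pi> k1 \<sigma> \<tau>) = v"

definition average_weights :: "nat \<Rightarrow> nat \<Rightarrow> real" where
  "average_weights n m = (if m < n then 1 / real n else 0)"

definition uniform_value ::
    "('k, 'i::topological_space, 'j::topological_space) stoch_game \<Rightarrow> ('k \<Rightarrow> real) \<Rightarrow> bool" where
  "uniform_value G v \<longleftrightarrow>
     (\<forall>k. v k \<in> {0..1}) \<and>
     (\<forall>k. \<forall>\<epsilon>>0. \<exists>\<sigma>'\<in>strategies1 G. \<exists>\<tau>'\<in>strategies2 G. \<exists>N\<ge>1. \<forall>n\<ge>N.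
        \<forall>\<sigma>\<in>strategies1 G. \<forall>\<tau>\<in>strategies2 G.
          expected_payoff G (average_weights n) k \<sigma>' \<tau> \<ge> v k - \<epsilon> \<and>
          expected_payoff G (average_weights n) k \<sigma> \<tau>' \<le> v k + \<epsilon>)"


lemma Ionescu_Tulcea_play_kernel:
  fixes G :: "('k::finite, 'i::topological_space, 'j::topological_space) stoch_game"
  assumes G: "stochastic_game G" and \<sigma>: "\<sigma> \<in> strategies1 G" and \<tau>: "\<tau> \<in> strategies2 G"
  shows "Ionescu_Tulcea (play_kernel G k1 \<sigma> \<tau>) (\<lambda>_. stage_space G)"
proof -
  let ?S = "stage_space G" and ?K = "count_space UNIV :: 'k measure"
  let ?A = "action_space1 G" and ?B = "action_space2 G"
  have q: "(\<lambda>(i, j). pmf (trans_law G k i j) k') \<in> borel_measurable (?A \<Otimes>\<^sub>M ?B)" for k k'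
    using G by (simp add: stochastic_game_def)
  have trans: "(\<lambda>(k, i, j). measure_pmf (trans_law G k i j)) \<in> ?S \<rightarrow>\<^sub>M prob_algebra ?K"
  proof (rule measurable_prob_algebraI)
    show "(\<lambda>(k, i, j). measure_pmf (trans_law G k i j)) \<in> ?S \<rightarrow>\<^sub>M subprob_algebra ?K"
    proof (rule measurable_subprob_algebra)
      fix A :: "'k set"
      have "emeasure (measure_pmf p) A = (\<Sum>k'\<in>A. ennreal (pmf p k'))" for p :: "'k pmf"
        by (simp add: emeasure_measure_pmf_finite)
      then have *: "(\<lambda>a. emeasure (case a of (k, i, j) \<Rightarrow> measure_pmf (trans_law G k i j)) A) =
          (\<lambda>a. \<Sum>k'\<in>A. ennreal (case a of (k, i, j) \<Rightarrow> pmf (trans_law G k i j) k'))"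
        by (auto simp: fun_eq_iff)
      have "(\<lambda>(k, i, j). pmf (trans_law G k i j) k') \<in> borel_measurable ?S" for k'
        unfolding stage_space_def
        by (rule measurable_pair_measure_countable1) (use q in \<open>auto simp: split_beta\<close>)
      then show "(\<lambda>a. emeasure (case a of (k, i, j) \<Rightarrow> measure_pmf (trans_law G k i j)) A)
          \<in> borel_measurable ?S"
        unfolding * by measurable
    qed (auto simp: measure_pmf.subprob_space_axioms)
  qed (auto simp: measure_pmf.prob_space_axioms)
  have law: "(\<lambda>\<omega>. measure_pmf (state_law G k1 n \<omega>))
      \<in> PiM {0..<n} (\<lambda>_. ?S) \<rightarrow>\<^sub>M prob_algebra ?K" for n
  proof (cases n)
    case 0
    then show ?thesis
      by (simp add: state_law_def space_prob_algebra measure_pmf.prob_space_axioms)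
  next
    case (Suc m)
    have *: "(\<lambda>\<omega>. measure_pmf (state_law G k1 n \<omega>)) =
        (\<lambda>a. case a of (k, i, j) \<Rightarrow> measure_pmf (trans_law G k i j)) \<circ> (\<lambda>\<omega>. \<omega> m)"
      by (auto simp: state_law_def Suc fun_eq_iff split: prod.split)
    show ?thesis
      unfolding *
    proof (rule measurable_comp)
      show "(\<lambda>\<omega>. \<omega> m) \<in> PiM {0..<n} (\<lambda>_. ?S) \<rightarrow>\<^sub>M ?S"
        by (rule measurable_component_singleton) (simp add: Suc)
    qed (rule trans)
  qed
  have kernel: "play_kernel G k1 \<sigma> \<tau> n \<in> PiM {0..<n} (\<lambda>_. ?S) \<rightarrow>\<^sub>M prob_algebra ?S" for n
  proof -
    have [measurable]: "\<sigma> n \<in> PiM {0..<n} (\<lambda>_. ?S) \<Otimes>\<^sub>M ?K \<rightarrow>\<^sub>M prob_algebra ?A"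
      "\<tau> n \<in> PiM {0..<n} (\<lambda>_. ?S) \<Otimes>\<^sub>M ?K \<rightarrow>\<^sub>M prob_algebra ?B"
      using \<sigma> \<tau> by (auto simp: strategies1_def strategies2_def history_space_def)
    have act: "(\<lambda>x. \<sigma> n x \<Otimes>\<^sub>M \<tau> n x) \<in> PiM {0..<n} (\<lambda>_. ?S) \<Otimes>\<^sub>M ?K \<rightarrow>\<^sub>M prob_algebra (?A \<Otimes>\<^sub>M ?B)"
      by measurable
    have "(\<lambda>x. distr (\<sigma> n x \<Otimes>\<^sub>M \<tau> n x) ?S (\<lambda>(i, j). (snd x, i, j)))
        \<in> PiM {0..<n} (\<lambda>_. ?S) \<Otimes>\<^sub>M ?K \<rightarrow>\<^sub>M prob_algebra ?S"
      by (rule measurable_distr_prob_space2[OF act])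
        (simp add: stage_space_def split_beta)
    then show ?thesis
      unfolding play_kernel_def
      by (intro measurable_bind_prob_space2[OF law]) (simp add: split_beta')
  qed
  show ?thesis
  proof (rule Ionescu_Tulcea.intro)
    show "play_kernel G k1 \<sigma> \<tau> n \<in> PiM {0..<n} (\<lambda>_. ?S) \<rightarrow>\<^sub>M subprob_algebra ?S" for n
      using kernel by (rule measurable_prob_algebraD)
    show "prob_space (play_kernel G k1 \<sigma> \<tau> n x)" if "x \<in> space (PiM {0..<n} (\<lambda>_. ?S))" for n x
      using measurable_space[OF kernel that] by (simp add: space_prob_algebra)
  qed
qed

lemma prob_space_play_measure:
  fixes G :: "('k::finite, 'i::topological_space, 'j::topological_space) stoch_game"
  assumes "stochastic_game G" "\<sigma> \<in> strategies1 G" "\<tau> \<in> strategies2 G"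
  shows "prob_space (play_measure G k1 \<sigma> \<tau>)"
proof -
  interpret Ionescu_Tulcea "play_kernel G k1 \<sigma> \<tau>" "\<lambda>_. stage_space G"
    using assms by (rule Ionescu_Tulcea_play_kernel)
  have emb: "PF.emb UNIV {} (space (PiM {} (\<lambda>_. stage_space G))) = space (PiM UNIV (\<lambda>_. stage_space G))"
    by (auto simp: prod_emb_def space_PiM PiE_def)
  have "emeasure PF.lim (PF.emb UNIV {} (space (PiM {} (\<lambda>_. stage_space G)))) =
      emeasure (CI {}) (space (PiM {} (\<lambda>_. stage_space G)))"
    by (rule lim) auto
  also have "\<dots> = 1"
    using prob_space.emeasure_space_1[OF PF.prob_space_P[of "{}"]] by (simp add: PF.space_P)
  finally show ?thesis
    by (intro prob_spaceI) (simp add: play_measure_def emb)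
qed

lemma borel_measurable_separately_continuous:
  fixes f :: "'a::metric_space \<Rightarrow> 'b::topological_space \<Rightarrow> real"
  assumes A: "compact A"
    and c1: "\<And>y. y \<in> B \<Longrightarrow> continuous_on A (\<lambda>x. f x y)"
    and c2: "\<And>x. x \<in> A \<Longrightarrow> continuous_on B (f x)"
  shows "(\<lambda>(x, y). f x y) \<in> borel_measurable (restrict_space borel A \<Otimes>\<^sub>M restrict_space borel B)"
proof -
  let ?M = "restrict_space borel A \<Otimes>\<^sub>M restrict_space borel B"
  define r where "r n = 1 / real (Suc n)" for n
  have r: "r n > 0" for n by (simp add: r_def)
  have "\<exists>C. finite C \<and> C \<subseteq> A \<and> A \<subseteq> (\<Union>c\<in>C. ball c (r n))" for n
    using compactE_image[OF A, of A "\<lambda>c. ball c (r n)"] r[of n] by (metis UN_I centre_in_ball open_ball subsetI)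
  then obtain C where C: "\<And>n. finite (C n)" "\<And>n. C n \<subseteq> A" "\<And>n. A \<subseteq> (\<Union>c\<in>C n. ball c (r n))"
    by metis
  define w where "w n c x = max 0 (r n - dist c x)" for n and c x :: 'a
  define W where "W n x = (\<Sum>c\<in>C n. w n c x)" for n x
  define h where "h n p = (\<Sum>c\<in>C n. w n c (fst p) * f c (snd p)) / W n (fst p)" for n p
  have w0: "w n c x \<ge> 0" for n c x by (simp add: w_def)
  have W: "W n x > 0" if "x \<in> A" for n x
  proof -
    obtain c where "c \<in> C n" "dist c x < r n" using C(3) \<open>x \<in> A\<close> by fastforce
    then show ?thesis
      unfolding W_def using C(1) w0 by (intro sum_pos2[of _ c]) (auto simp: w_def)
  qed
  have "h n \<in> borel_measurable ?M" for n
  proof -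
    have wm: "w n c \<in> borel_measurable (restrict_space borel A)" for c
      unfolding w_def by (intro borel_measurable_continuous_on_restrict continuous_intros)
    have fm: "f c \<in> borel_measurable (restrict_space borel B)" if "c \<in> C n" for c
      using c2 C(2) that by (intro borel_measurable_continuous_on_restrict) auto
    show ?thesis
      unfolding h_def W_def
      by (intro borel_measurable_divide borel_measurable_sum borel_measurable_times
          measurable_compose[OF measurable_fst wm] measurable_compose[OF measurable_snd fm])
  qed
  moreover have "(\<lambda>n. h n p) \<longlonglongrightarrow> (case p of (x, y) \<Rightarrow> f x y)" if pM: "p \<in> space ?M" for p
  proof -
    obtain x y where p: "p = (x, y)" "x \<in> A" "y \<in> B"
      using pM by (auto simp: space_pair_measure space_restrict_space)
    have "(\<lambda>n. h n p) \<longlonglongrightarrow> f x y"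
    proof (rule LIMSEQ_I)
      fix e :: real assume "e > 0"
      then obtain d where d: "d > 0" "\<And>c. c \<in> A \<Longrightarrow> dist c x < d \<Longrightarrow> dist (f c y) (f x y) < e / 2"
        using c1[OF p(3)] p(2) unfolding continuous_on_iff by (metis half_gt_zero)
      obtain N where N: "r N < d" using reals_Archimedean[OF d(1)] by (auto simp: r_def inverse_eq_divide)
      have "norm (h n p - f x y) < e" if "n \<ge> N" for n
      proof -
        have rn: "r n < d" using N that by (smt (verit) r_def frac_le of_nat_0_less_iff of_nat_mono zero_less_Suc Suc_le_mono)
        have *: "w n c x * \<bar>f c y - f x y\<bar> \<le> w n c x * (e / 2)" if "c \<in> C n" for c
        proof (cases "dist c x < r n")
          case True
          have "c \<in> A" using C(2) \<open>c \<in> C n\<close> by blast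
          then have "\<bar>f c y - f x y\<bar> \<le> e / 2"
            using d(2)[of c] True rn by (simp add: dist_real_def)
          then show ?thesis using w0 by (rule mult_left_mono)
        qed (simp add: w_def)
        have "h n p - f x y = (\<Sum>c\<in>C n. w n c x * (f c y - f x y)) / W n x"
          using W[OF p(2), of n]
          by (simp add: h_def p field_simps sum_subtractf W_def sum_distrib_left)
        then have "\<bar>h n p - f x y\<bar> \<le> (\<Sum>c\<in>C n. w n c x * \<bar>f c y - f x y\<bar>) / W n x"
          using W[OF p(2), of n] sum_abs[of "\<lambda>c. w n c x * (f c y - f x y)" "C n"] w0
          by (simp add: abs_mult divide_right_mono)
        also have "\<dots> \<le> (\<Sum>c\<in>C n. w n c x * (e / 2)) / W n x"
          using W[OF p(2), of n] * by (intro divide_right_mono sum_mono) auto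
        also have "\<dots> = e / 2"
          using W[OF p(2), of n] by (simp add: W_def flip: sum_divide_distrib sum_distrib_right)
        finally show ?thesis using \<open>e > 0\<close> by simp
      qed
      then show "\<exists>N. \<forall>n\<ge>N. norm (h n p - f x y) < e" by blast
    qed
    then show ?thesis by (simp add: p)
  qed
  ultimately show ?thesis
    by (rule borel_measurable_LIMSEQ_metric)
qed

lemma measurable_separately_continuous:
  fixes G :: "('k, 'i::metric_space, 'j::topological_space) stoch_game"
  assumes "separately_continuous G" "compact (actions1 G)"
  shows "(\<lambda>(i, j). payoff G k i j) \<in> borel_measurable (action_space1 G \<Otimes>\<^sub>M action_space2 G)"
    and "(\<lambda>(i, j). pmf (trans_law G k i j) k') \<in> borel_measurable (action_space1 G \<Otimes>\<^sub>M action_space2 G)"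
  using assms unfolding action_space1_def action_space2_def separately_continuous_def
  by (auto intro!: borel_measurable_separately_continuous)

end

theory Submission
  imports Defs "HOL-Library.Ramsey"
begin

text \<open>
  Let \<open>k0\<close> be the only state that may be nonabsorbing and write \<open>T n\<close> for the total weight of
  the stages from \<open>n\<close> on. If a player can get \<open>w\<close> in the one-shot game with payoff
  \<open>d * g + (1 - d) * E(continuation)\<close>, where the continuation is \<open>w\<close> in \<open>k0\<close> and the absorbing
  payoff elsewhere, then playing such an action with \<open>d = \<pi> n / T n\<close> at each stage \<open>n\<close> keeps
  \<open>T n * w\<close> as a lower bound for what remains to be collected. All these \<open>d\<close> are small as long as
  \<open>T n\<close> is not small, and the order in which they come does not matter; what remains once
  \<open>T n\<close> is small is negligible. It is thus enough to have the one-shot guarantee with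
  \<open>w = v_inf k0 - \<epsilon>\<close> for all small \<open>d\<close>. By minimax its failure at some \<open>d > 0\<close> would give the
  opponent a stationary strategy that holds the \<open>d\<close>-discounted payoff down to \<open>w\<close>, which
  contradicts the uniform value by Abel summation.

  The minimax theorem for separately continuous payoffs on arbitrary compact spaces rests on the
  double limit criterion of Grothendieck, which is inherited by mixed extensions.
\<close>

subsection \<open>Separately continuous games on compact spaces\<close>

text \<open>The spaces need not be metrizable and the payoff is only separately continuous. For a
  general mixed action, continuity of the integrated payoff in the other variable does not follow
  from dominated convergence, which handles sequences only, so the usual minimax theorems do not
  apply as they stand. Finitely supported mixtures, tested by sequences, get around this; they are
  only \<open>\<epsilon>\<close>-optimal, which is why every guarantee below carries a slack.

  Absorption is what turns one failure into a contradiction. With a single nonabsorbing state a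
  candidate value is one number \<open>w\<close>, and the reply that defeats it there can be
  repeated for ever, the payoffs elsewhere being fixed. With several nonabsorbing states a reply in
  one of them would control nothing in the others.

  Two points escape the discounted comparison: stages of weight 0, which ask for the guarantee at
  \<open>d = 0\<close>, and the absorbing states, where equality of \<open>v_inf\<close> and the
  absorbing payoff is not assumed but deduced from long averages.\<close>

text \<open>Without a metric there may be no convergent subsequence, but there is a cluster point.
  Inequalities that hold eventually pass to it through continuous functions, which is all that is
  later asked of a limit.\<close>

lemma compact_cluster_point:
  fixes s :: "nat \<Rightarrow> 'a::topological_space"
  assumes "compact U" "\<And>n. s n \<in> U"
  shows "\<exists>x\<in>U. \<forall>\<phi> (c::real). continuous_on U \<phi> \<longrightarrow>
    eventually (\<lambda>n. \<phi> (s n) \<le> c) sequentially \<longrightarrow> \<phi> x \<le> c"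
proof -
  obtain x where x: "x \<in> U" "inf (nhds x) (filtermap s sequentially) \<noteq> bot"
  proof -
    have "filtermap s sequentially \<noteq> bot" by (simp add: filtermap_bot_iff)
    moreover have "eventually (\<lambda>x. x \<in> U) (filtermap s sequentially)"
      using assms(2) by (simp add: eventually_filtermap)
    ultimately show thesis
      using assms(1) that unfolding compact_filter by blast
  qed
  have "\<phi> x \<le> c" if \<phi>: "continuous_on U \<phi>" and ev: "eventually (\<lambda>n. \<phi> (s n) \<le> c) sequentially"
    for \<phi> and c :: real
  proof (rule ccontr)
    assume "\<not> \<phi> x \<le> c"
    then have "x \<in> \<phi> -` {c<..} \<inter> U" using x by auto
    moreover obtain T where T: "open T" "T \<inter> U = \<phi> -` {c<..} \<inter> U"
      using \<phi> unfolding continuous_on_open_invariant by (metis open_greaterThan)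
    ultimately have "eventually (\<lambda>y. y \<in> T) (nhds x)"
      by (intro eventually_nhds_in_open) auto
    moreover have "eventually (\<lambda>y. y \<notin> T) (filtermap s sequentially)"
      unfolding eventually_filtermap using ev
    proof eventually_elim
      case (elim n)
      then have "s n \<notin> \<phi> -` {c<..} \<inter> U" by simp
      then show ?case using T(2) assms(2)[of n] by blast
    qed
    ultimately have "eventually (\<lambda>y. False) (inf (nhds x) (filtermap s sequentially))"
      unfolding eventually_inf by blast
    with x(2) show False by (simp add: trivial_limit_def)
  qed
  with x(1) show ?thesis by auto
qed

text \<open>Diagonal extraction by Tychonoff: the product of intervals is compact, and it is first
  countable because the index type is countable, so it is sequentially compact.\<close>

lemma bounded_pointwise_convergent_subseq:
  fixes \<phi> :: "nat \<Rightarrow> 'c::countable \<Rightarrow> real"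
  assumes "\<And>n c. \<bar>\<phi> n c\<bar> \<le> K"
  obtains r l where "strict_mono (r :: nat \<Rightarrow> nat)" "\<And>c. (\<lambda>n. \<phi> (r n) c) \<longlonglongrightarrow> l c"
proof -
  have "compactin (product_topology (\<lambda>_::'c. euclidean) UNIV) (PiE UNIV (\<lambda>_. {-K..K}))"
    by (subst compactin_PiE) auto
  then have "compact (PiE UNIV (\<lambda>_::'c. {-K..K}))"
    by (simp add: euclidean_product_topology)
  then have "seq_compact (PiE UNIV (\<lambda>_::'c. {-K..K}))"
    by (rule compact_imp_seq_compact)
  moreover have "\<forall>n. \<phi> n \<in> PiE UNIV (\<lambda>_. {-K..K})"
  proof
    fix n
    have "- K \<le> \<phi> n c" "\<phi> n c \<le> K" for c
      using assms[of n c] by linarith+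
    then show "\<phi> n \<in> PiE UNIV (\<lambda>_. {-K..K})" by auto
  qed
  ultimately obtain l r where r: "strict_mono (r :: nat \<Rightarrow> nat)" "(\<phi> \<circ> r) \<longlonglongrightarrow> l"
    by (rule seq_compactE)
  have "(\<lambda>n. (\<phi> \<circ> r) n c) \<longlonglongrightarrow> l c" for c
    using continuous_on_tendsto_compose[OF continuous_on_product_coordinates[of c] r(2)] by auto
  with r(1) show thesis by (intro that) (auto simp: o_def)
qed

text \<open>The double limit criterion, in the form that no pair of sequences orders \<open>F\<close>; unlike
  iterated limits this needs no convergence.\<close>

definition stable :: "('a \<Rightarrow> 'b \<Rightarrow> real) \<Rightarrow> 'a set \<Rightarrow> 'b set \<Rightarrow> bool" where
  "stable F A B \<longleftrightarrow> (\<forall>(x :: nat \<Rightarrow> 'a) (y :: nat \<Rightarrow> 'b) c d.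
     range x \<subseteq> A \<longrightarrow> range y \<subseteq> B \<longrightarrow> (\<forall>m n. m < n \<longrightarrow> F (x m) (y n) \<le> c) \<longrightarrow>
     (\<forall>m n. n < m \<longrightarrow> d \<le> F (x m) (y n)) \<longrightarrow> d \<le> c)"

lemma stableI:
  fixes F :: "'a \<Rightarrow> 'b \<Rightarrow> real"
  assumes "\<And>x y c d. \<lbrakk>\<And>n::nat. x n \<in> A; \<And>n::nat. y n \<in> B; c < d;
     \<And>m n. m < n \<Longrightarrow> F (x m) (y n) \<le> c; \<And>m n. n < m \<Longrightarrow> d \<le> F (x m) (y n)\<rbrakk> \<Longrightarrow> False"
  shows "stable F A B"
  unfolding stable_def
proof (intro allI impI, rule ccontr)
  fix x :: "nat \<Rightarrow> 'a" and y :: "nat \<Rightarrow> 'b" and c d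
  assume *: "range x \<subseteq> A" "range y \<subseteq> B" "\<forall>m n. m < n \<longrightarrow> F (x m) (y n) \<le> c"
    "\<forall>m n. n < m \<longrightarrow> d \<le> F (x m) (y n)" "\<not> d \<le> c"
  show False
    by (rule assms[of x y c d]) (use * in auto)
qed

lemma stableD:
  assumes "stable F A B" "\<And>n::nat. x n \<in> A" "\<And>n::nat. y n \<in> B" "c < d"
    "\<And>m n. m < n \<Longrightarrow> F (x m) (y n) \<le> c" "\<And>m n. n < m \<Longrightarrow> d \<le> F (x m) (y n)"
  shows False
proof -
  have "range x \<subseteq> A" "range y \<subseteq> B" using assms(2,3) by auto
  with assms(1,5,6) have "d \<le> c"
    unfolding stable_def by meson
  with assms(4) show False by simp
qed

text \<open>Exchanging the arguments reverses the order of the indices and the sign reverses the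
  inequalities. Results that treat one argument thus transfer to the other.\<close>

lemma stable_swap:
  assumes "stable F A B"
  shows "stable (\<lambda>y x. - F x y) B A"
proof (rule stableI)
  fix x y c d
  assume *: "\<And>n::nat. x n \<in> B" "\<And>n::nat. y n \<in> A" "c < d"
    "\<And>m n. m < n \<Longrightarrow> - F (y n) (x m) \<le> c" "\<And>m n. n < m \<Longrightarrow> d \<le> - F (y n) (x m)"
  show False
  proof (rule stableD[OF assms *(2,1), of "-d" "-c"])
    show "F (y m) (x n) \<le> - d" if "m < n" for m n using *(5)[OF that] by simp
    show "- c \<le> F (y m) (x n)" if "n < m" for m n using *(4)[OF that] by simp
  qed (use *(3) in simp)
qed

text \<open>Evaluate \<open>f\<close> at a pair of cluster points. Moving the second argument before
  the first gives \<open>f x' y' \<le> c\<close>, the other order gives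
  \<open>d \<le> f x' y'\<close>. Each passage moves one variable, so separate continuity
  suffices.\<close>

lemma stable_compact:
  fixes f :: "'a::topological_space \<Rightarrow> 'b::topological_space \<Rightarrow> real"
  assumes A: "compact A" and B: "compact B"
    and c1: "\<And>y. y \<in> B \<Longrightarrow> continuous_on A (\<lambda>x. f x y)"
    and c2: "\<And>x. x \<in> A \<Longrightarrow> continuous_on B (f x)"
  shows "stable f A B"
proof (rule stableI)
  fix x y c d
  assume x: "\<And>n::nat. x n \<in> A" and y: "\<And>n::nat. y n \<in> B" and "c < d"
    and 1: "\<And>m n. m < n \<Longrightarrow> f (x m) (y n) \<le> c" and 2: "\<And>m n. n < m \<Longrightarrow> d \<le> f (x m) (y n)"
  obtain x' where x': "x' \<in> A" "\<And>\<phi> c :: real. continuous_on A \<phi> \<Longrightarrow>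
      eventually (\<lambda>n. \<phi> (x n) \<le> c) sequentially \<Longrightarrow> \<phi> x' \<le> c"
    using compact_cluster_point[OF A, of x] x by auto
  obtain y' where y': "y' \<in> B" "\<And>\<phi> c :: real. continuous_on B \<phi> \<Longrightarrow>
      eventually (\<lambda>n. \<phi> (y n) \<le> c) sequentially \<Longrightarrow> \<phi> y' \<le> c"
    using compact_cluster_point[OF B, of y] y by auto
  have "f (x m) y' \<le> c" for m
  proof (rule y'(2))
    show "eventually (\<lambda>n. f (x m) (y n) \<le> c) sequentially"
      by (rule eventually_sequentiallyI[of "Suc m"]) (simp add: 1)
  qed (rule c2[OF x])
  then have "f x' y' \<le> c"
    by (intro x'(2)[OF c1[OF y'(1)]] always_eventually allI)
  moreover have "- f x' (y n) \<le> - d" for n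
  proof (rule x'(2))
    show "eventually (\<lambda>m. - f (x m) (y n) \<le> - d) sequentially"
      by (rule eventually_sequentiallyI[of "Suc n"]) (simp add: 2)
  qed (rule continuous_on_minus[OF c1[OF y]])
  then have "- f x' y' \<le> - d"
    by (intro y'(2)[OF continuous_on_minus[OF c2[OF x'(1)]]] always_eventually allI)
  ultimately show False using \<open>c < d\<close> by simp
qed

section \<open>The double limit criterion for mixed extensions\<close>

text \<open>Nonnegativity of the variance of \<open>X\<close>, the number of events
  \<open>A a\<close> that occur inside \<open>E\<close>. The set \<open>E\<close> will be the
  intersection of the events selected so far.\<close>

lemma square_sum_prob_le:
  fixes p :: "'b pmf"
  assumes "finite S"
  shows "(\<Sum>a\<in>S. measure p (A a \<inter> E))\<^sup>2 \<le> (\<Sum>a\<in>S. \<Sum>b\<in>S. measure p (A a \<inter> (A b \<inter> E)))"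
proof -
  define X where "X y = (\<Sum>a\<in>S. indicator (A a \<inter> E) y :: real)" for y
  have int: "integrable p (\<lambda>y. indicator D y :: real)" for D
    by (rule measure_pmf.integrable_const_bound[of _ 1]) (auto simp: indicator_def)
  have intX: "integrable p X" unfolding X_def using int by auto
  have sq: "(X y)\<^sup>2 = (\<Sum>a\<in>S. \<Sum>b\<in>S. indicator (A a \<inter> (A b \<inter> E)) y)" for y
    unfolding X_def power2_eq_square sum_product
    by (intro sum.cong refl) (auto simp: indicator_def)
  have intX2: "integrable p (\<lambda>y. (X y)\<^sup>2)" unfolding sq using int by auto
  have eX: "measure_pmf.expectation p X = (\<Sum>a\<in>S. measure p (A a \<inter> E))"
    unfolding X_def using int by (subst Bochner_Integration.integral_sum) auto
  have eX2: "measure_pmf.expectation p (\<lambda>y. (X y)\<^sup>2) = (\<Sum>a\<in>S. \<Sum>b\<in>S. measure p (A a \<inter> (A b \<inter> E)))"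
    unfolding sq using int by (simp add: Bochner_Integration.integral_sum)
  have "0 \<le> measure_pmf.variance p X" by (rule measure_pmf.variance_positive)
  also have "\<dots> = measure_pmf.expectation p (\<lambda>y. (X y)\<^sup>2) - (measure_pmf.expectation p X)\<^sup>2"
    by (rule measure_pmf.variance_eq[OF intX intX2])
  finally show ?thesis unfolding eX eX2 by simp
qed

text \<open>Pass to a limit \<open>\<nu>\<close> of the probabilities of all finite intersections. By Cauchy-Schwarz, among
  many events of probability at least \<open>\<eta>\<close> two meet with probability at least \<open>\<eta>\<^sup>2 / 2\<close>, so
  Ramsey's theorem gives infinitely many that do so pairwise; fix one of them and iterate inside
  it.\<close>

lemma infinite_subfamily_intersecting:
  fixes p :: "nat \<Rightarrow> 'b pmf" and A :: "nat \<Rightarrow> 'b set"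
  assumes \<delta>: "\<delta> > 0" and pA: "\<And>m n. m < n \<Longrightarrow> \<delta> \<le> measure (p n) (A m)"
  obtains s where "strict_mono (s :: nat \<Rightarrow> nat)"
    "\<And>r. \<exists>y\<in>\<Union>n. set_pmf (p n). \<forall>k<r. y \<in> A (s k)"
proof -
  \<comment> \<open>Lists of indices form a countable type, so a single subsequence makes the
    probabilities of all finite intersections converge at once.\<close>
  define \<phi> where "\<phi> n l = measure (p n) (\<Inter>m\<in>set l. A m)" for n l
  have "\<bar>\<phi> n l\<bar> \<le> 1" for n l by (simp add: \<phi>_def)
  then obtain r \<nu> where r: "strict_mono (r :: nat \<Rightarrow> nat)" and \<nu>: "\<And>l. (\<lambda>n. \<phi> (r n) l) \<longlonglongrightarrow> \<nu> l"
    using bounded_pointwise_convergent_subseq[of \<phi> 1] by metis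
  have \<nu>1: "\<nu> l \<le> 1" for l
    by (rule LIMSEQ_le_const2[OF \<nu>]) (auto simp: \<phi>_def)
  have sym: "\<nu> (a # b # l) = \<nu> (b # a # l)" for a b l
  proof -
    have "\<phi> n (a # b # l) = \<phi> n (b # a # l)" for n by (simp add: \<phi>_def Int_left_commute)
    then show ?thesis using \<nu>[of "a # b # l"] \<nu>[of "b # a # l"] by (simp add: LIMSEQ_unique)
  qed
  \<comment> \<open>\<open>A m\<close> is known to be likely only under the later
    \<open>p n\<close>; in the limit this restriction disappears.\<close>
  have start: "\<delta> \<le> \<nu> [m]" for m
  proof (rule LIMSEQ_le_const[OF \<nu>], intro exI allI impI)
    fix n assume "Suc m \<le> n"
    then have "m < r n" using seq_suble[OF r, of n] by simp
    then show "\<delta> \<le> \<phi> (r n) [m]" using pA by (simp add: \<phi>_def)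
  qed
  have CS: "(\<Sum>a\<in>S. \<nu> (a # l))\<^sup>2 \<le> (\<Sum>a\<in>S. \<Sum>b\<in>S. \<nu> (a # b # l))" if "finite S" for S l
  proof (rule LIMSEQ_le)
    show "(\<lambda>n. (\<Sum>a\<in>S. \<phi> (r n) (a # l))\<^sup>2) \<longlonglongrightarrow> (\<Sum>a\<in>S. \<nu> (a # l))\<^sup>2"
      "(\<lambda>n. \<Sum>a\<in>S. \<Sum>b\<in>S. \<phi> (r n) (a # b # l)) \<longlonglongrightarrow> (\<Sum>a\<in>S. \<Sum>b\<in>S. \<nu> (a # b # l))"
      by (intro tendsto_intros \<nu>)+
    show "\<exists>N. \<forall>n\<ge>N. (\<Sum>a\<in>S. \<phi> (r n) (a # l))\<^sup>2 \<le> (\<Sum>a\<in>S. \<Sum>b\<in>S. \<phi> (r n) (a # b # l))"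
      using square_sum_prob_le[OF that, of _ A "\<Inter>m\<in>set l. A m"] by (simp add: \<phi>_def)
  qed
  \<comment> \<open>\<open>l\<close> lists the indices selected so far, \<open>N\<close> is an
    infinite reservoir for further ones, and \<open>\<eta>\<close> bounds from below the limit mass
    left after adding any one of them.\<close>
  define Inv where "Inv = (\<lambda>(l, N, \<eta>). infinite N \<and> \<eta> > 0 \<and> (\<forall>m\<in>N. \<eta> \<le> \<nu> (m # l)))"
  define Q where "Q = (\<lambda>(l, N, \<eta>::real) (l', N', \<eta>'::real).
      \<exists>m\<in>N. l' = m # l \<and> N' \<subseteq> {m'\<in>N. (m::nat) < m'})"
  have step: "\<exists>z'. Inv z' \<and> Q z z'" if "Inv z" for z
  proof -
    obtain l N \<eta> where z: "z = (l, N, \<eta>)" by (metis prod_cases3)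
    with that have N: "infinite N" and \<eta>: "\<eta> > 0" and N\<nu>: "\<And>m. m \<in> N \<Longrightarrow> \<eta> \<le> \<nu> (m # l)"
      by (auto simp: Inv_def)
    define \<eta>' where "\<eta>' = \<eta>\<^sup>2 / 2"
    define col where "col X = (if \<exists>a b. X = {a, b} \<and> \<eta>' \<le> \<nu> (a # b # l) then 1 else 0 :: nat)" for X
    have "\<exists>Y t. Y \<subseteq> N \<and> infinite Y \<and> t < 2 \<and> (\<forall>x\<in>Y. \<forall>y\<in>Y. x \<noteq> y \<longrightarrow> col {x, y} = t)"
      by (rule Ramsey2[OF N]) (auto simp: col_def)
    then obtain Y t where Y: "Y \<subseteq> N" "infinite Y"
      and mono: "\<forall>x\<in>Y. \<forall>y\<in>Y. x \<noteq> y \<longrightarrow> col {x, y} = t"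
      by (elim exE conjE) (rule that)
    have "t \<noteq> 0"
    proof
      assume "t = 0"
      have small: "\<nu> (x # y # l) \<le> \<eta>'" if "x \<in> Y" "y \<in> Y" "x \<noteq> y" for x y
      proof (rule ccontr)
        assume "\<not> ?thesis"
        then have "\<exists>a b. {x, y} = {a, b} \<and> \<eta>' \<le> \<nu> (a # b # l)"
          by (intro exI[of _ x] exI[of _ y]) simp
        then have "col {x, y} = 1" unfolding col_def by (rule if_P)
        with mono that \<open>t = 0\<close> show False by (metis zero_neq_one)
      qed
      \<comment> \<open>If all distinct pairs met with mass at most \<open>\<eta>'\<close>, then
        \<open>CS\<close>, with the \<open>n\<close> diagonal terms bounded by 1, would give
        \<open>real n * \<eta>\<^sup>2 \<le> 2\<close>; \<open>n\<close> is taken beyond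
        that.\<close>
      obtain n where n: "2 / \<eta>\<^sup>2 < real n" using reals_Archimedean2 by blast
      then have "n > 0" using \<eta> by (intro gr0I) (auto simp: field_simps)
      obtain S where S: "finite S" "card S = n" "S \<subseteq> Y"
        using infinite_arbitrarily_large[OF Y(2)] by blast
      have "real n * \<eta> \<le> (\<Sum>a\<in>S. \<nu> (a # l))"
        using sum_bounded_below[of S \<eta> "\<lambda>a. \<nu> (a # l)"] N\<nu> S Y(1) by auto
      then have "(real n * \<eta>)\<^sup>2 \<le> (\<Sum>a\<in>S. \<nu> (a # l))\<^sup>2"
        using \<eta> by (intro power_mono) auto
      also have "\<dots> \<le> (\<Sum>a\<in>S. \<Sum>b\<in>S. \<nu> (a # b # l))" by (rule CS[OF S(1)])
      also have "\<dots> \<le> (\<Sum>a\<in>S. \<Sum>b\<in>S. (if a = b then 1 else 0) + \<eta>')"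
      proof (intro sum_mono)
        fix a b assume "a \<in> S" "b \<in> S"
        have "\<eta>' \<ge> 0" by (simp add: \<eta>'_def)
        then show "\<nu> (a # b # l) \<le> (if a = b then 1 else 0) + \<eta>'"
          using small[of a b] \<nu>1[of "a # b # l"] S(3) \<open>a \<in> S\<close> \<open>b \<in> S\<close> by auto
      qed
      also have "\<dots> = real n + (real n)\<^sup>2 * \<eta>'"
        using S by (simp add: sum.distrib power2_eq_square algebra_simps)
      finally have "real n * (real n * \<eta>\<^sup>2) \<le> real n * 2"
        by (simp add: \<eta>'_def power_mult_distrib power2_eq_square field_simps)
      then have "real n * \<eta>\<^sup>2 \<le> 2" using \<open>n > 0\<close> by simp
      with n \<eta> show False by (simp add: field_simps)
    qed
    obtain m where m: "m \<in> Y" using Y(2) by (metis finite.emptyI ex_in_conv)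
    define N' where "N' = {m'\<in>Y. m < m'}"
    have "Y \<subseteq> N' \<union> {..m}" by (auto simp: N'_def)
    then have "infinite N'" using Y(2) by (metis finite_Un finite_atMost finite_subset)
    moreover have "\<eta>' \<le> \<nu> (m' # m # l)" if "m' \<in> N'" for m'
    proof -
      have "col {m', m} = t" using that m mono by (metis (mono_tags, lifting) N'_def mem_Collect_eq nat_neq_iff)
      then obtain a b where ab: "{m', m} = {a, b}" "\<eta>' \<le> \<nu> (a # b # l)"
        using \<open>t \<noteq> 0\<close> unfolding col_def by meson
      then show ?thesis using sym[of m m' l] by (auto simp: doubleton_eq_iff)
    qed
    moreover have "\<eta>' > 0" using \<eta> by (simp add: \<eta>'_def)
    ultimately have "Inv (m # l, N', \<eta>')" by (auto simp: Inv_def)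
    moreover have "Q z (m # l, N', \<eta>')" using m Y(1) by (auto simp: Q_def z N'_def)
    ultimately show ?thesis by blast
  qed
  have "Inv ([], UNIV, \<delta>)" using start \<delta> by (auto simp: Inv_def)
  then have "\<exists>z. (\<forall>n::nat. Inv (z n)) \<and> (\<forall>n. Q (z n) (z (Suc n)))"
    using dependent_nat_choice[of "\<lambda>_. Inv" "\<lambda>_. Q"] step by (metis (no_types, lifting))
  then obtain z where z: "\<And>n::nat. Inv (z n)" "\<And>n. Q (z n) (z (Suc n))" by blast
  define l where "l n = fst (z n)" for n
  define N where "N n = fst (snd (z n))" for n
  define s where "s n = hd (l (Suc n))" for n
  have s: "s n \<in> N n \<and> l (Suc n) = s n # l n \<and> N (Suc n) \<subseteq> {m'\<in>N n. s n < m'}" for n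
    using z(2)[of n] unfolding Q_def s_def l_def N_def by (auto simp: split_beta)
  have pos: "0 < \<nu> (s n # l n)" for n
    using z(1)[of n] s[of n] unfolding Inv_def l_def N_def by (force simp: split_beta)
  have l: "s ` {..<n} \<subseteq> set (l n)" for n
  proof (induction n)
    case (Suc n)
    then show ?case using s[of n] by (simp add: lessThan_Suc subset_insertI2)
  qed auto
  show thesis
  proof (rule that)
    show "strict_mono s"
      unfolding strict_mono_Suc_iff using s by blast
    fix k
    \<comment> \<open>A positive limit forces a positive probability under some
      \<open>p (r n)\<close>, and hence a common point in its support.\<close>
    have "\<exists>n. \<phi> (r n) (s k # l k) > 0"
    proof (rule ccontr)
      assume "\<not> ?thesis"
      then have "\<phi> (r n) (s k # l k) \<le> 0" for n by (simp add: not_less)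
      then have "\<nu> (s k # l k) \<le> 0" by (intro LIMSEQ_le_const2[OF \<nu>]) blast
      with pos[of k] show False by simp
    qed
    then obtain n where n: "0 < \<phi> (r n) (s k # l k)" by (elim exE)
    define D where "D = (\<Inter>m\<in>set (s k # l k). A m)"
    have "measure (p (r n)) D \<noteq> 0"
      using n unfolding \<phi>_def D_def by (rule less_imp_neq[THEN not_sym])
    then obtain y where y: "y \<in> set_pmf (p (r n))" "y \<in> D"
      unfolding measure_pmf_zero_iff by auto
    have "y \<in> A (s j)" if "j < k" for j
    proof -
      have "s j \<in> s ` {..<k}" using that by (intro imageI) simp
      then have "s j \<in> set (l k)" by (rule subsetD[OF l])
      then have "s j \<in> set (s k # l k)" by (rule list.set_intros(2))
      then show ?thesis using y(2)[unfolded D_def] by (rule INT_D[rotated])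
    qed
    moreover have "y \<in> (\<Union>n. set_pmf (p n))" using y(1) by (intro UN_I UNIV_I)
    ultimately show "\<exists>y\<in>\<Union>n. set_pmf (p n). \<forall>j<k. y \<in> A (s j)"
      by (intro bexI[of _ y] allI impI)
  qed
qed

text \<open>Finite support turns expectations into finite sums, which exist for every integrand and
  commute with pointwise limits.\<close>

definition fin_pmfs :: "'a set \<Rightarrow> 'a pmf set" where
  "fin_pmfs A = {p. finite (set_pmf p) \<and> set_pmf p \<subseteq> A}"

text \<open>If \<open>x\<close> and the mixed \<open>p\<close> order the mixed extension and \<open>f (x m)\<close> tends to \<open>h\<close>, then each of the
  events \<open>f (x m) \<le> h - \<eta>\<close> has probability bounded below under all later \<open>p n\<close>. Points in finite
  intersections of infinitely many of these events order \<open>f\<close> itself.\<close>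

lemma stable_mixed:
  fixes f :: "'a \<Rightarrow> 'b \<Rightarrow> real"
  assumes st: "stable f A B" and K: "\<And>x y. x \<in> A \<Longrightarrow> y \<in> B \<Longrightarrow> \<bar>f x y\<bar> \<le> K"
  shows "stable (\<lambda>x p. measure_pmf.expectation p (f x)) A (fin_pmfs B)"
proof (rule stableI)
  fix x p c d
  assume xA: "\<And>n::nat. x n \<in> A" and pB: "\<And>n::nat. p n \<in> fin_pmfs B" and "c < d"
    and le: "\<And>m n. m < n \<Longrightarrow> measure_pmf.expectation (p n) (f (x m)) \<le> c"
    and ge: "\<And>m n. n < m \<Longrightarrow> d \<le> measure_pmf.expectation (p n) (f (x m))"
  \<comment> \<open>Only points charged by some \<open>p n\<close> matter. They are countably many,
    so \<open>f (x m)\<close> can be made to converge at all of them along one subsequence.\<close>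
  define J where "J = (\<Union>n. set_pmf (p n))"
  have J: "countable J" "J \<noteq> {}" "J \<subseteq> B"
    using pB by (auto simp: J_def fin_pmfs_def intro!: countable_finite set_pmf_not_empty)
  define e where "e = from_nat_into J"
  have e: "range e = J" unfolding e_def using J(2,1) by (rule range_from_nat_into)
  have eB: "e k \<in> B" for k using e J(3) by auto
  obtain r l where r: "strict_mono (r :: nat \<Rightarrow> nat)"
    and l: "\<And>k. (\<lambda>m. f (x (r m)) (e k)) \<longlonglongrightarrow> l k"
    using bounded_pointwise_convergent_subseq[of "\<lambda>m k. f (x m) (e k)" K] K[OF xA eB] by metis
  \<comment> \<open>Meaningful on \<open>J\<close> only; outside of it the limit need not
    exist.\<close>
  define h where "h y = lim (\<lambda>m. f (x (r m)) y)" for y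
  have h: "(\<lambda>m. f (x (r m)) y) \<longlonglongrightarrow> h y" if "y \<in> J" for y
  proof -
    have "y \<in> range e" using that e by simp
    then obtain k where "y = e k" by blast
    then show ?thesis using l[of k] limI[OF l[of k]] by (simp add: h_def)
  qed
  have hK: "\<bar>h y\<bar> \<le> K" if "y \<in> J" for y
    by (rule LIMSEQ_le_const2[OF tendsto_rabs[OF h[OF that]]]) (use K xA that J(3) in auto)
  have fin: "finite (set_pmf (p n))" and setJ: "set_pmf (p n) \<subseteq> J" for n
    using pB[of n] by (auto simp: fin_pmfs_def J_def)
  define \<eta> where "\<eta> = (d - c) / 2"
  have \<eta>: "\<eta> > 0" using \<open>c < d\<close> by (simp add: \<eta>_def)
  have Eh: "d \<le> measure_pmf.expectation (p (r n)) h" for n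
  proof (rule LIMSEQ_le_const)
    have E: "measure_pmf.expectation (p (r n)) g = (\<Sum>y\<in>set_pmf (p (r n)). g y * pmf (p (r n)) y)" for g
      by (rule integral_measure_pmf_real[OF fin])
    show "(\<lambda>m. measure_pmf.expectation (p (r n)) (f (x (r m)))) \<longlonglongrightarrow> measure_pmf.expectation (p (r n)) h"
      unfolding E using setJ by (intro tendsto_intros h) auto
    show "\<exists>N. \<forall>m\<ge>N. d \<le> measure_pmf.expectation (p (r n)) (f (x (r m)))"
      by (intro exI[of _ "Suc n"] allI impI ge strict_monoD[OF r]) simp
  qed
  define D where "D m = {y \<in> J. \<eta> \<le> h y - f (x (r m)) y}" for m
  \<comment> \<open>The summand 1 makes \<open>K'\<close> positive even if \<open>K = 0\<close>, so
    that it can be divided by.\<close>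
  define K' where "K' = \<bar>K\<bar> + 1"
  have K': "K' > 0" by (simp add: K'_def)
  \<comment> \<open>A Markov-type estimate: \<open>h - f (x (r m))\<close> has mean at least
    \<open>2 * \<eta>\<close>, is below \<open>\<eta>\<close> on \<open>J\<close> outside
    \<open>D m\<close> and never exceeds \<open>2 * K'\<close> on \<open>J\<close>.\<close>
  have prob: "\<eta> / (2 * K') \<le> measure (p (r n)) (D m)" if "m < n" for m n
  proof -
    let ?E = "measure_pmf.expectation (p (r n))"
    note int = integrable_measure_pmf_finite[OF fin]
    have "2 * \<eta> \<le> ?E h - ?E (f (x (r m)))"
      using Eh[of n] le[OF strict_monoD[OF r that]] by (simp add: \<eta>_def)
    also have "\<dots> = ?E (\<lambda>y. h y - f (x (r m)) y)"
      by (rule Bochner_Integration.integral_diff[symmetric]) (rule int)+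
    also have "\<dots> \<le> ?E (\<lambda>y. \<eta> + 2 * K' * indicator (D m) y)"
    proof (intro integral_mono_AE int, unfold AE_measure_pmf_iff, intro ballI)
      fix y assume "y \<in> set_pmf (p (r n))"
      then have yJ: "y \<in> J" using setJ by auto
      have "\<bar>f (x (r m)) y\<bar> \<le> K" using K xA yJ J(3) by auto
      then have "h y - f (x (r m)) y \<le> 2 * K'" using hK[OF yJ] by (simp add: K'_def)
      then show "h y - f (x (r m)) y \<le> \<eta> + 2 * K' * indicator (D m) y"
        using \<eta> yJ by (auto simp: D_def indicator_def)
    qed
    also have "\<dots> = \<eta> + 2 * K' * measure (p (r n)) (D m)"
      by (subst Bochner_Integration.integral_add) (auto intro!: int)
    finally show ?thesis using K' by (simp add: field_simps)
  qed
  have "\<eta> / (2 * K') > 0" using \<eta> K' by simp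
  then obtain s where s: "strict_mono (s :: nat \<Rightarrow> nat)"
    and inter: "\<And>k. \<exists>y\<in>\<Union>n. set_pmf (p (r n)). \<forall>j<k. y \<in> D (s j)"
    by (rule infinite_subfamily_intersecting[of _ "\<lambda>n. p (r n)" D, OF _ prob]) auto
  define z where "z j = x (r (s j))" for j
  have "\<exists>y\<in>J. \<forall>j<k. f (z j) y \<le> h y - \<eta>" for k
    using inter[of k] setJ by (force simp: D_def z_def)
  then obtain y where y: "\<And>k. y k \<in> J" "\<And>j k. j < k \<Longrightarrow> f (z j) (y k) \<le> h (y k) - \<eta>"
    by metis
  have zlim: "(\<lambda>j. f (z j) (y k)) \<longlonglongrightarrow> h (y k)" for k
    using LIMSEQ_subseq_LIMSEQ[OF h[OF y(1)] s] by (simp add: z_def o_def)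
  \<comment> \<open>The threshold \<open>h (y k) - \<eta>\<close> still depends on \<open>k\<close>.
    Along \<open>t\<close> it converges, so that constants can separate the two sides.\<close>
  obtain t T where t: "strict_mono (t :: nat \<Rightarrow> nat)" and T: "(\<lambda>n. h (y (t n))) \<longlonglongrightarrow> T"
    using bounded_pointwise_convergent_subseq[of "\<lambda>n (_::unit). h (y n)" K] hK[OF y(1)] by metis
  obtain N where N: "\<And>n. N \<le> n \<Longrightarrow> \<bar>h (y (t n)) - T\<bar> < \<eta> / 8"
    using LIMSEQ_D[OF T, of "\<eta> / 8"] \<eta> by auto
  have "\<exists>S. \<forall>j\<ge>S. h (y (t n)) - \<eta> / 8 \<le> f (z j) (y (t n))" for n
  proof -
    obtain S where "\<And>j. S \<le> j \<Longrightarrow> \<bar>f (z j) (y (t n)) - h (y (t n))\<bar> < \<eta> / 8"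
      using LIMSEQ_D[OF zlim[of "t n"], of "\<eta> / 8"] \<eta> by auto
    then show ?thesis by (intro exI[of _ S]) (smt (verit))
  qed
  then obtain S where S: "\<And>n j. S n \<le> j \<Longrightarrow> h (y (t n)) - \<eta> / 8 \<le> f (z j) (y (t n))"
    by metis
  \<comment> \<open>Indices are spaced out so that every later \<open>z\<close> is already within
    \<open>\<eta> / 8\<close> below its limit at every earlier \<open>y\<close>. As \<open>h\<close>
    is within \<open>\<eta> / 8\<close> of \<open>T\<close>, the two sides end up at
    \<open>T - 7 * \<eta> / 8\<close> and \<open>T - \<eta> / 4\<close>.\<close>
  define u where "u = rec_nat N (\<lambda>_ v. max (Suc v) (S v))"
  have u0: "u 0 = N" and uS: "u (Suc n) = max (Suc (u n)) (S (u n))" for n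
    by (simp_all add: u_def)
  have u: "strict_mono u" by (simp add: strict_mono_Suc_iff uS less_max_iff_disj)
  have uN: "N \<le> u n" for n using strict_mono_less_eq[OF u, of 0 n] u0 by simp
  show False
  proof (rule stableD[OF st, of "\<lambda>n. z (u n)" "\<lambda>n. y (t (u n))" "T - 7 * \<eta> / 8" "T - \<eta> / 4"])
    show "z (u n) \<in> A" for n by (simp add: z_def xA)
    show "y (t (u n)) \<in> B" for n using y(1) J(3) by auto
    show "T - 7 * \<eta> / 8 < T - \<eta> / 4" using \<eta> by simp
    show "f (z (u m)) (y (t (u n))) \<le> T - 7 * \<eta> / 8" if "m < n" for m n
    proof -
      have "u m < t (u n)"
        using strict_monoD[OF u that] seq_suble[OF t, of "u n"] by simp
      from y(2)[OF this] N[OF uN[of n]] show ?thesis by linarith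
    qed
    show "T - \<eta> / 4 \<le> f (z (u m)) (y (t (u n)))" if "n < m" for m n
    proof -
      have "S (u n) \<le> u (Suc n)" by (simp add: uS)
      also have "\<dots> \<le> u m" using that strict_mono_less_eq[OF u, of "Suc n" m] by simp
      finally show ?thesis using S[of "u n" "u m"] N[OF uN[of n]] by linarith
    qed
  qed
qed

section \<open>Minimax under the double limit criterion\<close>

text \<open>Fan's convexlike condition, with equality: mixtures exist as far as payoffs can tell.
  This asks for no vector space structure, which the type of pmfs does not carry.\<close>

definition affinelike :: "('a \<Rightarrow> 'b \<Rightarrow> real) \<Rightarrow> 'a set \<Rightarrow> 'b set \<Rightarrow> bool" where
  "affinelike F A B \<longleftrightarrow> (\<forall>x\<in>A. \<forall>x'\<in>A. \<forall>t\<in>{0..1}. \<exists>z\<in>A. \<forall>y\<in>B. F z y = (1 - t) * F x y + t * F x' y)"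

lemma affinelike_minus:
  assumes "affinelike G P Q"
  shows "affinelike (\<lambda>x y. - G x y) P Q"
  unfolding affinelike_def
proof (intro ballI)
  fix x x' and t :: real assume "x \<in> P" "x' \<in> P" "t \<in> {0..1}"
  then obtain z where "z \<in> P" "\<And>y. y \<in> Q \<Longrightarrow> G z y = (1 - t) * G x y + t * G x' y"
    using assms unfolding affinelike_def by blast
  then show "\<exists>z\<in>P. \<forall>y\<in>Q. - G z y = (1 - t) * - G x y + t * - G x' y"
    by (intro bexI[of _ z]) auto
qed

text \<open>Separation in the plane: the image of \<open>Y\<close> under \<open>\<phi>\<close> and
  \<open>\<psi>\<close> is convex and avoids the open quadrant below \<open>(c, c)\<close>. A point
  with \<open>\<phi> y < c\<close> demands \<open>t \<ge> R y\<close>, a point with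
  \<open>\<psi> y < c\<close> bounds \<open>t\<close> from above; every lower bound lies below every
  upper bound, since otherwise the segment between the two points would enter the quadrant. So the
  supremum of the lower bounds serves.\<close>

lemma two_function_alternative:
  fixes \<phi> \<psi> :: "'b \<Rightarrow> real"
  assumes conv: "\<And>y y' t. y \<in> Y \<Longrightarrow> y' \<in> Y \<Longrightarrow> t \<in> {0..1} \<Longrightarrow>
      \<exists>z\<in>Y. \<phi> z = (1 - t) * \<phi> y + t * \<phi> y' \<and> \<psi> z = (1 - t) * \<psi> y + t * \<psi> y'"
    and ge: "\<And>y. y \<in> Y \<Longrightarrow> c \<le> \<phi> y \<or> c \<le> \<psi> y"
  shows "\<exists>t\<in>{0..1}. \<forall>y\<in>Y. c \<le> (1 - t) * \<phi> y + t * \<psi> y"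
proof -
  define R where "R y = (c - \<phi> y) / ((c - \<phi> y) + (\<psi> y - c))" for y
  \<comment> \<open>The element 0 keeps the set nonempty when no point has
    \<open>\<phi> y < c\<close>, and makes \<open>t\<close> nonnegative.\<close>
  define T where "T = insert 0 (R ` {y \<in> Y. \<phi> y < c})"
  have R1: "R y \<le> 1" if "y \<in> Y" "\<phi> y < c" for y
    using ge[OF that(1)] that(2) by (auto simp: R_def divide_le_eq)
  have bdd: "bdd_above T" by (rule bdd_aboveI[of _ 1]) (auto simp: T_def R1)
  define t where "t = Sup T"
  have t0: "0 \<le> t" unfolding t_def by (rule cSup_upper[OF _ bdd]) (simp add: T_def)
  have t1: "t \<le> 1" unfolding t_def by (rule cSup_least) (auto simp: T_def R1)
  have "c \<le> (1 - t) * \<phi> y + t * \<psi> y" if y: "y \<in> Y" for y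
  proof -
    consider "\<phi> y < c" | "c \<le> \<phi> y" "c \<le> \<psi> y" | "\<psi> y < c" "c \<le> \<phi> y" by linarith
    then show ?thesis
    proof cases
      case 1
      have "R y \<le> t" unfolding t_def by (rule cSup_upper[OF _ bdd]) (use 1 y in \<open>auto simp: T_def\<close>)
      moreover have "0 < \<psi> y - \<phi> y" using ge[OF y] 1 by simp
      ultimately have "c - \<phi> y \<le> t * (\<psi> y - \<phi> y)"
        by (simp add: R_def divide_le_eq)
      then show ?thesis by (simp add: algebra_simps)
    next
      case 2
      have "c = (1 - t) * c + t * c" by (simp add: algebra_simps)
      also have "\<dots> \<le> (1 - t) * \<phi> y + t * \<psi> y"
        using 2 t0 t1 by (intro add_mono mult_left_mono) auto
      finally show ?thesis .
    next
      case 3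
      define p q where "p = \<phi> y - c" and "q = c - \<psi> y"
      have pq: "0 \<le> p" "0 < q" using 3 by (auto simp: p_def q_def)
      have "t \<le> p / (p + q)"
        unfolding t_def
      proof (rule cSup_least)
        fix w assume "w \<in> T"
        then consider "w = 0" | y' where "y' \<in> Y" "\<phi> y' < c" "w = R y'" by (auto simp: T_def)
        then show "w \<le> p / (p + q)"
        proof cases
          case 1
          then show ?thesis using pq by simp
        next
          case 2
          define a b where "a = c - \<phi> y'" and "b = \<psi> y' - c"
          have ab: "0 < a" "0 \<le> b" using 2 ge[OF 2(1)] by (auto simp: a_def b_def)
          have "a * q \<le> p * b"
          proof (rule ccontr)
            assume less: "\<not> a * q \<le> p * b"
            define Z where "Z = a + b + p + q"
            have Z: "Z > 0" using ab pq by (simp add: Z_def)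
            \<comment> \<open>The segment from \<open>y'\<close> to \<open>y\<close> meets the
              diagonal at \<open>s\<close>: both coordinates of \<open>z\<close> differ from
              \<open>c\<close> by \<open>(p * b - a * q) / Z\<close>, which is negative.\<close>
            define s where "s = (a + b) / Z"
            have s: "s \<in> {0..1}" "1 - s = (p + q) / Z"
              using ab pq Z by (auto simp: s_def Z_def field_simps)
            obtain z where z: "z \<in> Y" "\<phi> z = (1 - s) * \<phi> y' + s * \<phi> y" "\<psi> z = (1 - s) * \<psi> y' + s * \<psi> y"
              using conv[OF 2(1) y s(1)] by blast
            have "\<phi> z - c = s * p - (1 - s) * a"
              unfolding z(2) by (simp add: a_def p_def algebra_simps)
            also have "\<dots> = (p * b - a * q) / Z"
              unfolding s(2) by (simp add: s_def algebra_simps flip: diff_divide_distrib add_divide_distrib)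
            finally have "\<phi> z - c < 0" using less Z by (simp add: divide_less_0_iff)
            then have "\<phi> z < c" by simp
            have "\<psi> z - c = (1 - s) * b - s * q"
              unfolding z(3) by (simp add: b_def q_def algebra_simps)
            then have "\<psi> z - c = (p * b - a * q) / Z"
              unfolding s(2) by (simp add: s_def algebra_simps flip: diff_divide_distrib add_divide_distrib)
            then have "\<psi> z - c < 0" using less Z by (simp add: divide_less_0_iff)
            with \<open>\<phi> z < c\<close> show False using ge[OF z(1)] by simp
          qed
          then have "a / (a + b) \<le> p / (p + q)"
            using ab pq by (simp add: field_simps)
          then show ?thesis using 2(3) by (simp add: R_def a_def b_def)
        qed
      qed (simp add: T_def)
      then have "t * (p + q) \<le> p" using pq by (simp add: le_divide_eq)
      then show ?thesis by (simp add: p_def q_def algebra_simps)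
    qed
  qed
  with t0 t1 show ?thesis by (intro bexI[of _ t]) auto
qed

text \<open>The constraint set \<open>S\<close> makes the induction on \<open>X\<close> go through: a new function \<open>F x\<close> is first
  assumed to be small, and the two-function case then removes that assumption.\<close>

lemma finite_alternative:
  assumes A: "affinelike F A B" and B: "affinelike (\<lambda>y x. F x y) B A" and "A \<noteq> {}"
    and "finite X" "X \<subseteq> A" "S \<subseteq> A"
    and "\<And>y. y \<in> B \<Longrightarrow> (\<And>x. x \<in> S \<Longrightarrow> F x y < c) \<Longrightarrow> \<exists>x\<in>X. c \<le> F x y"
  shows "\<exists>z\<in>A. \<forall>y\<in>B. (\<forall>x\<in>S. F x y < c) \<longrightarrow> c \<le> F z y"
  using assms(4-)
proof (induction X arbitrary: S rule: finite_induct)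
  case empty
  with \<open>A \<noteq> {}\<close> show ?case by blast
next
  case (insert x X)
  have xA: "x \<in> A" using insert by auto
  have "\<exists>z\<in>A. \<forall>y\<in>B. (\<forall>x\<in>insert x S. F x y < c) \<longrightarrow> c \<le> F z y"
  proof (rule insert.IH)
    fix y assume "y \<in> B" and *: "\<And>x'. x' \<in> insert x S \<Longrightarrow> F x' y < c"
    then obtain x' where "x' \<in> insert x X" "c \<le> F x' y" using insert.prems(3)[of y] by auto
    with *[of x] show "\<exists>x'\<in>X. c \<le> F x' y" by auto
  qed (use insert.prems in auto)
  then obtain z where z: "z \<in> A" "\<And>y. y \<in> B \<Longrightarrow> F x y < c \<Longrightarrow> \<forall>x\<in>S. F x y < c \<Longrightarrow> c \<le> F z y"
    by auto
  \<comment> \<open>The constraints are strict upper bounds and mix affinely in \<open>y\<close>, so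
    \<open>Y\<close> admits mixtures and the alternative can be applied on it.\<close>
  define Y where "Y = {y \<in> B. \<forall>x\<in>S. F x y < c}"
  have "\<exists>t\<in>{0..1}. \<forall>y\<in>Y. c \<le> (1 - t) * F x y + t * F z y"
  proof (rule two_function_alternative)
    fix y y' and t :: real assume y: "y \<in> Y" "y' \<in> Y" and t: "t \<in> {0..1}"
    then obtain w where w: "w \<in> B" "\<And>x. x \<in> A \<Longrightarrow> F x w = (1 - t) * F x y + t * F x y'"
      using B unfolding affinelike_def Y_def by blast
    have "F x' w < c" if "x' \<in> S" for x'
    proof -
      have "F x' y < c" "F x' y' < c" using y that by (auto simp: Y_def)
      then have "(1 - t) * F x' y + t * F x' y' < c"
        using t by (intro convex_bound_lt) auto
      then show ?thesis using w(2)[of x'] insert.prems(2) that by auto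
    qed
    with w have "w \<in> Y" by (simp add: Y_def)
    then show "\<exists>w\<in>Y. F x w = (1 - t) * F x y + t * F x y' \<and> F z w = (1 - t) * F z y + t * F z y'"
      using w(2) xA z(1) by blast
  next
    fix y assume "y \<in> Y"
    then show "c \<le> F x y \<or> c \<le> F z y" using z(2)[of y] by (force simp: Y_def)
  qed
  then obtain t where t: "t \<in> {0..1}" "\<And>y. y \<in> Y \<Longrightarrow> c \<le> (1 - t) * F x y + t * F z y" by blast
  obtain w where "w \<in> A" "\<And>y. y \<in> B \<Longrightarrow> F w y = (1 - t) * F x y + t * F z y"
    using A xA z(1) t(1) unfolding affinelike_def by blast
  with t(2) show ?case by (intro bexI[of _ w]) (auto simp: Y_def)
qed

text \<open>If the value did not exist, each player could answer any finite set of actions of the other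
  one with a uniform margin; playing these answers in turn orders \<open>F\<close>.\<close>

theorem minimax_stable:
  fixes F :: "'a \<Rightarrow> 'b \<Rightarrow> real"
  assumes A: "affinelike F A B" and B: "affinelike (\<lambda>y x. F x y) B A" and ne: "A \<noteq> {}" "B \<noteq> {}"
    and st: "stable F A B" and K: "\<And>x y. x \<in> A \<Longrightarrow> y \<in> B \<Longrightarrow> \<bar>F x y\<bar> \<le> K"
  shows "\<exists>v. \<forall>\<epsilon>>0. (\<exists>x\<in>A. \<forall>y\<in>B. v - \<epsilon> \<le> F x y) \<and> (\<exists>y\<in>B. \<forall>x\<in>A. F x y \<le> v + \<epsilon>)"
proof -
  define V where "V = {w. \<exists>x\<in>A. \<forall>y\<in>B. w \<le> F x y}"
  have VK: "w \<le> K" if w: "w \<in> V" for w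
  proof -
    obtain x where "x \<in> A" "\<forall>y\<in>B. w \<le> F x y" using w by (auto simp: V_def)
    moreover obtain y where "y \<in> B" using ne by auto
    ultimately show ?thesis using K[of x y] by fastforce
  qed
  then have bdd: "bdd_above V" by (rule bdd_aboveI)
  have "V \<noteq> {}"
  proof -
    obtain x where "x \<in> A" using ne by auto
    then have "-K \<in> V" using K[of x] unfolding V_def
      by (auto intro!: bexI[of _ x]) (smt (verit))
    then show ?thesis by auto
  qed
  define v where "v = Sup V"
  have low: "\<exists>x\<in>A. \<forall>y\<in>B. v - \<epsilon> \<le> F x y" if \<epsilon>: "\<epsilon> > 0" for \<epsilon>
  proof -
    obtain w where "w \<in> V" "v - \<epsilon> < w"
      using less_cSupD[OF \<open>V \<noteq> {}\<close>, of "v - \<epsilon>"] \<epsilon> by (auto simp: v_def)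
    then obtain x where "x \<in> A" "\<And>y. y \<in> B \<Longrightarrow> w \<le> F x y" by (auto simp: V_def)
    with \<open>v - \<epsilon> < w\<close> show ?thesis by (intro bexI[of _ x] ballI) force+
  qed
  have noV: False if "x \<in> A" "v < w" "\<And>y. y \<in> B \<Longrightarrow> w \<le> F x y" for w x
  proof -
    have "w \<in> V" using that by (auto simp: V_def)
    then have "w \<le> v" unfolding v_def using bdd by (rule cSup_upper)
    with that(2) show False by simp
  qed
  have "\<exists>y\<in>B. \<forall>x\<in>A. F x y \<le> v + \<epsilon>" if \<epsilon>: "\<epsilon> > 0" for \<epsilon>
  proof (rule ccontr)
    assume neg: "\<not> ?thesis"
    \<comment> \<open>Since \<open>c\<close> exceeds \<open>v\<close>, no element of
      \<open>A\<close> guarantees \<open>c\<close>; since \<open>d\<close> is below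
      \<open>v + \<epsilon>\<close>, no element of \<open>B\<close> holds the payoff to
      \<open>d\<close>. The gap between the two is the margin.\<close>
    define c d where "c = v + \<epsilon> / 3" and "d = v + 2 * \<epsilon> / 3"
    have reply: "\<exists>y\<in>B. \<forall>x\<in>X. F x y < c" if "finite X" "X \<subseteq> A" for X
    proof (rule ccontr)
      assume *: "\<not> ?thesis"
      have "\<exists>z\<in>A. \<forall>y\<in>B. (\<forall>x\<in>{}. F x y < c) \<longrightarrow> c \<le> F z y"
        by (rule finite_alternative[OF A B ne(1) that]) (use * in \<open>auto simp: not_less\<close>)
      then obtain z where "z \<in> A" "\<And>y. y \<in> B \<Longrightarrow> c \<le> F z y" by auto
      then show False using noV[of z c] \<epsilon> by (auto simp: c_def)
    qed
    have attack: "\<exists>x\<in>A. \<forall>y\<in>Y. d < F x y" if "finite Y" "Y \<subseteq> B" for Y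
    proof (rule ccontr)
      assume *: "\<not> ?thesis"
      have "\<exists>z\<in>B. \<forall>x\<in>A. (\<forall>y\<in>{}. - F x y < - d) \<longrightarrow> - d \<le> - F x z"
        by (rule finite_alternative[OF affinelike_minus[OF B] affinelike_minus[OF A] ne(2) that])
          (use * in \<open>auto simp: not_less\<close>)
      then obtain z where z: "z \<in> B" "\<And>x. x \<in> A \<Longrightarrow> F x z \<le> d" by auto
      have "d \<le> v + \<epsilon>" using \<epsilon> by (simp add: d_def)
      with z neg show False by force
    qed
    \<comment> \<open>A round is compared with strictly earlier rounds only: its two actions are
      found independently of each other, and \<open>stable\<close> is silent on the
      diagonal.\<close>
    define P where "P f n r \<longleftrightarrow> fst r \<in> A \<and> snd r \<in> B \<and>
      (\<forall>m<n. fst (f m) \<in> A \<longrightarrow> snd (f m) \<in> B \<longrightarrow> F (fst (f m)) (snd r) < c \<and> d < F (fst r) (snd (f m)))"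
      for f :: "nat \<Rightarrow> 'a \<times> 'b" and n r
    have "\<exists>f. \<forall>n. P f n (f n)"
    proof (rule dependent_wellorder_choice)
      fix n :: nat and f :: "nat \<Rightarrow> 'a \<times> 'b"
      assume "\<And>m. m < n \<Longrightarrow> P f m (f m)"
      then have f: "fst (f m) \<in> A" "snd (f m) \<in> B" if "m < n" for m
        using that by (auto simp: P_def)
      obtain y where y: "y \<in> B" "\<forall>x\<in>(\<lambda>m. fst (f m)) ` {..<n}. F x y < c"
        using reply[of "(\<lambda>m. fst (f m)) ` {..<n}"] f by auto
      obtain x where x: "x \<in> A" "\<forall>y\<in>(\<lambda>m. snd (f m)) ` {..<n}. d < F x y"
        using attack[of "(\<lambda>m. snd (f m)) ` {..<n}"] f by auto
      show "\<exists>r. P f n r" using x y by (intro exI[of _ "(x, y)"]) (auto simp: P_def)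
    qed (simp add: P_def)
    then obtain f where f: "\<And>n. P f n (f n)" by blast
    have fAB: "fst (f n) \<in> A" "snd (f n) \<in> B" for n using f[of n] by (auto simp: P_def)
    show False
    proof (rule stableD[OF st, of "\<lambda>n. fst (f n)" "\<lambda>n. snd (f n)" c d])
      show "c < d" using \<epsilon> by (simp add: c_def d_def)
      show "F (fst (f m)) (snd (f n)) \<le> c" if "m < n" for m n
        using f[of n] that fAB[of m] by (simp add: P_def less_imp_le)
      show "d \<le> F (fst (f m)) (snd (f n))" if "n < m" for m n
        using f[of m] that fAB[of n] by (simp add: P_def less_imp_le)
    qed (rule fAB)+
  qed
  with low show ?thesis by (intro exI[of _ v] allI impI conjI)
qed

section \<open>From finitely supported mixtures to Borel mixed actions\<close>

lemma mix_fin_pmfs: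
  assumes p: "p \<in> fin_pmfs A" "p' \<in> fin_pmfs A" and t: "t \<in> {0..1}"
  shows "\<exists>z\<in>fin_pmfs A. \<forall>g :: _ \<Rightarrow> real. measure_pmf.expectation z g =
    (1 - t) * measure_pmf.expectation p g + t * measure_pmf.expectation p' g"
proof (intro bexI allI)
  define z where "z = bind_pmf (bernoulli_pmf t) (\<lambda>b. if b then p' else p)"
  show "z \<in> fin_pmfs A" using p unfolding z_def fin_pmfs_def by (auto split: if_splits)
  fix g :: "_ \<Rightarrow> real"
  have "measure_pmf.expectation z g = (\<Sum>b\<in>UNIV. pmf (bernoulli_pmf t) b *\<^sub>R
      measure_pmf.expectation (if b then p' else p) g)"
    unfolding z_def by (rule pmf_expectation_bind) (use p in \<open>auto simp: fin_pmfs_def\<close>)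
  then show "measure_pmf.expectation z g =
    (1 - t) * measure_pmf.expectation p g + t * measure_pmf.expectation p' g"
    using t by (simp add: UNIV_bool)
qed

text \<open>A pmf lives on the discrete sigma-algebra, so it is pushed forward to \<open>M\<close>.
  A measurable map must land in \<open>space M\<close> everywhere; \<open>\<rho>\<close> is the
  identity there and moves the null set outside to a point of the support.\<close>

lemma prob_algebra_of_pmf:
  assumes p: "set_pmf p \<subseteq> space M"
  shows "\<exists>\<mu>\<in>space (prob_algebra M). \<forall>g\<in>borel_measurable M. (\<integral>x. g x \<partial>\<mu>) = (measure_pmf.expectation p g :: real)"
proof -
  obtain a where a: "a \<in> set_pmf p" using set_pmf_not_empty[of p] by auto
  define \<rho> where "\<rho> x = (if x \<in> space M then x else a)" for x
  have \<rho>: "\<rho> \<in> measurable (measure_pmf p) M" using a p by (auto simp: \<rho>_def)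
  show ?thesis
  proof (intro bexI ballI)
    show "distr p M \<rho> \<in> space (prob_algebra M)"
      by (simp add: space_prob_algebra measure_pmf.prob_space_distr[OF \<rho>])
    fix g :: "_ \<Rightarrow> real" assume g: "g \<in> borel_measurable M"
    have "(\<integral>x. g x \<partial>distr p M \<rho>) = measure_pmf.expectation p (\<lambda>x. g (\<rho> x))"
      by (rule integral_distr[OF \<rho> g])
    also have "\<dots> = measure_pmf.expectation p g"
      by (rule integral_cong_AE) (use p in \<open>auto simp: AE_measure_pmf_iff \<rho>_def\<close>)
    finally show "(\<integral>x. g x \<partial>distr p M \<rho>) = measure_pmf.expectation p g" .
  qed
qed

text \<open>\<open>stable_mixed\<close> extends the second argument only, so it is used once for
  each player with \<open>stable_swap\<close> in between. The guarantees are stated against pure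
  actions; integration later extends them to arbitrary mixed ones.\<close>

theorem minimax_separately_continuous:
  fixes f :: "'a::topological_space \<Rightarrow> 'b::topological_space \<Rightarrow> real"
  assumes A: "compact A" "A \<noteq> {}" and B: "compact B" "B \<noteq> {}"
    and c1: "\<And>y. y \<in> B \<Longrightarrow> continuous_on A (\<lambda>x. f x y)"
    and c2: "\<And>x. x \<in> A \<Longrightarrow> continuous_on B (f x)"
    and K: "\<And>x y. x \<in> A \<Longrightarrow> y \<in> B \<Longrightarrow> \<bar>f x y\<bar> \<le> K"
  shows "\<exists>v. \<forall>\<epsilon>>0.
    (\<exists>\<mu>\<in>space (prob_algebra (restrict_space borel A)). \<forall>y\<in>B. v - \<epsilon> \<le> (\<integral>x. f x y \<partial>\<mu>)) \<and>
    (\<exists>\<nu>\<in>space (prob_algebra (restrict_space borel B)). \<forall>x\<in>A. (\<integral>y. f x y \<partial>\<nu>) \<le> v + \<epsilon>)"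
proof -
  define F where "F p q = measure_pmf.expectation p (\<lambda>x. measure_pmf.expectation q (f x))" for p q
  have int: "integrable (measure_pmf p) g" if "p \<in> fin_pmfs C" for p C and g :: "_ \<Rightarrow> real"
    using that by (intro integrable_measure_pmf_finite) (simp add: fin_pmfs_def)
  have bound: "\<bar>measure_pmf.expectation p g\<bar> \<le> K" if "p \<in> fin_pmfs C" "\<And>x. x \<in> C \<Longrightarrow> \<bar>g x\<bar> \<le> K"
    for p C and g :: "_ \<Rightarrow> real"
  proof -
    have "\<bar>measure_pmf.expectation p g\<bar> \<le> measure_pmf.expectation p (\<lambda>x. \<bar>g x\<bar>)"
      by (rule integral_abs_bound)
    also have "\<dots> \<le> measure_pmf.expectation p (\<lambda>x. K)"
      using that by (intro integral_mono_AE int[OF that(1)]) (auto simp: AE_measure_pmf_iff fin_pmfs_def)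
    finally show ?thesis by simp
  qed
  have K1: "\<bar>measure_pmf.expectation q (f x)\<bar> \<le> K" if "x \<in> A" "q \<in> fin_pmfs B" for x q
    by (rule bound[OF that(2)]) (rule K[OF that(1)])
  have "stable (\<lambda>x q. measure_pmf.expectation q (f x)) A (fin_pmfs B)"
    by (rule stable_mixed[OF stable_compact[OF A(1) B(1) c1 c2] K])
  then have "stable (\<lambda>q x. - measure_pmf.expectation q (f x)) (fin_pmfs B) A"
    by (rule stable_swap)
  then have "stable (\<lambda>q p. measure_pmf.expectation p (\<lambda>x. - measure_pmf.expectation q (f x))) (fin_pmfs B) (fin_pmfs A)"
    by (rule stable_mixed[where K=K]) (simp add: K1)
  then have "stable (\<lambda>p q. - measure_pmf.expectation p (\<lambda>x. - measure_pmf.expectation q (f x))) (fin_pmfs A) (fin_pmfs B)"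
    by (rule stable_swap)
  then have st: "stable F (fin_pmfs A) (fin_pmfs B)"
    by (simp add: F_def[abs_def])
  have aff1: "affinelike F (fin_pmfs A) (fin_pmfs B)"
    unfolding affinelike_def
  proof (intro ballI)
    fix p p' and t :: real assume "p \<in> fin_pmfs A" "p' \<in> fin_pmfs A" "t \<in> {0..1}"
    from mix_fin_pmfs[OF this] obtain z where "z \<in> fin_pmfs A"
      "\<forall>g :: _ \<Rightarrow> real. measure_pmf.expectation z g =
        (1 - t) * measure_pmf.expectation p g + t * measure_pmf.expectation p' g" by blast
    then show "\<exists>z\<in>fin_pmfs A. \<forall>q\<in>fin_pmfs B. F z q = (1 - t) * F p q + t * F p' q"
      by (intro bexI[of _ z]) (auto simp: F_def)
  qed
  have aff2: "affinelike (\<lambda>q p. F p q) (fin_pmfs B) (fin_pmfs A)"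
    unfolding affinelike_def
  proof (intro ballI)
    fix q q' and t :: real assume "q \<in> fin_pmfs B" "q' \<in> fin_pmfs B" "t \<in> {0..1}"
    from mix_fin_pmfs[OF this] obtain z where z: "z \<in> fin_pmfs B"
      "\<And>g :: _ \<Rightarrow> real. measure_pmf.expectation z g =
        (1 - t) * measure_pmf.expectation q g + t * measure_pmf.expectation q' g" by blast
    have "F p z = (1 - t) * F p q + t * F p q'" if "p \<in> fin_pmfs A" for p
      unfolding F_def z(2)
      by (subst Bochner_Integration.integral_add) (auto intro!: int[OF that])
    with z(1) show "\<exists>z\<in>fin_pmfs B. \<forall>p\<in>fin_pmfs A. F p z = (1 - t) * F p q + t * F p q'"
      by blast
  qed
  have ret: "return_pmf x \<in> fin_pmfs C \<longleftrightarrow> x \<in> C" for x C by (simp add: fin_pmfs_def)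
  obtain a b where "a \<in> A" "b \<in> B" using A(2) B(2) by auto
  then have "return_pmf a \<in> fin_pmfs A" "return_pmf b \<in> fin_pmfs B" by (simp_all add: ret)
  then have ne: "fin_pmfs A \<noteq> {}" "fin_pmfs B \<noteq> {}" by auto
  have KF: "\<bar>F p q\<bar> \<le> K" if "p \<in> fin_pmfs A" "q \<in> fin_pmfs B" for p q
    unfolding F_def by (rule bound[OF that(1)]) (rule K1[OF _ that(2)])
  obtain v where v1: "\<And>\<epsilon>. \<epsilon> > 0 \<Longrightarrow> \<exists>p\<in>fin_pmfs A. \<forall>q\<in>fin_pmfs B. v - \<epsilon> \<le> F p q"
    and v2: "\<And>\<epsilon>. \<epsilon> > 0 \<Longrightarrow> \<exists>q\<in>fin_pmfs B. \<forall>p\<in>fin_pmfs A. F p q \<le> v + \<epsilon>"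
    using minimax_stable[OF aff1 aff2 ne st KF] by auto
  show ?thesis
  proof (intro exI[of _ v] allI impI conjI)
    fix \<epsilon> :: real assume \<epsilon>: "\<epsilon> > 0"
    obtain p where p: "p \<in> fin_pmfs A" "\<And>q. q \<in> fin_pmfs B \<Longrightarrow> v - \<epsilon> \<le> F p q" using v1[OF \<epsilon>] by blast
    obtain \<mu> where \<mu>: "\<mu> \<in> space (prob_algebra (restrict_space borel A))"
      "\<And>g. g \<in> borel_measurable (restrict_space borel A) \<Longrightarrow> (\<integral>x. g x \<partial>\<mu>) = (measure_pmf.expectation p g :: real)"
      using prob_algebra_of_pmf[of p "restrict_space borel A"] p(1)
      by (auto simp: fin_pmfs_def space_restrict_space)
    have "v - \<epsilon> \<le> (\<integral>x. f x y \<partial>\<mu>)" if "y \<in> B" for y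
      using p(2)[of "return_pmf y"] that
        \<mu>(2)[OF borel_measurable_continuous_on_restrict[OF c1[OF that]]] by (simp add: ret F_def)
    with \<mu>(1) show "\<exists>\<mu>\<in>space (prob_algebra (restrict_space borel A)). \<forall>y\<in>B. v - \<epsilon> \<le> (\<integral>x. f x y \<partial>\<mu>)"
      by blast
  next
    fix \<epsilon> :: real assume \<epsilon>: "\<epsilon> > 0"
    obtain q where q: "q \<in> fin_pmfs B" "\<And>p. p \<in> fin_pmfs A \<Longrightarrow> F p q \<le> v + \<epsilon>" using v2[OF \<epsilon>] by blast
    obtain \<nu> where \<nu>: "\<nu> \<in> space (prob_algebra (restrict_space borel B))"
      "\<And>g. g \<in> borel_measurable (restrict_space borel B) \<Longrightarrow> (\<integral>x. g x \<partial>\<nu>) = (measure_pmf.expectation q g :: real)"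
      using prob_algebra_of_pmf[of q "restrict_space borel B"] q(1)
      by (auto simp: fin_pmfs_def space_restrict_space)
    have "(\<integral>y. f x y \<partial>\<nu>) \<le> v + \<epsilon>" if "x \<in> A" for x
      using q(2)[of "return_pmf x"] that
        \<nu>(2)[OF borel_measurable_continuous_on_restrict[OF c2[OF that]]] by (simp add: ret F_def)
    with \<nu>(1) show "\<exists>\<nu>\<in>space (prob_algebra (restrict_space borel B)). \<forall>x\<in>A. (\<integral>y. f x y \<partial>\<nu>) \<le> v + \<epsilon>"
      by blast
  qed
qed

subsection \<open>Expected payoffs along a play\<close>

text \<open>The limit is known through \<open>CI\<close>, which runs the kernels for
  \<open>up_to J\<close> stages and projects to \<open>J\<close>; for an initial segment nothing is
  projected away.\<close>

lemma (in Ionescu_Tulcea) distr_lim_prefix: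
  "distr PF.lim (PiM {0..<n} M) (\<lambda>x. restrict x {0..<n}) = C 0 n (\<lambda>_. undefined)"
proof -
  have "up_to {0..<n} = n"
  proof (rule antisym)
    show "up_to {0..<n} \<le> n" by (simp add: up_to_iff_Ico)
    show "n \<le> up_to {0..<n}" using up_to[of "{0..<n}"] by (cases n) auto
  qed
  then show ?thesis
    using distr_C[of n n "\<lambda>_. undefined" 0] by (simp add: distr_lim CI_def)
qed

text \<open>The tower property at stage \<open>n\<close>: the law of the first \<open>Suc n\<close>
  coordinates is the law of the first \<open>n\<close> bound with the extended kernel
  \<open>eP n\<close>.\<close>

lemma (in Ionescu_Tulcea) integral_lim_component:
  fixes F :: "'a \<Rightarrow> real"
  assumes F[measurable]: "F \<in> borel_measurable (M n)" and B: "\<And>x. x \<in> space (M n) \<Longrightarrow> \<bar>F x\<bar> \<le> B"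
  shows "(\<integral>\<omega>. F (\<omega> n) \<partial>PF.lim) = (\<integral>\<omega>. (\<integral>x. F x \<partial>P n (restrict \<omega> {0..<n})) \<partial>PF.lim)"
proof -
  \<comment> \<open>The empty history: the only point of the empty product.\<close>
  let ?u = "\<lambda>_::nat. undefined :: 'a"
  have u: "?u \<in> space (PiM {0..<0} M)" by simp
  have lim_meas: "(\<lambda>x. restrict x {0..<k}) \<in> PF.lim \<rightarrow>\<^sub>M PiM {0..<k} M" for k
    by (subst measurable_cong_sets[OF PF.sets_lim refl]) (simp add: measurable_restrict_subset)
  have comp: "(\<lambda>x. F (x n)) \<in> borel_measurable (PiM {0..<Suc n} M)"
    by measurable
  have int_meas: "(\<lambda>\<omega>. \<integral>x. F x \<partial>P n \<omega>) \<in> borel_measurable (PiM {0..<n} M)"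
    using P by (rule measurable_compose[OF _ integral_measurable_subprob_algebra[OF F]])
  have sets_C0: "sets (C 0 n ?u) = sets (PiM {0..<n} M)"
    using sets_C[OF u, of n] by simp
  have eP_meas: "eP n \<in> C 0 n ?u \<rightarrow>\<^sub>M subprob_algebra (PiM {0..<Suc n} M)"
    by (subst measurable_cong_sets[OF sets_C0 refl]) (rule measurable_eP)
  have space_C0: "space (C 0 n ?u) = space (PiM {0..<n} M)"
    using space_C[OF u, of n] by simp
  have "(\<integral>\<omega>. F (\<omega> n) \<partial>PF.lim) = (\<integral>\<omega>. F (restrict \<omega> {0..<Suc n} n) \<partial>PF.lim)"
    by simp
  also have "\<dots> = (\<integral>x. F (x n) \<partial>distr PF.lim (PiM {0..<Suc n} M) (\<lambda>x. restrict x {0..<Suc n}))"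
    by (rule integral_distr[symmetric, OF lim_meas comp])
  also have "\<dots> = (\<integral>x. F (x n) \<partial>(C 0 n ?u \<bind> eP n))"
    unfolding distr_lim_prefix by simp
  also have "\<dots> = (\<integral>\<omega>. (\<integral>x. F (x n) \<partial>eP n \<omega>) \<partial>C 0 n ?u)"
  proof (rule integral_bind[OF comp _ eP_meas])
    show "\<bar>F (x n)\<bar> \<le> B" if "x \<in> space (PiM {0..<Suc n} M)" for x
      using that by (intro B) (auto simp: space_PiM PiE_iff)
    show "finite_measure (C 0 n ?u)"
      using prob_space_C[OF u, of n] by (simp add: prob_space.finite_measure)
    show "AE \<omega> in C 0 n ?u. emeasure (eP n \<omega>) (space (eP n \<omega>)) \<le> ennreal 1"
      using prob_space_eP by (intro AE_I2) (auto simp: space_C0 prob_space.emeasure_space_1)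
  qed
  also have "\<dots> = (\<integral>\<omega>. (\<integral>x. F x \<partial>P n \<omega>) \<partial>C 0 n ?u)"
  proof (rule Bochner_Integration.integral_cong[OF refl])
    fix \<omega> assume "\<omega> \<in> space (C 0 n ?u)"
    then have \<omega>: "\<omega> \<in> space (PiM {0..<n} M)" by (simp add: space_C0)
    have upd: "fun_upd \<omega> n \<in> P n \<omega> \<rightarrow>\<^sub>M PiM {0..<Suc n} M"
      using \<omega> by (intro measurable_fun_upd[where J="{0..<n}"]) auto
    show "(\<integral>x. F (x n) \<partial>eP n \<omega>) = (\<integral>x. F x \<partial>P n \<omega>)"
      unfolding eP_def by (subst integral_distr[OF upd comp]) simp
  qed
  also have "\<dots> = (\<integral>\<omega>. (\<integral>x. F x \<partial>P n (restrict \<omega> {0..<n})) \<partial>PF.lim)"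
    unfolding distr_lim_prefix[symmetric] by (rule integral_distr[OF lim_meas int_meas])
  finally show ?thesis .
qed

section \<open>Potentials along a play\<close>

text \<open>By Fubini, where joint measurability enters: a bound valid against each pure action of
  the opponent is averaged over the opponent's mixed action.\<close>

lemma integral_pair_bounds:
  fixes h :: "'a \<Rightarrow> 'b \<Rightarrow> real"
  assumes \<mu>: "\<mu> \<in> space (prob_algebra M)" and \<nu>: "\<nu> \<in> space (prob_algebra N)"
    and h: "(\<lambda>(i, j). h i j) \<in> borel_measurable (M \<Otimes>\<^sub>M N)"
    and B: "\<And>i j. i \<in> space M \<Longrightarrow> j \<in> space N \<Longrightarrow> \<bar>h i j\<bar> \<le> B"
  shows "(\<And>j. j \<in> space N \<Longrightarrow> c \<le> (\<integral>i. h i j \<partial>\<mu>)) \<Longrightarrow> c \<le> (\<integral>(i, j). h i j \<partial>(\<mu> \<Otimes>\<^sub>M \<nu>))"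
    and "(\<And>i. i \<in> space M \<Longrightarrow> (\<integral>j. h i j \<partial>\<nu>) \<le> c) \<Longrightarrow> (\<integral>(i, j). h i j \<partial>(\<mu> \<Otimes>\<^sub>M \<nu>)) \<le> c"
proof -
  have sets: "sets \<mu> = sets M" "sets \<nu> = sets N" and "prob_space \<mu>" "prob_space \<nu>"
    using \<mu> \<nu> by (auto simp: space_prob_algebra)
  then interpret \<mu>: prob_space \<mu> + \<nu>: prob_space \<nu> by auto
  interpret pair_prob_space \<mu> \<nu> ..
  have sp: "space \<mu> = space M" "space \<nu> = space N" by (rule sets_eq_imp_space_eq[OF sets(1)], rule sets_eq_imp_space_eq[OF sets(2)])
  have "(\<lambda>(i, j). h i j) \<in> borel_measurable (\<mu> \<Otimes>\<^sub>M \<nu>)"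
    using h by (simp cong: measurable_cong_sets add: sets_pair_measure_cong[OF sets])
  then have int: "integrable (\<mu> \<Otimes>\<^sub>M \<nu>) (\<lambda>(i, j). h i j)"
    by (intro integrable_const_bound[of _ B]) (auto simp: space_pair_measure sp B)
  {
    assume c: "\<And>j. j \<in> space N \<Longrightarrow> c \<le> (\<integral>i. h i j \<partial>\<mu>)"
    have "(\<integral>j. c \<partial>\<nu>) \<le> (\<integral>j. (\<integral>i. h i j \<partial>\<mu>) \<partial>\<nu>)"
      by (intro integral_mono integrable_snd[OF int]) (auto simp: c sp)
    then show "c \<le> (\<integral>(i, j). h i j \<partial>(\<mu> \<Otimes>\<^sub>M \<nu>))"
      by (simp add: integral_snd[OF int] \<nu>.prob_space)
  }
  {
    assume c: "\<And>i. i \<in> space M \<Longrightarrow> (\<integral>j. h i j \<partial>\<nu>) \<le> c"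
    have "(\<integral>i. (\<integral>j. h i j \<partial>\<nu>) \<partial>\<mu>) \<le> (\<integral>i. c \<partial>\<mu>)"
      by (intro integral_mono integrable_fst[OF int]) (auto simp: c sp)
    then show "(\<integral>(i, j). h i j \<partial>(\<mu> \<Otimes>\<^sub>M \<nu>)) \<le> c"
      by (simp add: integral_fst[OF int] \<mu>.prob_space)
  }
qed

definition next_value :: "('k::finite, 'i, 'j) stoch_game \<Rightarrow> ('k \<Rightarrow> real) \<Rightarrow> 'k \<Rightarrow> 'i \<Rightarrow> 'j \<Rightarrow> real" where
  "next_value G V k i j = (\<Sum>k'\<in>UNIV. pmf (trans_law G k i j) k' * V k')"

definition stage_payoff where
  "stage_payoff G k1 \<sigma> \<tau> n = (\<integral>\<omega>. (case \<omega> n of (k, i, j) \<Rightarrow> payoff G k i j) \<partial>play_measure G k1 \<sigma> \<tau>)"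

lemma weighted_pmf_bound:
  fixes V :: "'k::finite \<Rightarrow> real"
  shows "\<bar>\<Sum>k\<in>UNIV. pmf p k * V k\<bar> \<le> (\<Sum>k\<in>UNIV. \<bar>V k\<bar>)"
proof -
  have "\<bar>\<Sum>k\<in>UNIV. pmf p k * V k\<bar> \<le> (\<Sum>k\<in>UNIV. \<bar>pmf p k * V k\<bar>)" by (rule sum_abs)
  also have "\<dots> \<le> (\<Sum>k\<in>UNIV. \<bar>V k\<bar>)"
    by (intro sum_mono) (auto simp: abs_mult pmf_le_1 intro: mult_left_le_one_le)
  finally show ?thesis .
qed

lemma space_action [simp]:
  "space (action_space1 G) = actions1 G" "space (action_space2 G) = actions2 G"
  by (auto simp: action_space1_def action_space2_def space_restrict_space)

lemma payoff_section_measurable: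
  assumes "stochastic_game G"
  shows "(\<lambda>(i, j). payoff G k i j) \<in> borel_measurable (action_space1 G \<Otimes>\<^sub>M action_space2 G)"
  using assms unfolding stochastic_game_def by blast

lemma next_value_section_measurable:
  assumes "stochastic_game G"
  shows "(\<lambda>(i, j). next_value G V k i j) \<in> borel_measurable (action_space1 G \<Otimes>\<^sub>M action_space2 G)"
proof -
  have [measurable]: "(\<lambda>(i, j). pmf (trans_law G k i j) k') \<in> borel_measurable (action_space1 G \<Otimes>\<^sub>M action_space2 G)" for k'
    using assms unfolding stochastic_game_def by blast
  have "(\<lambda>z. \<Sum>k'\<in>UNIV. (case z of (i, j) \<Rightarrow> pmf (trans_law G k i j) k') * V k')
      \<in> borel_measurable (action_space1 G \<Otimes>\<^sub>M action_space2 G)"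
    by measurable
  then show ?thesis by (simp add: next_value_def split_beta)
qed

lemma next_value_bound: "\<bar>next_value G V k i j\<bar> \<le> (\<Sum>k\<in>UNIV. \<bar>V k\<bar>)"
  unfolding next_value_def by (rule weighted_pmf_bound)

locale play =
  fixes G :: "('k::finite, 'i::topological_space, 'j::topological_space) stoch_game"
    and k1 :: 'k and \<sigma> and \<tau>
  assumes G: "stochastic_game G" and \<sigma>: "\<sigma> \<in> strategies1 G" and \<tau>: "\<tau> \<in> strategies2 G"
begin

abbreviation "S \<equiv> stage_space G"
abbreviation "P \<equiv> play_measure G k1 \<sigma> \<tau>"

sublocale IT: Ionescu_Tulcea "play_kernel G k1 \<sigma> \<tau>" "\<lambda>_. S"
  using G \<sigma> \<tau> by (rule Ionescu_Tulcea_play_kernel)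

lemma P_eq: "P = IT.PF.lim" by (simp add: play_measure_def)

sublocale law: prob_space P
  using G \<sigma> \<tau> by (rule prob_space_play_measure)

lemma sets_P [measurable_cong]: "sets P = sets (PiM UNIV (\<lambda>_. S))"
  by (simp add: P_eq)

lemma space_P: "space P = space (PiM UNIV (\<lambda>_. S))"
  using sets_P by (rule sets_eq_imp_space_eq)

lemma component_measurable [measurable]: "(\<lambda>\<omega>. \<omega> n) \<in> P \<rightarrow>\<^sub>M S"
  by measurable

lemma component_space: "\<omega> \<in> space P \<Longrightarrow> \<omega> n \<in> space S"
  by (auto simp: space_P space_PiM)

lemma space_S: "space S = UNIV \<times> actions1 G \<times> actions2 G"
  by (simp add: stage_space_def space_pair_measure)

lemma payoff_measurable [measurable]: "(\<lambda>(k, i, j). payoff G k i j) \<in> borel_measurable S"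
  unfolding stage_space_def
  by (rule measurable_pair_measure_countable1) (use payoff_section_measurable[OF G] in \<open>simp_all add: split_beta\<close>)

lemma next_value_measurable [measurable]: "(\<lambda>(k, i, j). next_value G V k i j) \<in> borel_measurable S"
  unfolding stage_space_def
  by (rule measurable_pair_measure_countable1) (use next_value_section_measurable[OF G] in \<open>simp_all add: split_beta\<close>)

lemma payoff_bounds: "z \<in> space S \<Longrightarrow> (case z of (k, i, j) \<Rightarrow> payoff G k i j) \<in> {0..1}"
  using G by (auto simp: space_S stochastic_game_def)

text \<open>The state of stage \<open>n\<close> belongs to triple \<open>n\<close>, so the first
  \<open>n\<close> triples determine only its conditional law. This is the conditional expectation
  of \<open>V\<close> under that law.\<close>

definition state_value :: "nat \<Rightarrow> ('k \<Rightarrow> real) \<Rightarrow> (nat \<Rightarrow> 'k \<times> 'i \<times> 'j) \<Rightarrow> real" where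
  "state_value n V \<omega> = (\<Sum>k\<in>UNIV. pmf (state_law G k1 n \<omega>) k * V k)"

lemma state_value_0: "state_value 0 V \<omega> = V k1"
  by (simp add: state_value_def state_law_def indicator_def pmf_return sum.delta if_distrib cong: if_cong)

lemma state_value_Suc: "state_value (Suc n) V \<omega> = (case \<omega> n of (k, i, j) \<Rightarrow> next_value G V k i j)"
  by (simp add: state_value_def state_law_def next_value_def split: prod.split)

lemma state_value_restrict: "state_value n V (restrict \<omega> {0..<n}) = state_value n V \<omega>"
  by (cases n) (simp_all add: state_value_0 state_value_Suc)

lemma integrable_state_value: "integrable P (state_value n V)"
proof (rule law.integrable_const_bound)
  show "AE \<omega> in P. norm (state_value n V \<omega>) \<le> (\<Sum>k\<in>UNIV. \<bar>V k\<bar>)"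
    unfolding state_value_def real_norm_def by (intro AE_I2 weighted_pmf_bound)
  show "state_value n V \<in> borel_measurable P"
  proof (cases n)
    case 0
    then show ?thesis by (simp add: state_value_0[abs_def])
  next
    case (Suc m)
    show ?thesis unfolding Suc state_value_Suc[abs_def]
      by (rule measurable_compose[OF component_measurable next_value_measurable])
  qed
qed

lemma integral_state_value_le:
  assumes "\<And>k. V k \<le> C"
  shows "(\<integral>\<omega>. state_value n V \<omega> \<partial>P) \<le> C"
proof -
  have "state_value n V \<omega> \<le> C" for \<omega>
  proof -
    have "state_value n V \<omega> \<le> (\<Sum>k\<in>UNIV. pmf (state_law G k1 n \<omega>) k * C)"
      unfolding state_value_def using assms by (intro sum_mono mult_left_mono) auto
    also have "\<dots> = C"
      using sum_pmf_eq_1[of UNIV "state_law G k1 n \<omega>"] by (simp flip: sum_distrib_right)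
    finally show ?thesis .
  qed
  then have "(\<integral>\<omega>. state_value n V \<omega> \<partial>P) \<le> (\<integral>\<omega>. C \<partial>P)"
    by (intro integral_mono integrable_state_value) auto
  then show ?thesis by (simp add: law.prob_space)
qed

lemma integral_play_kernel:
  fixes F :: "'k \<times> 'i \<times> 'j \<Rightarrow> real"
  assumes F: "F \<in> borel_measurable S" and B: "\<And>z. z \<in> space S \<Longrightarrow> \<bar>F z\<bar> \<le> B"
    and \<omega>: "\<omega> \<in> space (PiM {0..<n} (\<lambda>_. S))"
  shows "(\<integral>z. F z \<partial>play_kernel G k1 \<sigma> \<tau> n \<omega>) =
    state_value n (\<lambda>k. \<integral>(i, j). F (k, i, j) \<partial>(\<sigma> n (\<omega>, k) \<Otimes>\<^sub>M \<tau> n (\<omega>, k))) \<omega>"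
proof -
  let ?D = "\<lambda>k. distr (\<sigma> n (\<omega>, k) \<Otimes>\<^sub>M \<tau> n (\<omega>, k)) S (\<lambda>(i, j). (k, i, j))"
  have hist: "(\<omega>, k) \<in> space (history_space G n)" for k
    using \<omega> by (simp add: history_space_def space_pair_measure)
  have s: "\<sigma> n (\<omega>, k) \<in> space (prob_algebra (action_space1 G))"
    and t: "\<tau> n (\<omega>, k) \<in> space (prob_algebra (action_space2 G))" for k
    by (rule measurable_space[OF _ hist], use \<sigma> \<tau> in \<open>simp add: strategies1_def strategies2_def\<close>)+
  have sets: "sets (\<sigma> n (\<omega>, k) \<Otimes>\<^sub>M \<tau> n (\<omega>, k)) = sets (action_space1 G \<Otimes>\<^sub>M action_space2 G)" for k
    using s t by (intro sets_pair_measure_cong) (auto simp: space_prob_algebra)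
  have meas: "(\<lambda>(i, j). (k, i, j)) \<in> \<sigma> n (\<omega>, k) \<Otimes>\<^sub>M \<tau> n (\<omega>, k) \<rightarrow>\<^sub>M S" for k
    by (subst measurable_cong_sets[OF sets refl]) (simp add: stage_space_def split_beta')
  have prob: "prob_space (?D k)" for k
  proof -
    interpret s: prob_space "\<sigma> n (\<omega>, k)" using s by (simp add: space_prob_algebra)
    interpret t: prob_space "\<tau> n (\<omega>, k)" using t by (simp add: space_prob_algebra)
    interpret pair_prob_space "\<sigma> n (\<omega>, k)" "\<tau> n (\<omega>, k)" ..
    show ?thesis by (rule prob_space_distr[OF meas])
  qed
  have inner: "(\<integral>z. F z \<partial>?D k) = (\<integral>(i, j). F (k, i, j) \<partial>(\<sigma> n (\<omega>, k) \<Otimes>\<^sub>M \<tau> n (\<omega>, k)))" for k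
    by (subst integral_distr[OF meas F]) (simp add: split_beta')
  have "(\<integral>z. F z \<partial>play_kernel G k1 \<sigma> \<tau> n \<omega>) =
      (\<integral>k. (\<integral>z. F z \<partial>?D k) \<partial>measure_pmf (state_law G k1 n \<omega>))"
    unfolding play_kernel_def
  proof (rule integral_bind[OF F B])
    show "?D \<in> measure_pmf (state_law G k1 n \<omega>) \<rightarrow>\<^sub>M subprob_algebra S"
      using prob by (auto simp: space_subprob_algebra prob_space_imp_subprob_space)
    show "AE k in measure_pmf (state_law G k1 n \<omega>). emeasure (?D k) (space (?D k)) \<le> ennreal 1"
      using prob by (intro AE_I2) (simp only: prob_space.emeasure_space_1 ennreal_1 order_refl)
  qed (auto intro: measure_pmf.finite_measure)
  also have "\<dots> = (\<Sum>k\<in>UNIV. (\<integral>z. F z \<partial>?D k) * pmf (state_law G k1 n \<omega>) k)"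
    by (rule integral_measure_pmf_real) auto
  finally show ?thesis unfolding inner by (simp add: state_value_def mult.commute)
qed

lemma integral_component_ge:
  fixes F :: "'k \<times> 'i \<times> 'j \<Rightarrow> real"
  assumes F: "F \<in> borel_measurable S" and B: "\<And>z. z \<in> space S \<Longrightarrow> \<bar>F z\<bar> \<le> B"
    and V: "\<And>\<omega> k. (\<omega>, k) \<in> space (history_space G n) \<Longrightarrow>
      V k \<le> (\<integral>(i, j). F (k, i, j) \<partial>(\<sigma> n (\<omega>, k) \<Otimes>\<^sub>M \<tau> n (\<omega>, k)))"
  shows "(\<integral>\<omega>. state_value n V \<omega> \<partial>P) \<le> (\<integral>\<omega>. F (\<omega> n) \<partial>P)"
proof -
  let ?R = "\<lambda>\<omega> :: nat \<Rightarrow> 'k \<times> 'i \<times> 'j. restrict \<omega> {0..<n}"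
  let ?I = "\<lambda>\<omega>. \<integral>z. F z \<partial>play_kernel G k1 \<sigma> \<tau> n (?R \<omega>)"
  have R: "?R \<omega> \<in> space (PiM {0..<n} (\<lambda>_. S))" if "\<omega> \<in> space P" for \<omega>
    using component_space[OF that] by (auto simp: space_PiM)
  have le: "state_value n V \<omega> \<le> ?I \<omega>" if "\<omega> \<in> space P" for \<omega>
  proof -
    have "state_value n V \<omega> = state_value n V (?R \<omega>)" by (simp add: state_value_restrict)
    also have "\<dots> \<le> ?I \<omega>"
      unfolding integral_play_kernel[OF F B R[OF that], simplified] state_value_def
      using R[OF that] by (intro sum_mono mult_left_mono V) (auto simp: history_space_def space_pair_measure)
    finally show ?thesis .
  qed
  have int: "integrable P ?I"
  proof (rule law.integrable_const_bound)
    have "\<bar>?I \<omega>\<bar> \<le> B" if "\<omega> \<in> space P" for \<omega>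
    proof -
      interpret K: prob_space "play_kernel G k1 \<sigma> \<tau> n (?R \<omega>)" by (rule IT.prob_space_P[OF R[OF that]])
      have sp: "space (play_kernel G k1 \<sigma> \<tau> n (?R \<omega>)) = space S" by (rule IT.space_P[OF R[OF that]])
      have "\<bar>?I \<omega>\<bar> \<le> (\<integral>z. \<bar>F z\<bar> \<partial>play_kernel G k1 \<sigma> \<tau> n (?R \<omega>))"
        by (rule integral_abs_bound)
      also have "\<dots> \<le> (\<integral>z. B \<partial>play_kernel G k1 \<sigma> \<tau> n (?R \<omega>))"
      proof (rule integral_mono)
        have "F \<in> borel_measurable (play_kernel G k1 \<sigma> \<tau> n (?R \<omega>))"
          using F by (subst measurable_cong_sets[OF IT.sets_P[OF R[OF that]] refl])
        then show "integrable (play_kernel G k1 \<sigma> \<tau> n (?R \<omega>)) (\<lambda>z. \<bar>F z\<bar>)"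
          by (intro integrable_abs K.integrable_const_bound[of _ B]) (auto simp: sp B)
      qed (auto simp: sp B)
      finally show ?thesis by (simp add: K.prob_space)
    qed
    then show "AE \<omega> in P. norm (?I \<omega>) \<le> B" by (intro AE_I2) simp
    have "?R \<in> P \<rightarrow>\<^sub>M PiM {0..<n} (\<lambda>_. S)"
      by (subst measurable_cong_sets[OF sets_P refl]) (simp add: measurable_restrict_subset)
    then show "?I \<in> borel_measurable P"
      by (rule measurable_compose)
        (rule measurable_compose[OF IT.P integral_measurable_subprob_algebra[OF F]])
  qed
  have "(\<integral>\<omega>. state_value n V \<omega> \<partial>P) \<le> (\<integral>\<omega>. ?I \<omega> \<partial>P)"
    by (rule integral_mono[OF integrable_state_value int le])
  also have "\<dots> = (\<integral>\<omega>. F (\<omega> n) \<partial>P)"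
    unfolding P_eq by (rule IT.integral_lim_component[symmetric, OF F B])
  finally show ?thesis .
qed

lemma integrable_payoff: "integrable P (\<lambda>\<omega>. case \<omega> n of (k, i, j) \<Rightarrow> payoff G k i j)"
proof (rule law.integrable_const_bound)
  show "AE \<omega> in P. norm (case \<omega> n of (k, i, j) \<Rightarrow> payoff G k i j) \<le> 1"
  proof (intro AE_I2)
    fix \<omega> assume "\<omega> \<in> space P"
    from payoff_bounds[OF component_space[OF this, of n]]
    show "norm (case \<omega> n of (k, i, j) \<Rightarrow> payoff G k i j) \<le> 1" by simp
  qed
qed (rule measurable_compose[OF component_measurable payoff_measurable])

lemma stage_payoff_bounds: "stage_payoff G k1 \<sigma> \<tau> n \<in> {0..1}"
proof -
  note b = payoff_bounds[OF component_space]
  have "0 \<le> stage_payoff G k1 \<sigma> \<tau> n"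
    unfolding stage_payoff_def using b by (intro integral_nonneg_AE AE_I2) auto
  moreover have "stage_payoff G k1 \<sigma> \<tau> n \<le> (\<integral>\<omega>. 1 \<partial>P)"
    unfolding stage_payoff_def using b by (intro integral_mono integrable_payoff) auto
  ultimately show ?thesis by (simp add: law.prob_space)
qed

text \<open>The series is dominated by \<open>\<pi>\<close>, so it may be integrated term by term.
  One sequence of stage payoffs thus serves all weights, which is what allows averages and
  discounted sums to be compared.\<close>

lemma expected_payoff_sums:
  assumes \<pi>: "\<pi> \<in> weights"
  shows "(\<lambda>m. \<pi> m * stage_payoff G k1 \<sigma> \<tau> m) sums expected_payoff G \<pi> k1 \<sigma> \<tau>"
proof -
  let ?g = "\<lambda>m \<omega>. case \<omega> m of (k, i, j) \<Rightarrow> payoff G k i j"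
  have p: "0 \<le> \<pi> m" "summable \<pi>" for m using \<pi> by (auto simp: weights_def sums_iff)
  have le: "norm (\<pi> m * ?g m \<omega>) \<le> \<pi> m" and ge: "0 \<le> ?g m \<omega>" if "\<omega> \<in> space P" for m \<omega>
    using payoff_bounds[OF component_space[OF that, of m]] p
    by (auto simp: abs_mult intro: mult_left_le)
  have "(\<lambda>m. \<integral>\<omega>. \<pi> m * ?g m \<omega> \<partial>P) sums (\<integral>\<omega>. (\<Sum>m. \<pi> m * ?g m \<omega>) \<partial>P)"
  proof (rule sums_integral)
    show int: "integrable P (\<lambda>\<omega>. \<pi> m * ?g m \<omega>)" for m
      by (intro integrable_mult_right integrable_payoff)
    show "AE \<omega> in P. summable (\<lambda>m. norm (\<pi> m * ?g m \<omega>))"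
      using le by (intro AE_I2 summable_comparison_test'[OF p(2), of 0]) auto
    have "(\<integral>\<omega>. norm (\<pi> m * ?g m \<omega>) \<partial>P) \<le> (\<integral>\<omega>. \<pi> m \<partial>P)" for m
      using le by (intro integral_mono integrable_norm int) auto
    then have "norm (\<integral>\<omega>. norm (\<pi> m * ?g m \<omega>) \<partial>P) \<le> \<pi> m" for m
      by (simp add: law.prob_space)
    then show "summable (\<lambda>m. \<integral>\<omega>. norm (\<pi> m * ?g m \<omega>) \<partial>P)"
      by (intro summable_comparison_test'[OF p(2), of 0])
  qed
  then show ?thesis by (simp add: stage_payoff_def expected_payoff_def)
qed

text \<open>In expectation, the amount collected plus the potential \<open>V n\<close> at the
  current state drops by at most \<open>\<eta>\<close> per stage; this telescopes. As
  \<open>\<pi>\<close> and \<open>V\<close> may take either sign, negating both yields upper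
  bounds.\<close>

lemma partial_payoff_ge:
  assumes step: "\<And>n \<omega> k. n < N \<Longrightarrow> (\<omega>, k) \<in> space (history_space G n) \<Longrightarrow>
      V n k - \<eta> \<le> (\<integral>(i, j). \<pi> n * payoff G k i j + next_value G (V (Suc n)) k i j
        \<partial>(\<sigma> n (\<omega>, k) \<Otimes>\<^sub>M \<tau> n (\<omega>, k)))"
    and C: "\<And>k. V N k \<le> C"
  shows "V 0 k1 - real N * \<eta> - C \<le> (\<Sum>n<N. \<pi> n * stage_payoff G k1 \<sigma> \<tau> n)"
proof -
  define E where "E n = (\<integral>\<omega>. state_value n (V n) \<omega> \<partial>P)" for n
  have E: "E n - \<eta> \<le> \<pi> n * stage_payoff G k1 \<sigma> \<tau> n + E (Suc n)" if n: "n < N" for n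
  proof -
    define F where "F = (\<lambda>(k, i, j). \<pi> n * payoff G k i j + next_value G (V (Suc n)) k i j)"
    have F_eq: "F z = \<pi> n * (case z of (k, i, j) \<Rightarrow> payoff G k i j) +
        (case z of (k, i, j) \<Rightarrow> next_value G (V (Suc n)) k i j)" for z
      by (simp add: F_def split_beta)
    have F: "F \<in> borel_measurable S" unfolding F_eq[abs_def] by measurable
    have B: "\<bar>F z\<bar> \<le> \<bar>\<pi> n\<bar> + (\<Sum>k\<in>UNIV. \<bar>V (Suc n) k\<bar>)" if "z \<in> space S" for z
    proof -
      obtain k i j where z: "z = (k, i, j)" by (metis prod_cases3)
      have "\<bar>\<pi> n * payoff G k i j\<bar> \<le> \<bar>\<pi> n\<bar>"
        using payoff_bounds[OF that] by (auto simp: z abs_mult intro: mult_left_le)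
      moreover have "\<bar>next_value G (V (Suc n)) k i j\<bar> \<le> (\<Sum>k\<in>UNIV. \<bar>V (Suc n) k\<bar>)"
        by (rule next_value_bound)
      ultimately show ?thesis by (simp add: F_def z)
    qed
    have "state_value n (\<lambda>k. V n k - \<eta>) \<omega> = state_value n (V n) \<omega> - \<eta>" for \<omega>
      using sum_pmf_eq_1[of UNIV "state_law G k1 n \<omega>"]
      by (simp add: state_value_def right_diff_distrib sum_subtractf flip: sum_distrib_right)
    then have "E n - \<eta> = (\<integral>\<omega>. state_value n (\<lambda>k. V n k - \<eta>) \<omega> \<partial>P)"
      by (simp add: E_def Bochner_Integration.integral_diff[OF integrable_state_value] law.prob_space)
    also have "\<dots> \<le> (\<integral>\<omega>. F (\<omega> n) \<partial>P)"
      by (rule integral_component_ge[OF F B]) (use step[OF n] in \<open>simp_all add: F_def\<close>)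
    also have "\<dots> = \<pi> n * stage_payoff G k1 \<sigma> \<tau> n + E (Suc n)"
      unfolding F_eq E_def stage_payoff_def state_value_Suc[symmetric]
      by (simp add: Bochner_Integration.integral_add[OF integrable_mult_right[OF integrable_payoff] integrable_state_value])
    finally show ?thesis .
  qed
  have "E 0 - real n * \<eta> \<le> (\<Sum>m<n. \<pi> m * stage_payoff G k1 \<sigma> \<tau> m) + E n" if "n \<le> N" for n
    using that
  proof (induction n)
    case (Suc n)
    then show ?case using E[of n] by (simp add: algebra_simps)
  qed simp
  from this[of N] have "E 0 - real N * \<eta> \<le> (\<Sum>m<N. \<pi> m * stage_payoff G k1 \<sigma> \<tau> m) + E N" by simp
  moreover have "E N \<le> C" unfolding E_def using C by (rule integral_state_value_le)
  moreover have "E 0 = V 0 k1" by (simp add: E_def state_value_0 law.prob_space)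
  ultimately show ?thesis by simp
qed

end

section \<open>Stage-dependent strategies and the value of weighted games\<close>

text \<open>Constant in the history but not in the stage. The current state may be ignored as well,
  because actions change nothing once the play is absorbed.\<close>

lemma constant_strategies:
  "(\<And>n. \<mu> n \<in> space (prob_algebra (action_space1 G))) \<Longrightarrow> (\<lambda>n _. \<mu> n) \<in> strategies1 G"
  "(\<And>n. \<nu> n \<in> space (prob_algebra (action_space2 G))) \<Longrightarrow> (\<lambda>n _. \<nu> n) \<in> strategies2 G"
  by (auto simp: strategies1_def strategies2_def)

lemma strategies_nonempty:
  assumes "stochastic_game G"
  shows "strategies1 G \<noteq> {}" "strategies2 G \<noteq> {}"
proof -
  obtain i j where "i \<in> actions1 G" "j \<in> actions2 G" using assms by (auto simp: stochastic_game_def)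
  then have "return (action_space1 G) i \<in> space (prob_algebra (action_space1 G))"
    "return (action_space2 G) j \<in> space (prob_algebra (action_space2 G))"
    by (auto simp: space_prob_algebra intro!: prob_space_return)
  from constant_strategies(1)[of "\<lambda>_. _", OF this(1)] constant_strategies(2)[of "\<lambda>_. _", OF this(2)]
  show "strategies1 G \<noteq> {}" "strategies2 G \<noteq> {}" by auto
qed

lemma stage_reward_measurable:
  assumes "stochastic_game G"
  shows "(\<lambda>(i, j). a * payoff G k i j + next_value G V k i j)
    \<in> borel_measurable (action_space1 G \<Otimes>\<^sub>M action_space2 G)"
proof -
  note [measurable] = payoff_section_measurable[OF assms] next_value_section_measurable[OF assms]
  have "(\<lambda>z. a * (case z of (i, j) \<Rightarrow> payoff G k i j) + (case z of (i, j) \<Rightarrow> next_value G V k i j))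
      \<in> borel_measurable (action_space1 G \<Otimes>\<^sub>M action_space2 G)"
    by measurable
  then show ?thesis by (simp add: split_beta)
qed

lemma stage_reward_bound:
  assumes "stochastic_game G" "i \<in> actions1 G" "j \<in> actions2 G"
  shows "\<bar>a * payoff G k i j + next_value G V k i j\<bar> \<le> \<bar>a\<bar> + (\<Sum>k\<in>UNIV. \<bar>V k\<bar>)"
proof -
  have "payoff G k i j \<in> {0..1}" using assms by (simp add: stochastic_game_def)
  then have "\<bar>a * payoff G k i j\<bar> \<le> \<bar>a\<bar>" by (auto simp: abs_mult intro: mult_left_le)
  with next_value_bound[of G V k i j] show ?thesis by linarith
qed

lemma next_value_scale: "next_value G (\<lambda>k. c * V k) k i j = c * next_value G V k i j"
  by (simp add: next_value_def sum_distrib_left mult_ac)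

lemma expected_payoff_bounds:
  assumes "stochastic_game G" "\<sigma> \<in> strategies1 G" "\<tau> \<in> strategies2 G" "\<pi> \<in> weights"
  shows "(\<Sum>n<N. \<pi> n * stage_payoff G k \<sigma> \<tau> n) \<le> expected_payoff G \<pi> k \<sigma> \<tau>"
    and "expected_payoff G \<pi> k \<sigma> \<tau> \<le> (\<Sum>n<N. \<pi> n * stage_payoff G k \<sigma> \<tau> n) + (1 - (\<Sum>n<N. \<pi> n))"
proof -
  interpret play G k \<sigma> \<tau> using assms by (simp add: play.intro)
  have \<pi>: "0 \<le> \<pi> n" "\<pi> sums 1" for n using assms by (auto simp: weights_def)
  note s = expected_payoff_sums[OF assms(4)] and a = stage_payoff_bounds
  have "(\<Sum>n<N. \<pi> n * stage_payoff G k \<sigma> \<tau> n) \<le> (\<Sum>n. \<pi> n * stage_payoff G k \<sigma> \<tau> n)"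
    using \<pi>(1) a by (intro sum_le_suminf sums_summable[OF s]) (auto intro!: mult_nonneg_nonneg)
  then show "(\<Sum>n<N. \<pi> n * stage_payoff G k \<sigma> \<tau> n) \<le> expected_payoff G \<pi> k \<sigma> \<tau>"
    using sums_unique[OF s] by simp
  have s': "(\<lambda>n. \<pi> n - \<pi> n * stage_payoff G k \<sigma> \<tau> n) sums (1 - expected_payoff G \<pi> k \<sigma> \<tau>)"
    by (rule sums_diff[OF \<pi>(2) s])
  have "(\<Sum>n<N. \<pi> n - \<pi> n * stage_payoff G k \<sigma> \<tau> n) \<le> (\<Sum>n. \<pi> n - \<pi> n * stage_payoff G k \<sigma> \<tau> n)"
    using \<pi>(1) a by (intro sum_le_suminf sums_summable[OF s']) (auto intro!: mult_left_le)
  then show "expected_payoff G \<pi> k \<sigma> \<tau> \<le> (\<Sum>n<N. \<pi> n * stage_payoff G k \<sigma> \<tau> n) + (1 - (\<Sum>n<N. \<pi> n))"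
    using sums_unique[OF s'] by (simp add: sum_subtractf)
qed

lemma expected_payoff_unit:
  assumes "stochastic_game G" "\<sigma> \<in> strategies1 G" "\<tau> \<in> strategies2 G" "\<pi> \<in> weights"
  shows "expected_payoff G \<pi> k \<sigma> \<tau> \<in> {0..1}"
  using expected_payoff_bounds[OF assms, of k 0] by simp

text \<open>Payoffs from stage \<open>N\<close> on are nonnegative and simply dropped; what the
  potential promised for them costs at most \<open>C\<close>.\<close>

lemma expected_payoff_ge:
  assumes G: "stochastic_game G" and \<tau>: "\<tau> \<in> strategies2 G" and \<pi>: "\<pi> \<in> weights"
    and \<mu>: "\<And>n. \<mu> n \<in> space (prob_algebra (action_space1 G))"
    and step: "\<And>n k j. n < N \<Longrightarrow> j \<in> actions2 G \<Longrightarrow>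
      V n k - \<eta> \<le> (\<integral>i. \<pi> n * payoff G k i j + next_value G (V (Suc n)) k i j \<partial>\<mu> n)"
    and C: "\<And>k. V N k \<le> C"
  shows "V 0 k - real N * \<eta> - C \<le> expected_payoff G \<pi> k (\<lambda>n _. \<mu> n) \<tau>"
proof -
  have \<sigma>: "(\<lambda>n _. \<mu> n) \<in> strategies1 G" using \<mu> by (rule constant_strategies)
  interpret play G k "\<lambda>n _. \<mu> n" \<tau> using G \<sigma> \<tau> by (rule play.intro)
  have "V 0 k - real N * \<eta> - C \<le> (\<Sum>n<N. \<pi> n * stage_payoff G k (\<lambda>n _. \<mu> n) \<tau> n)"
  proof (rule partial_payoff_ge[where V = V and C = C])
    fix n \<omega> k' assume n: "n < N" and \<omega>: "(\<omega>, k') \<in> space (history_space G n)"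
    have \<tau>n: "\<tau> n (\<omega>, k') \<in> space (prob_algebra (action_space2 G))"
      using \<tau> by (intro measurable_space[OF _ \<omega>]) (simp add: strategies2_def)
    show "V n k' - \<eta> \<le> (\<integral>(i, j). \<pi> n * payoff G k' i j + next_value G (V (Suc n)) k' i j
        \<partial>(\<mu> n \<Otimes>\<^sub>M \<tau> n (\<omega>, k')))"
      by (rule integral_pair_bounds(1)[OF \<mu> \<tau>n stage_reward_measurable[OF G]
          stage_reward_bound[OF G]]) (use step[OF n] in auto)
  qed (rule C)
  also have "\<dots> \<le> expected_payoff G \<pi> k (\<lambda>n _. \<mu> n) \<tau>"
    by (rule expected_payoff_bounds(1)[OF G \<sigma> \<tau> \<pi>])
  finally show ?thesis .
qed

text \<open>The negated form of \<open>partial_payoff_ge\<close>. Payoffs from stage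
  \<open>N\<close> on can be as large as 1, hence the additional term for the remaining
  weight.\<close>

lemma expected_payoff_le:
  assumes G: "stochastic_game G" and \<sigma>: "\<sigma> \<in> strategies1 G" and \<pi>: "\<pi> \<in> weights"
    and \<nu>: "\<And>n. \<nu> n \<in> space (prob_algebra (action_space2 G))"
    and step: "\<And>n k i. n < N \<Longrightarrow> i \<in> actions1 G \<Longrightarrow>
      (\<integral>j. \<pi> n * payoff G k i j + next_value G (V (Suc n)) k i j \<partial>\<nu> n) \<le> V n k + \<eta>"
    and C: "\<And>k. - C \<le> V N k"
  shows "expected_payoff G \<pi> k \<sigma> (\<lambda>n _. \<nu> n) \<le> V 0 k + real N * \<eta> + C + (1 - (\<Sum>n<N. \<pi> n))"
proof -
  have \<tau>: "(\<lambda>n _. \<nu> n) \<in> strategies2 G" using \<nu> by (rule constant_strategies)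
  interpret play G k \<sigma> "\<lambda>n _. \<nu> n" using G \<sigma> \<tau> by (rule play.intro)
  have "- V 0 k - real N * \<eta> - C \<le> (\<Sum>n<N. - \<pi> n * stage_payoff G k \<sigma> (\<lambda>n _. \<nu> n) n)"
  proof (rule partial_payoff_ge[where V = "\<lambda>n k. - V n k"])
    fix n \<omega> k' assume n: "n < N" and \<omega>: "(\<omega>, k') \<in> space (history_space G n)"
    have \<sigma>n: "\<sigma> n (\<omega>, k') \<in> space (prob_algebra (action_space1 G))"
      using \<sigma> by (intro measurable_space[OF _ \<omega>]) (simp add: strategies1_def)
    have "(\<integral>(i, j). \<pi> n * payoff G k' i j + next_value G (V (Suc n)) k' i j
        \<partial>(\<sigma> n (\<omega>, k') \<Otimes>\<^sub>M \<nu> n)) \<le> V n k' + \<eta>"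
      by (rule integral_pair_bounds(2)[OF \<sigma>n \<nu> stage_reward_measurable[OF G]
          stage_reward_bound[OF G]]) (use step[OF n] in auto)
    moreover have "(\<lambda>(i, j). - \<pi> n * payoff G k' i j + next_value G (\<lambda>k. - V (Suc n) k) k' i j) =
        (\<lambda>z. - (case z of (i, j) \<Rightarrow> \<pi> n * payoff G k' i j + next_value G (V (Suc n)) k' i j))"
      by (auto simp: fun_eq_iff next_value_def sum_negf)
    ultimately show "- V n k' - \<eta> \<le> (\<integral>(i, j). - \<pi> n * payoff G k' i j +
        next_value G (\<lambda>k. - V (Suc n) k) k' i j \<partial>(\<sigma> n (\<omega>, k') \<Otimes>\<^sub>M \<nu> n))"
      by simp
  qed (use C in \<open>simp add: minus_le_iff\<close>)
  with expected_payoff_bounds(2)[OF G \<sigma> \<tau> \<pi>, of k N] show ?thesis by (simp add: sum_negf)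
qed

text \<open>On the reals \<open>SUP\<close> and \<open>INF\<close> behave well only for bounded
  nonempty families. Payoffs in \<open>{0..1}\<close> and existing strategies settle these side
  conditions here.\<close>

lemma
  fixes G :: "('k::finite, 'i::topological_space, 'j::topological_space) stoch_game" and k :: 'k
  assumes G: "stochastic_game G" and \<pi>: "\<pi> \<in> weights"
  defines "E \<equiv> expected_payoff G \<pi> k"
  shows sup_inf_ge: "\<And>\<sigma> w. \<sigma> \<in> strategies1 G \<Longrightarrow> (\<And>\<tau>. \<tau> \<in> strategies2 G \<Longrightarrow> w \<le> E \<sigma> \<tau>) \<Longrightarrow>
      w \<le> (SUP \<sigma>\<in>strategies1 G. INF \<tau>\<in>strategies2 G. E \<sigma> \<tau>)"
    and inf_sup_le: "\<And>\<tau> w. \<tau> \<in> strategies2 G \<Longrightarrow> (\<And>\<sigma>. \<sigma> \<in> strategies1 G \<Longrightarrow> E \<sigma> \<tau> \<le> w) \<Longrightarrow>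
      (INF \<tau>\<in>strategies2 G. SUP \<sigma>\<in>strategies1 G. E \<sigma> \<tau>) \<le> w"
    and sup_inf_le_inf_sup: "(SUP \<sigma>\<in>strategies1 G. INF \<tau>\<in>strategies2 G. E \<sigma> \<tau>) \<le>
      (INF \<tau>\<in>strategies2 G. SUP \<sigma>\<in>strategies1 G. E \<sigma> \<tau>)"
proof -
  note ne = strategies_nonempty[OF G]
  have E: "0 \<le> E \<sigma> \<tau>" "E \<sigma> \<tau> \<le> 1" if "\<sigma> \<in> strategies1 G" "\<tau> \<in> strategies2 G" for \<sigma> \<tau>
    using expected_payoff_unit[OF G that \<pi>, of k] by (auto simp: E_def)
  have below: "bdd_below (E \<sigma> ` strategies2 G)" if "\<sigma> \<in> strategies1 G" for \<sigma>
    using E(1)[OF that] by (intro bdd_belowI2)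
  have above: "bdd_above ((\<lambda>\<sigma>. E \<sigma> \<tau>) ` strategies1 G)" if "\<tau> \<in> strategies2 G" for \<tau>
    using E(2)[OF _ that] by (intro bdd_aboveI2)
  obtain \<sigma>0 \<tau>0 where s0: "\<sigma>0 \<in> strategies1 G" "\<tau>0 \<in> strategies2 G" using ne by auto
  have inf_le: "(INF \<tau>\<in>strategies2 G. E \<sigma> \<tau>) \<le> 1" if "\<sigma> \<in> strategies1 G" for \<sigma>
    using cINF_lower[OF below[OF that] s0(2)] E(2)[OF that s0(2)] by simp
  have sup_ge: "0 \<le> (SUP \<sigma>\<in>strategies1 G. E \<sigma> \<tau>)" if "\<tau> \<in> strategies2 G" for \<tau>
    using cSUP_upper[OF s0(1) above[OF that]] E(1)[OF s0(1) that] by simp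
  show "w \<le> (SUP \<sigma>\<in>strategies1 G. INF \<tau>\<in>strategies2 G. E \<sigma> \<tau>)"
    if "\<sigma> \<in> strategies1 G" "\<And>\<tau>. \<tau> \<in> strategies2 G \<Longrightarrow> w \<le> E \<sigma> \<tau>" for \<sigma> w
  proof -
    have "w \<le> (INF \<tau>\<in>strategies2 G. E \<sigma> \<tau>)" by (rule cINF_greatest[OF ne(2) that(2)])
    also have "\<dots> \<le> (SUP \<sigma>\<in>strategies1 G. INF \<tau>\<in>strategies2 G. E \<sigma> \<tau>)"
      by (rule cSUP_upper[OF that(1)]) (use inf_le in \<open>intro bdd_aboveI2\<close>)
    finally show ?thesis .
  qed
  show "(INF \<tau>\<in>strategies2 G. SUP \<sigma>\<in>strategies1 G. E \<sigma> \<tau>) \<le> w"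
    if "\<tau> \<in> strategies2 G" "\<And>\<sigma>. \<sigma> \<in> strategies1 G \<Longrightarrow> E \<sigma> \<tau> \<le> w" for \<tau> w
  proof -
    have "(INF \<tau>\<in>strategies2 G. SUP \<sigma>\<in>strategies1 G. E \<sigma> \<tau>) \<le> (SUP \<sigma>\<in>strategies1 G. E \<sigma> \<tau>)"
      by (rule cINF_lower[OF _ that(1)]) (use sup_ge in \<open>intro bdd_belowI2\<close>)
    also have "\<dots> \<le> w" by (rule cSUP_least[OF ne(1) that(2)])
    finally show ?thesis .
  qed
  show "(SUP \<sigma>\<in>strategies1 G. INF \<tau>\<in>strategies2 G. E \<sigma> \<tau>) \<le>
      (INF \<tau>\<in>strategies2 G. SUP \<sigma>\<in>strategies1 G. E \<sigma> \<tau>)"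
  proof (intro cSUP_least[OF ne(1)] cINF_greatest[OF ne(2)])
    fix \<sigma> \<tau> assume *: "\<sigma> \<in> strategies1 G" "\<tau> \<in> strategies2 G"
    have "(INF \<tau>\<in>strategies2 G. E \<sigma> \<tau>) \<le> E \<sigma> \<tau>" by (rule cINF_lower[OF below[OF *(1)] *(2)])
    also have "\<dots> \<le> (SUP \<sigma>\<in>strategies1 G. E \<sigma> \<tau>)" by (rule cSUP_upper[OF *(1) above[OF *(2)]])
    finally show "(INF \<tau>\<in>strategies2 G. E \<sigma> \<tau>) \<le> (SUP \<sigma>\<in>strategies1 G. E \<sigma> \<tau>)" .
  qed
qed

text \<open>The number \<open>v\<close> may depend on \<open>\<epsilon>\<close>: it only serves to
  show that the gap between the two sides is at most \<open>2 * \<epsilon>\<close>.\<close>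

lemma is_value_if_approx_optimal:
  assumes G: "stochastic_game G" and \<pi>: "\<pi> \<in> weights"
    and approx: "\<And>\<epsilon>. \<epsilon> > 0 \<Longrightarrow> \<exists>v. (\<exists>\<sigma>\<in>strategies1 G. \<forall>\<tau>\<in>strategies2 G. v - \<epsilon> \<le> expected_payoff G \<pi> k \<sigma> \<tau>) \<and>
      (\<exists>\<tau>\<in>strategies2 G. \<forall>\<sigma>\<in>strategies1 G. expected_payoff G \<pi> k \<sigma> \<tau> \<le> v + \<epsilon>)"
  shows "\<exists>v. is_value G \<pi> k v"
proof -
  let ?a = "SUP \<sigma>\<in>strategies1 G. INF \<tau>\<in>strategies2 G. expected_payoff G \<pi> k \<sigma> \<tau>"
  let ?b = "INF \<tau>\<in>strategies2 G. SUP \<sigma>\<in>strategies1 G. expected_payoff G \<pi> k \<sigma> \<tau>"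
  have "?b \<le> ?a + \<epsilon>" if "\<epsilon> > 0" for \<epsilon>
  proof -
    have "\<epsilon> / 2 > 0" using \<open>\<epsilon> > 0\<close> by simp
    from approx[OF this] obtain v \<sigma> \<tau> where *: "\<sigma> \<in> strategies1 G" "\<tau> \<in> strategies2 G"
      "\<forall>\<tau>\<in>strategies2 G. v - \<epsilon> / 2 \<le> expected_payoff G \<pi> k \<sigma> \<tau>"
      "\<forall>\<sigma>\<in>strategies1 G. expected_payoff G \<pi> k \<sigma> \<tau> \<le> v + \<epsilon> / 2"
      by (elim exE conjE bexE)
    have "v - \<epsilon> / 2 \<le> ?a" using * by (intro sup_inf_ge[OF G \<pi> *(1)]) blast
    moreover have "?b \<le> v + \<epsilon> / 2" using * by (intro inf_sup_le[OF G \<pi> *(2)]) blast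
    ultimately show ?thesis by simp
  qed
  then have "?b \<le> ?a" by (rule field_le_epsilon)
  then show ?thesis
    using sup_inf_le_inf_sup[OF G \<pi>, of k] by (auto simp: is_value_def intro!: exI[of _ ?a])
qed

lemma average_weights: "n \<ge> 1 \<Longrightarrow> average_weights n \<in> weights"
proof -
  assume "n \<ge> 1"
  have "average_weights n sums (\<Sum>m<n. average_weights n m)"
    by (rule sums_finite) (auto simp: average_weights_def)
  with \<open>n \<ge> 1\<close> show ?thesis by (simp add: weights_def average_weights_def)
qed

lemma expected_payoff_average:
  assumes "stochastic_game G" "\<sigma> \<in> strategies1 G" "\<tau> \<in> strategies2 G" "n \<ge> 1"
  shows "real n * expected_payoff G (average_weights n) k \<sigma> \<tau> = (\<Sum>m<n. stage_payoff G k \<sigma> \<tau> m)"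
proof -
  interpret play G k \<sigma> \<tau> using assms by (simp add: play.intro)
  have "(\<lambda>m. average_weights n m * stage_payoff G k \<sigma> \<tau> m) sums
      (\<Sum>m<n. average_weights n m * stage_payoff G k \<sigma> \<tau> m)"
    by (rule sums_finite) (auto simp: average_weights_def)
  from sums_unique2[OF expected_payoff_sums[OF average_weights[OF assms(4)]] this]
  show ?thesis using assms(4) by (simp add: average_weights_def flip: sum_divide_distrib)
qed

section \<open>Discounted weights, Abel summation and remaining weight\<close>

definition discounted_weights :: "real \<Rightarrow> nat \<Rightarrow> real" where
  "discounted_weights d n = d * (1 - d) ^ n"

lemma sum_discounted_weights: "1 - (\<Sum>n<N. discounted_weights d n) = (1 - d) ^ N"
  by (induction N) (simp_all add: discounted_weights_def algebra_simps)

lemma discounted_weights: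
  assumes "0 < d" "d \<le> 1"
  shows "discounted_weights d \<in> weights"
proof -
  have "(\<lambda>n. d * (1 - d) ^ n) sums (d * (1 / (1 - (1 - d))))"
    using assms by (intro sums_mult geometric_sums) auto
  then show ?thesis using assms by (simp add: weights_def discounted_weights_def[abs_def])
qed

text \<open>Partial sums of \<open>a n - L\<close> are nonnegative from \<open>N\<close> on, and
  before that at least \<open>- real N\<close> because each term is at least -1. The discounted
  weights decrease from \<open>d\<close>, so this deficit costs at most
  \<open>real N * d\<close>.\<close>

lemma abel_lower_bound:
  fixes a :: "nat \<Rightarrow> real"
  assumes d: "0 < d" "d \<le> 1" and a: "\<And>n. 0 \<le> a n" and L: "L \<le> 1"
    and avg: "\<And>n. N \<le> n \<Longrightarrow> real n * L \<le> (\<Sum>m<n. a m)"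
    and s: "(\<lambda>n. discounted_weights d n * a n) sums E"
  shows "L - real N * d \<le> E"
proof -
  define b where "b m = a m - L" for m
  have "- real N \<le> (\<Sum>m<n. b m)" for n
  proof (cases "N \<le> n")
    case True
    then show ?thesis using avg[OF True] by (simp add: b_def sum_subtractf)
  next
    case False
    have "- real N \<le> (\<Sum>m<n. - 1)" using False by simp
    also have "\<dots> \<le> (\<Sum>m<n. b m)" 
    proof (intro sum_mono)
      show "- 1 \<le> b m" for m using a[of m] L by (simp add: b_def)
    qed
    finally show ?thesis .
  qed
  then have B: "0 \<le> (\<Sum>m<n. b m) + real N" for n
    using add_right_mono[of "- real N" "\<Sum>m<n. b m" "real N"] by simp
  \<comment> \<open>Abel summation as an invariant: the shifted partial sum is nonnegative, so
    replacing its weight by the next, smaller one only lowers the left side.\<close>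
  have "discounted_weights d M * ((\<Sum>m<M. b m) + real N) - real N * d \<le> (\<Sum>m<M. discounted_weights d m * b m)" for M
  proof (induction M)
    case (Suc M)
    have "discounted_weights d (Suc M) \<le> discounted_weights d M"
      using d by (simp add: discounted_weights_def mult_left_le_one_le)
    then have "discounted_weights d (Suc M) * ((\<Sum>m<Suc M. b m) + real N) \<le>
        discounted_weights d M * ((\<Sum>m<Suc M. b m) + real N)"
      using B by (rule mult_right_mono)
    then show ?case using Suc by (simp add: algebra_simps)
  qed (simp add: discounted_weights_def)
  moreover have "0 \<le> discounted_weights d M * ((\<Sum>m<M. b m) + real N)" for M
    using B[of M] d by (simp add: discounted_weights_def)
  ultimately have ge: "- real N * d \<le> (\<Sum>m<M. discounted_weights d m * b m)" for M
    by (smt (verit) mult_minus_left)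
  have "(\<lambda>n. discounted_weights d n * b n) sums (E - 1 * L)"
    using sums_diff[OF s sums_mult2[of "discounted_weights d" 1 L]] discounted_weights[OF d]
    by (simp add: b_def weights_def algebra_simps)
  then have "- real N * d \<le> E - 1 * L"
    unfolding sums_def by (rule LIMSEQ_le_const) (use ge in blast)
  then show ?thesis by simp
qed

definition tail :: "(nat \<Rightarrow> real) \<Rightarrow> nat \<Rightarrow> real" where
  "tail \<pi> n = 1 - (\<Sum>m<n. \<pi> m)"

lemma tail_0 [simp]: "tail \<pi> 0 = 1"
  by (simp add: tail_def)

lemma tail_Suc: "tail \<pi> (Suc n) = tail \<pi> n - \<pi> n"
  by (simp add: tail_def)

lemma tail_bounds:
  assumes "\<pi> \<in> weights"
  shows "0 \<le> tail \<pi> n" "tail \<pi> n \<le> 1"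
proof -
  have \<pi>: "0 \<le> \<pi> m" "\<pi> sums 1" for m using assms by (auto simp: weights_def)
  have "(\<Sum>m<n. \<pi> m) \<le> (\<Sum>m. \<pi> m)"
    using \<pi> by (intro sum_le_suminf sums_summable[OF \<pi>(2)]) auto
  then show "0 \<le> tail \<pi> n" using sums_unique[OF \<pi>(2)] by (simp add: tail_def)
  show "tail \<pi> n \<le> 1" using \<pi>(1) by (simp add: tail_def sum_nonneg)
qed

lemma tail_small:
  assumes "\<pi> \<in> weights" "\<delta> > 0"
  shows "\<exists>N. tail \<pi> N < \<delta>"
proof -
  have "(\<lambda>n. \<Sum>m<n. \<pi> m) \<longlonglongrightarrow> 1" using assms(1) by (simp add: weights_def sums_def)
  from LIMSEQ_D[OF this assms(2)] obtain N where "\<bar>(\<Sum>m<N. \<pi> m) - 1\<bar> < \<delta>" by auto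
  then show ?thesis by (intro exI[of _ N]) (simp add: tail_def)
qed

subsection \<open>Absorbing games\<close>

text \<open>\<open>k0\<close> may itself be absorbing, and \<open>c\<close> is tied to the payoff
  only off \<open>k0\<close>. This treats games with and without a nonabsorbing state alike.\<close>

locale compact_absorbing_game =
  fixes G :: "('k::finite, 'i::topological_space, 'j::topological_space) stoch_game"
    and k0 :: 'k and c :: "'k \<Rightarrow> real"
  assumes G: "stochastic_game G" and cont: "separately_continuous G"
    and compact: "compact (actions1 G)" "compact (actions2 G)"
    and abs_payoff: "\<And>k i j. k \<noteq> k0 \<Longrightarrow> i \<in> actions1 G \<Longrightarrow> j \<in> actions2 G \<Longrightarrow> payoff G k i j = c k"
    and abs_trans: "\<And>k i j. k \<noteq> k0 \<Longrightarrow> i \<in> actions1 G \<Longrightarrow> j \<in> actions2 G \<Longrightarrow> trans_law G k i j = return_pmf k"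
begin

abbreviation "mixed1 \<equiv> space (prob_algebra (action_space1 G))"
abbreviation "mixed2 \<equiv> space (prob_algebra (action_space2 G))"

lemma actions_nonempty: "actions1 G \<noteq> {}" "actions2 G \<noteq> {}"
  using G by (auto simp: stochastic_game_def)

lemma c_bounds: "k \<noteq> k0 \<Longrightarrow> 0 \<le> c k" "k \<noteq> k0 \<Longrightarrow> c k \<le> 1"
proof -
  assume k: "k \<noteq> k0"
  obtain i j where ij: "i \<in> actions1 G" "j \<in> actions2 G" using actions_nonempty by auto
  then have "payoff G k i j \<in> {0..1}" using G by (auto simp: stochastic_game_def)
  then show "0 \<le> c k" "c k \<le> 1" using abs_payoff[OF k ij] by auto
qed

lemma next_value_absorbing:
  "k \<noteq> k0 \<Longrightarrow> i \<in> actions1 G \<Longrightarrow> j \<in> actions2 G \<Longrightarrow> next_value G V k i j = V k"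
  by (simp add: next_value_def abs_trans pmf_return indicator_def if_distrib cong: if_cong)

lemma integral_absorbing1:
  assumes "k \<noteq> k0" "\<mu> \<in> mixed1" "j \<in> actions2 G"
  shows "(\<integral>i. a * payoff G k i j + next_value G V k i j \<partial>\<mu>) = a * c k + V k"
proof -
  interpret prob_space \<mu> using assms by (simp add: space_prob_algebra)
  have sp: "space \<mu> = actions1 G" 
    using assms(2) sets_eq_imp_space_eq[of \<mu> "action_space1 G"] by (simp add: space_prob_algebra)
  have "(\<integral>i. a * payoff G k i j + next_value G V k i j \<partial>\<mu>) = (\<integral>i. a * c k + V k \<partial>\<mu>)"
    by (rule Bochner_Integration.integral_cong) (use assms in \<open>auto simp: sp abs_payoff next_value_absorbing\<close>)
  then show ?thesis by (simp add: prob_space)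
qed

lemma integral_absorbing2:
  assumes "k \<noteq> k0" "\<nu> \<in> mixed2" "i \<in> actions1 G"
  shows "(\<integral>j. a * payoff G k i j + next_value G V k i j \<partial>\<nu>) = a * c k + V k"
proof -
  interpret prob_space \<nu> using assms by (simp add: space_prob_algebra)
  have sp: "space \<nu> = actions2 G"
    using assms(2) sets_eq_imp_space_eq[of \<nu> "action_space2 G"] by (simp add: space_prob_algebra)
  have "(\<integral>j. a * payoff G k i j + next_value G V k i j \<partial>\<nu>) = (\<integral>j. a * c k + V k \<partial>\<nu>)"
    by (rule Bochner_Integration.integral_cong) (use assms in \<open>auto simp: sp abs_payoff next_value_absorbing\<close>)
  then show ?thesis by (simp add: prob_space)
qed

lemma continuous_payoff:
  "j \<in> actions2 G \<Longrightarrow> continuous_on (actions1 G) (\<lambda>i. payoff G k i j)"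
  "i \<in> actions1 G \<Longrightarrow> continuous_on (actions2 G) (\<lambda>j. payoff G k i j)"
  using cont by (auto simp: separately_continuous_def)

lemma continuous_next_value:
  "j \<in> actions2 G \<Longrightarrow> continuous_on (actions1 G) (\<lambda>i. next_value G V k i j)"
  "i \<in> actions1 G \<Longrightarrow> continuous_on (actions2 G) (\<lambda>j. next_value G V k i j)"
  unfolding next_value_def using cont
  by (auto simp: separately_continuous_def intro!: continuous_intros)

lemma integrable_payoff_next_value:
  "\<mu> \<in> mixed1 \<Longrightarrow> j \<in> actions2 G \<Longrightarrow> integrable \<mu> (\<lambda>i. payoff G k i j)"
  "\<mu> \<in> mixed1 \<Longrightarrow> j \<in> actions2 G \<Longrightarrow> integrable \<mu> (\<lambda>i. next_value G V k i j)"
  "\<nu> \<in> mixed2 \<Longrightarrow> i \<in> actions1 G \<Longrightarrow> integrable \<nu> (\<lambda>j. payoff G k i j)"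
  "\<nu> \<in> mixed2 \<Longrightarrow> i \<in> actions1 G \<Longrightarrow> integrable \<nu> (\<lambda>j. next_value G V k i j)"
proof -
  have int: "integrable \<mu> f" if "\<mu> \<in> space (prob_algebra (restrict_space borel A))"
    "continuous_on A f" "\<And>x. x \<in> A \<Longrightarrow> \<bar>f x\<bar> \<le> K" for \<mu> and f :: "'x::topological_space \<Rightarrow> real" and A K
  proof -
    interpret prob_space \<mu> using that by (simp add: space_prob_algebra)
    have s: "sets \<mu> = sets (restrict_space borel A)" using that by (simp add: space_prob_algebra)
    have sp: "space \<mu> = A" using sets_eq_imp_space_eq[OF s] by (simp add: space_restrict_space)
    have "f \<in> borel_measurable \<mu>"
      by (subst measurable_cong_sets[OF s refl]) (rule borel_measurable_continuous_on_restrict[OF that(2)])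
    then show ?thesis
      by (intro integrable_const_bound[of _ K]) (auto simp: sp that(3))
  qed
  have p: "\<bar>payoff G k i j\<bar> \<le> 1" if "i \<in> actions1 G" "j \<in> actions2 G" for i j
    using stage_reward_bound[OF G that, of 1 k "\<lambda>_. 0"] by (simp add: next_value_def)
  show "\<mu> \<in> mixed1 \<Longrightarrow> j \<in> actions2 G \<Longrightarrow> integrable \<mu> (\<lambda>i. payoff G k i j)"
    "\<mu> \<in> mixed1 \<Longrightarrow> j \<in> actions2 G \<Longrightarrow> integrable \<mu> (\<lambda>i. next_value G V k i j)"
    unfolding action_space1_def
    by (auto intro!: int continuous_payoff continuous_next_value p next_value_bound)
  show "\<nu> \<in> mixed2 \<Longrightarrow> i \<in> actions1 G \<Longrightarrow> integrable \<nu> (\<lambda>j. payoff G k i j)"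
    "\<nu> \<in> mixed2 \<Longrightarrow> i \<in> actions1 G \<Longrightarrow> integrable \<nu> (\<lambda>j. next_value G V k i j)"
    unfolding action_space2_def
    by (auto intro!: int continuous_payoff continuous_next_value p next_value_bound)
qed

section \<open>The one-shot game at \<open>k0\<close> and existence of values\<close>

text \<open>Stated through \<open>\<epsilon>\<close>-optimal mixed actions, the form in which
  minimax provides the value.\<close>

definition one_shot_value :: "real \<Rightarrow> ('k \<Rightarrow> real) \<Rightarrow> real \<Rightarrow> bool" where
  "one_shot_value a V v \<longleftrightarrow> (\<forall>\<epsilon>>0.
    (\<exists>\<mu>\<in>mixed1. \<forall>j\<in>actions2 G. v - \<epsilon> \<le> (\<integral>i. a * payoff G k0 i j + next_value G V k0 i j \<partial>\<mu>)) \<and>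
    (\<exists>\<nu>\<in>mixed2. \<forall>i\<in>actions1 G. (\<integral>j. a * payoff G k0 i j + next_value G V k0 i j \<partial>\<nu>) \<le> v + \<epsilon>))"

lemma ex_one_shot_value: "\<exists>v. one_shot_value a V v"
  unfolding one_shot_value_def action_space1_def action_space2_def
  by (rule minimax_separately_continuous[OF compact(1) actions_nonempty(1) compact(2) actions_nonempty(2)])
    (auto intro!: continuous_intros continuous_payoff continuous_next_value stage_reward_bound[OF G])

lemma one_shot_valueD:
  assumes "one_shot_value a V v" "\<epsilon> > 0"
  shows "\<exists>\<mu>\<in>mixed1. \<forall>j\<in>actions2 G. v - \<epsilon> \<le> (\<integral>i. a * payoff G k0 i j + next_value G V k0 i j \<partial>\<mu>)"
    and "\<exists>\<nu>\<in>mixed2. \<forall>i\<in>actions1 G. (\<integral>j. a * payoff G k0 i j + next_value G V k0 i j \<partial>\<nu>) \<le> v + \<epsilon>"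
  using assms unfolding one_shot_value_def by auto

text \<open>Backward induction on the game cut at a stage \<open>N\<close> after which less than
  \<open>\<epsilon> / 2\<close> of the weight remains. The near-optimal actions of the one-shot
  games lose \<open>\<eta>\<close> per stage, together at most
  \<open>\<epsilon> / 2\<close>.\<close>

lemma ex_value:
  assumes \<pi>: "\<pi> \<in> weights"
  shows "\<exists>v. is_value G \<pi> k v"
proof (rule is_value_if_approx_optimal[OF G \<pi>])
  fix \<epsilon> :: real assume "\<epsilon> > 0"
  then obtain N where N: "tail \<pi> N < \<epsilon> / 2" using tail_small[OF \<pi>, of "\<epsilon> / 2"] by auto
  define \<eta> where "\<eta> = \<epsilon> / (2 * (real N + 1))"
  have \<eta>: "\<eta> > 0" using \<open>\<epsilon> > 0\<close> by (simp add: \<eta>_def)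
  have N\<eta>: "real N * \<eta> \<le> \<epsilon> / 2" using \<open>\<epsilon> > 0\<close> by (simp add: \<eta>_def field_simps)
  note t = tail_bounds[OF \<pi>]
  define val where "val a V = (SOME v. one_shot_value a V v)" for a V
  have val: "one_shot_value a V (val a V)" for a V
    unfolding val_def by (rule someI_ex[OF ex_one_shot_value])
  \<comment> \<open>\<open>U r\<close> is the potential at \<open>k0\<close> with \<open>r\<close>
    stages left, so the current stage is \<open>N - r\<close>. It starts from 0, as nothing after
    the cut is counted at \<open>k0\<close>; elsewhere \<open>tail \<pi> n * c k\<close> is the
    exact future reward.\<close>
  define U where "U = rec_nat 0 (\<lambda>r u. val (\<pi> (N - Suc r)) (\<lambda>k. if k = k0 then u else tail \<pi> (N - r) * c k))"
  define V where "V n k = (if k = k0 then U (N - n) else tail \<pi> n * c k)" for n k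
  have V: "V n k0 = val (\<pi> n) (V (Suc n))" if n: "n < N" for n
  proof -
    define r where "r = N - Suc n"
    have r: "N - n = Suc r" "N - Suc r = n" "N - r = Suc n" "N - Suc n = r"
      using n by (auto simp: r_def)
    have U: "U (Suc r) = val (\<pi> (N - Suc r)) (\<lambda>k. if k = k0 then U r else tail \<pi> (N - r) * c k)"
      unfolding U_def by simp
    show ?thesis unfolding V_def[abs_def] r U by simp
  qed
  have Vabs: "V n k = \<pi> n * c k + V (Suc n) k" if "k \<noteq> k0" for n k
    using that by (simp add: V_def tail_Suc algebra_simps)
  have VN: "0 \<le> V N k" "V N k \<le> \<epsilon> / 2" for k
  proof -
    have "tail \<pi> N * c k \<le> tail \<pi> N" if "k \<noteq> k0" using that t c_bounds by (intro mult_left_le) auto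
    then show "0 \<le> V N k" "V N k \<le> \<epsilon> / 2" using c_bounds[of k] t N \<open>\<epsilon> > 0\<close>
      by (force simp: V_def U_def)+
  qed
  have "\<forall>n. \<exists>\<mu>. \<mu> \<in> mixed1 \<and> (\<forall>j\<in>actions2 G.
      val (\<pi> n) (V (Suc n)) - \<eta> \<le> (\<integral>i. \<pi> n * payoff G k0 i j + next_value G (V (Suc n)) k0 i j \<partial>\<mu>))"
    using one_shot_valueD(1)[OF val \<eta>] unfolding Bex_def by (rule allI)
  then obtain \<mu> where \<mu>: "\<And>n. \<mu> n \<in> mixed1" "\<And>n j. j \<in> actions2 G \<Longrightarrow>
      val (\<pi> n) (V (Suc n)) - \<eta> \<le> (\<integral>i. \<pi> n * payoff G k0 i j + next_value G (V (Suc n)) k0 i j \<partial>\<mu> n)"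
    unfolding choice_iff by blast
  have "\<forall>n. \<exists>\<nu>. \<nu> \<in> mixed2 \<and> (\<forall>i\<in>actions1 G.
      (\<integral>j. \<pi> n * payoff G k0 i j + next_value G (V (Suc n)) k0 i j \<partial>\<nu>) \<le> val (\<pi> n) (V (Suc n)) + \<eta>)"
    using one_shot_valueD(2)[OF val \<eta>] unfolding Bex_def by (rule allI)
  then obtain \<nu> where \<nu>: "\<And>n. \<nu> n \<in> mixed2" "\<And>n i. i \<in> actions1 G \<Longrightarrow>
      (\<integral>j. \<pi> n * payoff G k0 i j + next_value G (V (Suc n)) k0 i j \<partial>\<nu> n) \<le> val (\<pi> n) (V (Suc n)) + \<eta>"
    unfolding choice_iff by blast
  have "V 0 k - \<epsilon> \<le> expected_payoff G \<pi> k (\<lambda>n _. \<mu> n) \<tau>" if "\<tau> \<in> strategies2 G" for \<tau>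
  proof -
    have "V 0 k - real N * \<eta> - \<epsilon> / 2 \<le> expected_payoff G \<pi> k (\<lambda>n _. \<mu> n) \<tau>"
    proof (rule expected_payoff_ge[OF G that \<pi> \<mu>(1)])
      fix n k j assume "n < N" "j \<in> actions2 G"
      then show "V n k - \<eta> \<le> (\<integral>i. \<pi> n * payoff G k i j + next_value G (V (Suc n)) k i j \<partial>\<mu> n)"
        using \<mu>(2) V \<eta> Vabs[of k n] by (cases "k = k0") (simp_all add: integral_absorbing1 \<mu>(1))
    qed (rule VN)
    with N\<eta> show ?thesis by simp
  qed
  moreover have "expected_payoff G \<pi> k \<sigma> (\<lambda>n _. \<nu> n) \<le> V 0 k + \<epsilon>" if "\<sigma> \<in> strategies1 G" for \<sigma>
  proof -
    have "expected_payoff G \<pi> k \<sigma> (\<lambda>n _. \<nu> n) \<le> V 0 k + real N * \<eta> + 0 + (1 - (\<Sum>n<N. \<pi> n))"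
    proof (rule expected_payoff_le[OF G that \<pi> \<nu>(1)])
      fix n k i assume "n < N" "i \<in> actions1 G"
      then show "(\<integral>j. \<pi> n * payoff G k i j + next_value G (V (Suc n)) k i j \<partial>\<nu> n) \<le> V n k + \<eta>"
        using \<nu>(2) V \<eta> Vabs[of k n] by (cases "k = k0") (simp_all add: integral_absorbing2 \<nu>(1))
    qed (use VN in simp)
    with N\<eta> N show ?thesis by (simp add: tail_def)
  qed
  ultimately show "\<exists>v. (\<exists>\<sigma>\<in>strategies1 G. \<forall>\<tau>\<in>strategies2 G. v - \<epsilon> \<le> expected_payoff G \<pi> k \<sigma> \<tau>) \<and>
      (\<exists>\<tau>\<in>strategies2 G. \<forall>\<sigma>\<in>strategies1 G. expected_payoff G \<pi> k \<sigma> \<tau> \<le> v + \<epsilon>)"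
    using constant_strategies(1)[OF \<mu>(1)] constant_strategies(2)[OF \<nu>(1)]
    by (intro exI[of _ "V 0 k"] conjI bexI[of _ "\<lambda>n _. \<mu> n"] bexI[of _ "\<lambda>n _. \<nu> n"] ballI)
qed

section \<open>One-shot guarantees and what they give in the weighted game\<close>

definition glue :: "real \<Rightarrow> 'k \<Rightarrow> real" where
  "glue w k = (if k = k0 then w else c k)"

text \<open>\<open>w\<close> is a subsolution of the Shapley equation at \<open>k0\<close>, that is,
  at most the \<open>d\<close>-discounted Shapley operator applied to \<open>glue w\<close>;
  \<open>guarantee2\<close> is the supersolution. Having the same \<open>w\<close> on both sides is
  what lets the inequality be iterated.\<close>

definition guarantee1 :: "real \<Rightarrow> real \<Rightarrow> bool" where
  "guarantee1 d w \<longleftrightarrow> (\<forall>\<eta>>0. \<exists>\<mu>\<in>mixed1. \<forall>j\<in>actions2 G.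
     w - \<eta> \<le> (\<integral>i. d * payoff G k0 i j + next_value G (\<lambda>k. (1 - d) * glue w k) k0 i j \<partial>\<mu>))"

definition guarantee2 :: "real \<Rightarrow> real \<Rightarrow> bool" where
  "guarantee2 d w \<longleftrightarrow> (\<forall>\<eta>>0. \<exists>\<nu>\<in>mixed2. \<forall>i\<in>actions1 G.
     (\<integral>j. d * payoff G k0 i j + next_value G (\<lambda>k. (1 - d) * glue w k) k0 i j \<partial>\<nu>) \<le> w + \<eta>)"

lemma scaled_stage_reward:
  "s * d * payoff G k i j + next_value G (\<lambda>k. s * (1 - d) * V k) k i j =
   s * (d * payoff G k i j + next_value G (\<lambda>k. (1 - d) * V k) k i j)"
  by (simp add: next_value_def sum_distrib_left algebra_simps)

text \<open>At the stages \<open>n < N\<close> the remaining weight is at least \<open>\<delta>\<close>, so that \<open>\<pi> n / tail \<pi> n \<le> b\<close>.\<close>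

lemma weighted_bounds:
  assumes \<pi>: "\<pi> \<in> weights" and \<delta>: "\<delta> > 0" and small: "\<And>m. \<pi> m \<le> b * \<delta>"
  shows "(\<And>d. d \<in> {0..b} \<Longrightarrow> guarantee1 d w) \<Longrightarrow> w \<le> 1 \<Longrightarrow>
      \<exists>\<sigma>\<in>strategies1 G. \<forall>\<tau>\<in>strategies2 G. glue w k - 2 * \<delta> \<le> expected_payoff G \<pi> k \<sigma> \<tau>"
    and "(\<And>d. d \<in> {0..b} \<Longrightarrow> guarantee2 d w) \<Longrightarrow> 0 \<le> w \<Longrightarrow>
      \<exists>\<tau>\<in>strategies2 G. \<forall>\<sigma>\<in>strategies1 G. expected_payoff G \<pi> k \<sigma> \<tau> \<le> glue w k + 2 * \<delta>"
proof -
  have \<pi>0: "0 \<le> \<pi> m" for m using \<pi> by (simp add: weights_def)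
  note t = tail_bounds[OF \<pi>]
  define N where "N = (LEAST N. tail \<pi> N < \<delta>)"
  have N: "tail \<pi> N < \<delta>" unfolding N_def using tail_small[OF \<pi> \<delta>] by (rule LeastI_ex)
  have before: "\<delta> \<le> tail \<pi> n" if "n < N" for n
    using not_less_Least[of n "\<lambda>N. tail \<pi> N < \<delta>"] that by (simp add: N_def)
  \<comment> \<open>The default 0 keeps \<open>d n\<close> in \<open>{0..b}\<close> for all
    \<open>n\<close>, so that mixed actions can be chosen for all stages at once.\<close>
  define d where "d n = (if n < N then \<pi> n / tail \<pi> n else 0)" for n
  have "0 \<le> b * \<delta>" using \<pi>0[of 0] small[of 0] by simp
  then have b: "0 \<le> b" using \<delta> by (simp add: zero_le_mult_iff)
  have d: "d n \<in> {0..b}" for n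
  proof (cases "n < N")
    case True
    have "\<pi> n \<le> b * tail \<pi> n"
      using small[of n] mult_left_mono[OF before[OF True] b] by simp
    then show ?thesis using True before[OF True] \<delta> \<pi>0 by (simp add: d_def divide_le_eq)
  qed (simp add: d_def b)
  have split: "\<pi> n = tail \<pi> n * d n" "tail \<pi> (Suc n) = tail \<pi> n * (1 - d n)" if "n < N" for n
    using before[OF that] that \<delta> by (auto simp: d_def tail_Suc field_simps)
  \<comment> \<open>The one-stage losses before \<open>N\<close> add up to at most one
    \<open>\<delta>\<close>; the other \<open>\<delta>\<close> of the conclusion pays for the stages
    from \<open>N\<close> on.\<close>
  define \<eta> where "\<eta> = \<delta> / (real N + 1)"
  have \<eta>: "\<eta> > 0" using \<delta> by (simp add: \<eta>_def)
  have N\<eta>: "real N * \<eta> \<le> \<delta>" using \<delta> by (simp add: \<eta>_def field_simps)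
  define V where "V n k = tail \<pi> n * glue w k" for n k
  have reward: "\<pi> n * payoff G k i j + next_value G (V (Suc n)) k i j =
      tail \<pi> n * (d n * payoff G k i j + next_value G (\<lambda>k. (1 - d n) * glue w k) k i j)" if "n < N" for n k i j
    unfolding V_def[abs_def] split[OF that] by (rule scaled_stage_reward)
  have Vabs: "V n k = \<pi> n * c k + V (Suc n) k" if "k \<noteq> k0" for n k
    using that by (simp add: V_def glue_def tail_Suc algebra_simps)
  have t\<eta>: "tail \<pi> n * \<eta> \<le> \<eta>" for n using t \<eta> by (intro mult_left_le_one_le) auto
  {
    assume g: "\<And>d. d \<in> {0..b} \<Longrightarrow> guarantee1 d w" and "w \<le> 1"
    have "\<forall>n. \<exists>\<mu>. \<mu> \<in> mixed1 \<and> (\<forall>j\<in>actions2 G.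
        w - \<eta> \<le> (\<integral>i. d n * payoff G k0 i j + next_value G (\<lambda>k. (1 - d n) * glue w k) k0 i j \<partial>\<mu>))"
      using g[OF d] \<eta> unfolding guarantee1_def Bex_def by simp
    then obtain \<mu> where \<mu>: "\<And>n. \<mu> n \<in> mixed1" "\<And>n j. j \<in> actions2 G \<Longrightarrow>
        w - \<eta> \<le> (\<integral>i. d n * payoff G k0 i j + next_value G (\<lambda>k. (1 - d n) * glue w k) k0 i j \<partial>\<mu> n)"
      unfolding choice_iff by blast
    have "V N k \<le> \<delta>" for k
    proof -
      have "V N k \<le> tail \<pi> N"
        unfolding V_def using t c_bounds \<open>w \<le> 1\<close> by (intro mult_left_le) (auto simp: glue_def)
      with N show ?thesis by simp
    qed
    then have "V 0 k - real N * \<eta> - \<delta> \<le> expected_payoff G \<pi> k (\<lambda>n _. \<mu> n) \<tau>"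
      if "\<tau> \<in> strategies2 G" for \<tau>
    proof (rule expected_payoff_ge[OF G that \<pi> \<mu>(1), rotated])
      fix n k j assume n: "n < N" and j: "j \<in> actions2 G"
      show "V n k - \<eta> \<le> (\<integral>i. \<pi> n * payoff G k i j + next_value G (V (Suc n)) k i j \<partial>\<mu> n)"
      proof (cases "k = k0")
        case True
        have "V n k0 - \<eta> \<le> tail \<pi> n * (w - \<eta>)"
          using t\<eta>[of n] by (simp add: V_def glue_def algebra_simps)
        also have "\<dots> \<le> tail \<pi> n * (\<integral>i. d n * payoff G k0 i j + next_value G (\<lambda>k. (1 - d n) * glue w k) k0 i j \<partial>\<mu> n)"
          using \<mu>(2)[OF j] t by (intro mult_left_mono)
        finally show ?thesis unfolding reward[OF n] True by simp
      next
        case False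
        then show ?thesis using \<eta> by (simp add: integral_absorbing1[OF False \<mu>(1) j] Vabs[of k n])
      qed
    qed
    then show "\<exists>\<sigma>\<in>strategies1 G. \<forall>\<tau>\<in>strategies2 G. glue w k - 2 * \<delta> \<le> expected_payoff G \<pi> k \<sigma> \<tau>"
      using constant_strategies(1)[OF \<mu>(1)] N\<eta> by (intro bexI[of _ "\<lambda>n _. \<mu> n"]) (force simp: V_def)+
  }
  {
    assume g: "\<And>d. d \<in> {0..b} \<Longrightarrow> guarantee2 d w" and "0 \<le> w"
    have "\<forall>n. \<exists>\<nu>. \<nu> \<in> mixed2 \<and> (\<forall>i\<in>actions1 G.
        (\<integral>j. d n * payoff G k0 i j + next_value G (\<lambda>k. (1 - d n) * glue w k) k0 i j \<partial>\<nu>) \<le> w + \<eta>)"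
      using g[OF d] \<eta> unfolding guarantee2_def Bex_def by simp
    then obtain \<nu> where \<nu>: "\<And>n. \<nu> n \<in> mixed2" "\<And>n i. i \<in> actions1 G \<Longrightarrow>
        (\<integral>j. d n * payoff G k0 i j + next_value G (\<lambda>k. (1 - d n) * glue w k) k0 i j \<partial>\<nu> n) \<le> w + \<eta>"
      unfolding choice_iff by blast
    have "- 0 \<le> V N k" for k
      using t c_bounds \<open>0 \<le> w\<close> by (auto simp: V_def glue_def)
    then have "expected_payoff G \<pi> k \<sigma> (\<lambda>n _. \<nu> n) \<le> V 0 k + real N * \<eta> + 0 + (1 - (\<Sum>n<N. \<pi> n))"
      if "\<sigma> \<in> strategies1 G" for \<sigma>
    proof (rule expected_payoff_le[OF G that \<pi> \<nu>(1), rotated])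
      fix n k i assume n: "n < N" and i: "i \<in> actions1 G"
      show "(\<integral>j. \<pi> n * payoff G k i j + next_value G (V (Suc n)) k i j \<partial>\<nu> n) \<le> V n k + \<eta>"
      proof (cases "k = k0")
        case True
        have "tail \<pi> n * (\<integral>j. d n * payoff G k0 i j + next_value G (\<lambda>k. (1 - d n) * glue w k) k0 i j \<partial>\<nu> n)
            \<le> tail \<pi> n * (w + \<eta>)"
          using \<nu>(2)[OF i] t by (intro mult_left_mono)
        also have "\<dots> \<le> V n k0 + \<eta>"
          using t\<eta>[of n] by (simp add: V_def glue_def algebra_simps)
        finally show ?thesis unfolding reward[OF n] True by simp
      next
        case False
        then show ?thesis using \<eta> by (simp add: integral_absorbing2[OF False \<nu>(1) i] Vabs[of k n])
      qed
    qed
    then have "expected_payoff G \<pi> k \<sigma> (\<lambda>n _. \<nu> n) \<le> glue w k + 2 * \<delta>" if "\<sigma> \<in> strategies1 G" for \<sigma>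
      using N N\<eta> that by (force simp: V_def tail_def)
    then show "\<exists>\<tau>\<in>strategies2 G. \<forall>\<sigma>\<in>strategies1 G. expected_payoff G \<pi> k \<sigma> \<tau> \<le> glue w k + 2 * \<delta>"
      using constant_strategies(2)[OF \<nu>(1)] by (intro bexI[of _ "\<lambda>n _. \<nu> n"]) auto
  }
qed

text \<open>Repeating one mixed action iterates the one-shot inequality with potential
  \<open>(1 - d) ^ n * glue w k\<close> and no loss per stage. The horizon can therefore tend to
  infinity, where the leftover vanishes.\<close>

lemma discounted_bounds:
  assumes d: "0 < d" "d \<le> 1"
  defines "f \<equiv> \<lambda>w i j. d * payoff G k0 i j + next_value G (\<lambda>k. (1 - d) * glue w k) k0 i j"
  shows "\<mu> \<in> mixed1 \<Longrightarrow> (\<And>j. j \<in> actions2 G \<Longrightarrow> w \<le> (\<integral>i. f w i j \<partial>\<mu>)) \<Longrightarrow> \<tau> \<in> strategies2 G \<Longrightarrow>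
      w \<le> expected_payoff G (discounted_weights d) k0 (\<lambda>_ _. \<mu>) \<tau>"
    and "\<nu> \<in> mixed2 \<Longrightarrow> (\<And>i. i \<in> actions1 G \<Longrightarrow> (\<integral>j. f w i j \<partial>\<nu>) \<le> w) \<Longrightarrow> \<sigma> \<in> strategies1 G \<Longrightarrow>
      expected_payoff G (discounted_weights d) k0 \<sigma> (\<lambda>_ _. \<nu>) \<le> w"
proof -
  let ?\<pi> = "discounted_weights d"
  have \<pi>: "?\<pi> \<in> weights" using d by (rule discounted_weights)
  define V where "V n k = (1 - d) ^ n * glue w k" for n k
  have reward: "?\<pi> n * payoff G k0 i j + next_value G (V (Suc n)) k0 i j = (1 - d) ^ n * f w i j" for n i j
    using scaled_stage_reward[of "(1 - d) ^ n" d k0 i j "glue w"]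
    by (simp add: V_def[abs_def] f_def discounted_weights_def mult_ac)
  have Vabs: "V n k = ?\<pi> n * c k + V (Suc n) k" if "k \<noteq> k0" for n k
    using that by (simp add: V_def glue_def discounted_weights_def algebra_simps)
  have pow: "0 \<le> (1 - d) ^ n" for n using d by simp
  \<comment> \<open>The bound \<open>\<bar>w\<bar> + 1\<close> holds in every state: absorbing
    payoffs lie in the unit interval, while \<open>w\<close> is an arbitrary real.\<close>
  have VN: "\<bar>V N k\<bar> \<le> (1 - d) ^ N * (\<bar>w\<bar> + 1)" for N k
    unfolding V_def abs_mult using pow[of N] c_bounds[of k] d
    by (auto simp: glue_def power_abs intro!: mult_left_mono)
  have lim0: "(\<lambda>n. (1 - d) ^ n * K) \<longlonglongrightarrow> 0" for K
    using tendsto_mult[OF LIMSEQ_realpow_zero[of "1 - d"] tendsto_const[of K]] d by simp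
  {
    assume \<mu>: "\<mu> \<in> mixed1" and w: "\<And>j. j \<in> actions2 G \<Longrightarrow> w \<le> (\<integral>i. f w i j \<partial>\<mu>)" and \<tau>: "\<tau> \<in> strategies2 G"
    have "V 0 k0 - real N * 0 - (1 - d) ^ N * (\<bar>w\<bar> + 1) \<le> expected_payoff G ?\<pi> k0 (\<lambda>_ _. \<mu>) \<tau>" for N
    proof (rule expected_payoff_ge[OF G \<tau> \<pi> \<mu>])
      show "V N k \<le> (1 - d) ^ N * (\<bar>w\<bar> + 1)" for k using VN[of N k] by simp
      fix n k j assume j: "j \<in> actions2 G"
      show "V n k - 0 \<le> (\<integral>i. ?\<pi> n * payoff G k i j + next_value G (V (Suc n)) k i j \<partial>\<mu>)"
      proof (cases "k = k0")
        case True
        then show ?thesis using mult_left_mono[OF w[OF j] pow[of n]]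
          by (simp add: reward) (simp add: V_def glue_def)
      qed (simp add: integral_absorbing1[OF _ \<mu> j] Vabs[of k n])
    qed
    then have *: "w - (1 - d) ^ N * (\<bar>w\<bar> + 1) \<le> expected_payoff G ?\<pi> k0 (\<lambda>_ _. \<mu>) \<tau>" for N
      by (simp add: V_def glue_def)
    have "(\<lambda>N. w - (1 - d) ^ N * (\<bar>w\<bar> + 1)) \<longlonglongrightarrow> w - 0"
      by (intro tendsto_intros lim0)
    then have "w - 0 \<le> expected_payoff G ?\<pi> k0 (\<lambda>_ _. \<mu>) \<tau>"
      by (rule LIMSEQ_le_const2) (intro exI allI impI *)
    then show "w \<le> expected_payoff G ?\<pi> k0 (\<lambda>_ _. \<mu>) \<tau>" by simp
  }
  {
    assume \<nu>: "\<nu> \<in> mixed2" and w: "\<And>i. i \<in> actions1 G \<Longrightarrow> (\<integral>j. f w i j \<partial>\<nu>) \<le> w" and \<sigma>: "\<sigma> \<in> strategies1 G"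
    have "expected_payoff G ?\<pi> k0 \<sigma> (\<lambda>_ _. \<nu>) \<le>
        V 0 k0 + real N * 0 + (1 - d) ^ N * (\<bar>w\<bar> + 1) + (1 - (\<Sum>n<N. ?\<pi> n))" for N
    proof (rule expected_payoff_le[OF G \<sigma> \<pi> \<nu>])
      show "- ((1 - d) ^ N * (\<bar>w\<bar> + 1)) \<le> V N k" for k using VN[of N k] by simp
      fix n k i assume i: "i \<in> actions1 G"
      show "(\<integral>j. ?\<pi> n * payoff G k i j + next_value G (V (Suc n)) k i j \<partial>\<nu>) \<le> V n k + 0"
      proof (cases "k = k0")
        case True
        then show ?thesis using mult_left_mono[OF w[OF i] pow[of n]]
          by (simp add: reward) (simp add: V_def glue_def)
      qed (simp add: integral_absorbing2[OF _ \<nu> i] Vabs[of k n])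
    qed
    then have *: "expected_payoff G ?\<pi> k0 \<sigma> (\<lambda>_ _. \<nu>) \<le> w + (1 - d) ^ N * (\<bar>w\<bar> + 1) + (1 - d) ^ N * 1" for N
      unfolding sum_discounted_weights by (simp add: V_def glue_def)
    have "(\<lambda>N. w + (1 - d) ^ N * (\<bar>w\<bar> + 1) + (1 - d) ^ N * 1) \<longlonglongrightarrow> w + 0 + 0"
      by (intro tendsto_intros lim0)
    then have "expected_payoff G ?\<pi> k0 \<sigma> (\<lambda>_ _. \<nu>) \<le> w + 0 + 0"
      by (rule LIMSEQ_le_const) (intro exI allI impI *)
    then show "expected_payoff G ?\<pi> k0 \<sigma> (\<lambda>_ _. \<nu>) \<le> w" by simp
  }
qed

section \<open>Guarantees from the uniform value\<close>

text \<open>A stage of weight 0 calls for \<open>d = 0\<close>, where no discounted game is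
  available. The one-shot reward changes by at most \<open>d * (1 + K)\<close> when \<open>d\<close>
  drops to 0, so a guarantee for small positive \<open>d\<close> survives.\<close>

lemma guarantee1_0:
  assumes "d0 > 0" and g: "\<And>d. 0 < d \<Longrightarrow> d \<le> d0 \<Longrightarrow> guarantee1 d w"
  shows "guarantee1 0 w"
  unfolding guarantee1_def
proof (intro allI impI)
  fix \<eta> :: real assume \<eta>: "\<eta> > 0"
  define K where "K = (\<Sum>k\<in>UNIV. \<bar>glue w k\<bar>)"
  have K: "0 \<le> K" by (simp add: K_def sum_nonneg)
  \<comment> \<open>Half of \<open>\<eta>\<close> is spent on the guarantee at \<open>d\<close>, the
    other half on moving from \<open>d\<close> to 0.\<close>
  define d where "d = min d0 (\<eta> / (2 * (1 + K)))"
  have d: "0 < d" "d \<le> d0" and "d \<le> \<eta> / (2 * (1 + K))"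
    using assms(1) \<eta> K by (auto simp: d_def)
  then have dK: "d * (1 + K) \<le> \<eta> / 2" using K by (simp add: field_simps)
  have "\<eta> / 2 > 0" using \<eta> by simp
  with g[OF d(1,2)] obtain \<mu> where \<mu>: "\<mu> \<in> mixed1" "\<And>j. j \<in> actions2 G \<Longrightarrow>
      w - \<eta> / 2 \<le> (\<integral>i. d * payoff G k0 i j + next_value G (\<lambda>k. (1 - d) * glue w k) k0 i j \<partial>\<mu>)"
    unfolding guarantee1_def by blast
  interpret \<mu>: prob_space \<mu> using \<mu>(1) by (simp add: space_prob_algebra)
  have sp: "space \<mu> = actions1 G"
    using \<mu>(1) sets_eq_imp_space_eq[of \<mu> "action_space1 G"] by (simp add: space_prob_algebra)
  have "w - \<eta> \<le> (\<integral>i. 0 * payoff G k0 i j + next_value G (\<lambda>k. (1 - 0) * glue w k) k0 i j \<partial>\<mu>)"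
    if j: "j \<in> actions2 G" for j
  proof -
    note int = integrable_payoff_next_value(1,2)[OF \<mu>(1) j]
    have "(\<integral>i. d * payoff G k0 i j + next_value G (\<lambda>k. (1 - d) * glue w k) k0 i j \<partial>\<mu>)
        \<le> (\<integral>i. next_value G (glue w) k0 i j + d * (1 + K) \<partial>\<mu>)"
    proof (rule integral_mono)
      fix i assume "i \<in> space \<mu>"
      then have "payoff G k0 i j \<le> 1" using G j by (simp add: sp stochastic_game_def)
      moreover have "- next_value G (glue w) k0 i j \<le> K"
        using next_value_bound[of G "glue w" k0 i j] by (simp add: K_def)
      ultimately have "d * (payoff G k0 i j - next_value G (glue w) k0 i j) \<le> d * (1 + K)"
        using d(1) by (intro mult_left_mono) auto
      then show "d * payoff G k0 i j + next_value G (\<lambda>k. (1 - d) * glue w k) k0 i j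
          \<le> next_value G (glue w) k0 i j + d * (1 + K)"
        unfolding next_value_scale by (simp add: algebra_simps)
    qed (auto intro!: int)
    also have "\<dots> = (\<integral>i. next_value G (glue w) k0 i j \<partial>\<mu>) + d * (1 + K)"
      by (subst Bochner_Integration.integral_add) (auto intro!: int simp: \<mu>.prob_space)
    finally show ?thesis using \<mu>(2)[OF j] dK by simp
  qed
  with \<mu>(1) show "\<exists>\<mu>\<in>mixed1. \<forall>j\<in>actions2 G.
      w - \<eta> \<le> (\<integral>i. 0 * payoff G k0 i j + next_value G (\<lambda>k. (1 - 0) * glue w k) k0 i j \<partial>\<mu>)"
    by blast
qed

lemma guarantee2_0:
  assumes "d0 > 0" and g: "\<And>d. 0 < d \<Longrightarrow> d \<le> d0 \<Longrightarrow> guarantee2 d w"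
  shows "guarantee2 0 w"
  unfolding guarantee2_def
proof (intro allI impI)
  fix \<eta> :: real assume \<eta>: "\<eta> > 0"
  define K where "K = (\<Sum>k\<in>UNIV. \<bar>glue w k\<bar>)"
  have K: "0 \<le> K" by (simp add: K_def sum_nonneg)
  define d where "d = min d0 (\<eta> / (2 * (1 + K)))"
  have d: "0 < d" "d \<le> d0" and "d \<le> \<eta> / (2 * (1 + K))"
    using assms(1) \<eta> K by (auto simp: d_def)
  then have dK: "d * (1 + K) \<le> \<eta> / 2" using K by (simp add: field_simps)
  have "\<eta> / 2 > 0" using \<eta> by simp
  with g[OF d(1,2)] obtain \<nu> where \<nu>: "\<nu> \<in> mixed2" "\<And>i. i \<in> actions1 G \<Longrightarrow>
      (\<integral>j. d * payoff G k0 i j + next_value G (\<lambda>k. (1 - d) * glue w k) k0 i j \<partial>\<nu>) \<le> w + \<eta> / 2"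
    unfolding guarantee2_def by blast
  interpret \<nu>: prob_space \<nu> using \<nu>(1) by (simp add: space_prob_algebra)
  have sp: "space \<nu> = actions2 G"
    using \<nu>(1) sets_eq_imp_space_eq[of \<nu> "action_space2 G"] by (simp add: space_prob_algebra)
  have "(\<integral>j. 0 * payoff G k0 i j + next_value G (\<lambda>k. (1 - 0) * glue w k) k0 i j \<partial>\<nu>) \<le> w + \<eta>"
    if i: "i \<in> actions1 G" for i
  proof -
    note int = integrable_payoff_next_value(3,4)[OF \<nu>(1) i]
    have "(\<integral>j. next_value G (glue w) k0 i j - d * (1 + K) \<partial>\<nu>) \<le>
        (\<integral>j. d * payoff G k0 i j + next_value G (\<lambda>k. (1 - d) * glue w k) k0 i j \<partial>\<nu>)"
    proof (rule integral_mono)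
      fix j assume "j \<in> space \<nu>"
      then have "0 \<le> payoff G k0 i j" using G i by (simp add: sp stochastic_game_def)
      moreover have "next_value G (glue w) k0 i j \<le> K"
        using next_value_bound[of G "glue w" k0 i j] by (simp add: K_def)
      ultimately have "d * (next_value G (glue w) k0 i j - payoff G k0 i j) \<le> d * (1 + K)"
        using d(1) by (intro mult_left_mono) auto
      then show "next_value G (glue w) k0 i j - d * (1 + K)
          \<le> d * payoff G k0 i j + next_value G (\<lambda>k. (1 - d) * glue w k) k0 i j"
        unfolding next_value_scale by (simp add: algebra_simps)
    qed (auto intro!: int)
    moreover have "(\<integral>j. next_value G (glue w) k0 i j - d * (1 + K) \<partial>\<nu>) =
        (\<integral>j. next_value G (glue w) k0 i j \<partial>\<nu>) - d * (1 + K)"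
      by (subst Bochner_Integration.integral_diff) (auto intro!: int simp: \<nu>.prob_space)
    ultimately show ?thesis using \<nu>(2)[OF i] dK by simp
  qed
  with \<nu>(1) show "\<exists>\<nu>\<in>mixed2. \<forall>i\<in>actions1 G.
      (\<integral>j. 0 * payoff G k0 i j + next_value G (\<lambda>k. (1 - 0) * glue w k) k0 i j \<partial>\<nu>) \<le> w + \<eta>"
    by blast
qed

text \<open>One \<open>\<sigma>\<close> is good for all averages beyond \<open>N\<close>, so it is
  good for all small discount rates too: at least
  \<open>v - \<epsilon> / 2 - \<epsilon> / 4\<close>. A stationary reply holding the payoff to
  \<open>v - \<epsilon>\<close> is thus impossible.\<close>

lemma uniform_guarantee1:
  assumes \<epsilon>: "\<epsilon> > 0" and v: "v \<le> 1" and \<sigma>: "\<sigma> \<in> strategies1 G" and N: "N \<ge> 1"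
    and unif: "\<And>n \<tau>. N \<le> n \<Longrightarrow> \<tau> \<in> strategies2 G \<Longrightarrow>
      v - \<epsilon> / 2 \<le> expected_payoff G (average_weights n) k0 \<sigma> \<tau>"
  shows "\<exists>d0>0. \<forall>d\<in>{0..d0}. guarantee1 d (v - \<epsilon>)"
proof -
  \<comment> \<open>The loss \<open>real N * d\<close> from Abel summation stays below
    \<open>\<epsilon> / 4\<close>, and \<open>d\<close> remains a discount rate.\<close>
  define d0 where "d0 = min 1 (\<epsilon> / (4 * real N))"
  have d0: "d0 > 0" using \<epsilon> N by (simp add: d0_def)
  have pos: "guarantee1 d (v - \<epsilon>)" if d: "0 < d" "d \<le> d0" for d
  proof -
    let ?V = "\<lambda>k. (1 - d) * glue (v - \<epsilon>) k"
    have d1: "d \<le> 1" and "d \<le> \<epsilon> / (4 * real N)" using d by (auto simp: d0_def)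
    then have Nd: "real N * d \<le> \<epsilon> / 4" using N by (simp add: field_simps)
    obtain u where "one_shot_value d ?V u" using ex_one_shot_value by blast
    note u = one_shot_valueD[OF this]
    have "v - \<epsilon> \<le> u"
    \<comment> \<open>The continuation in \<open>?V\<close> is the very number
      \<open>v - \<epsilon>\<close> that is assumed to be missed, so the reply \<open>\<nu>\<close>
      reproduces its own bound when repeated. Its slack is the gap between \<open>u\<close> and
      \<open>v - \<epsilon>\<close>.\<close>
    proof (rule ccontr)
      assume "\<not> v - \<epsilon> \<le> u"
      then obtain \<nu> where \<nu>: "\<nu> \<in> mixed2" "\<And>i. i \<in> actions1 G \<Longrightarrow>
          (\<integral>j. d * payoff G k0 i j + next_value G ?V k0 i j \<partial>\<nu>) \<le> v - \<epsilon>"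
        using u(2)[of "v - \<epsilon> - u"] by auto
      define \<tau> :: "nat \<Rightarrow> (nat \<Rightarrow> 'k \<times> 'i \<times> 'j) \<times> 'k \<Rightarrow> 'j measure" where "\<tau> = (\<lambda>_ _. \<nu>)"
      have \<tau>: "\<tau> \<in> strategies2 G" unfolding \<tau>_def using \<nu>(1) by (intro constant_strategies)
      have upper: "expected_payoff G (discounted_weights d) k0 \<sigma> \<tau> \<le> v - \<epsilon>"
        unfolding \<tau>_def by (rule discounted_bounds(2)[OF d(1) d1 \<nu> \<sigma>])
      interpret play G k0 \<sigma> \<tau> using G \<sigma> \<tau> by (rule play.intro)
      have "(v - \<epsilon> / 2) - real N * d \<le> expected_payoff G (discounted_weights d) k0 \<sigma> \<tau>"
      proof (rule abel_lower_bound[OF d(1) d1])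
        show "0 \<le> stage_payoff G k0 \<sigma> \<tau> n" for n using stage_payoff_bounds by simp
        show "v - \<epsilon> / 2 \<le> 1" using v \<epsilon> by simp
        show "real n * (v - \<epsilon> / 2) \<le> (\<Sum>m<n. stage_payoff G k0 \<sigma> \<tau> m)" if "N \<le> n" for n
          using mult_left_mono[OF unif[OF that \<tau>], of "real n"] that N
          by (simp add: expected_payoff_average[OF G \<sigma> \<tau>])
        show "(\<lambda>n. discounted_weights d n * stage_payoff G k0 \<sigma> \<tau> n) sums
            expected_payoff G (discounted_weights d) k0 \<sigma> \<tau>"
          by (rule expected_payoff_sums[OF discounted_weights[OF d(1) d1]])
      qed
      with upper Nd \<epsilon> show False by simp
    qed
    then show ?thesis
      unfolding guarantee1_def using u(1) by (meson diff_right_mono order_trans)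
  qed
  have "guarantee1 d (v - \<epsilon>)" if "d \<in> {0..d0}" for d
    using that pos guarantee1_0[OF d0 pos] by (cases "d = 0") auto
  with d0 show ?thesis by blast
qed

lemma uniform_guarantee2:
  assumes \<epsilon>: "\<epsilon> > 0" and v: "0 \<le> v" and \<tau>: "\<tau> \<in> strategies2 G" and N: "N \<ge> 1"
    and unif: "\<And>n \<sigma>. N \<le> n \<Longrightarrow> \<sigma> \<in> strategies1 G \<Longrightarrow>
      expected_payoff G (average_weights n) k0 \<sigma> \<tau> \<le> v + \<epsilon> / 2"
  shows "\<exists>d0>0. \<forall>d\<in>{0..d0}. guarantee2 d (v + \<epsilon>)"
proof -
  define d0 where "d0 = min 1 (\<epsilon> / (4 * real N))"
  have d0: "d0 > 0" using \<epsilon> N by (simp add: d0_def)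
  have pos: "guarantee2 d (v + \<epsilon>)" if d: "0 < d" "d \<le> d0" for d
  proof -
    let ?V = "\<lambda>k. (1 - d) * glue (v + \<epsilon>) k"
    have d1: "d \<le> 1" and "d \<le> \<epsilon> / (4 * real N)" using d by (auto simp: d0_def)
    then have Nd: "real N * d \<le> \<epsilon> / 4" using N by (simp add: field_simps)
    obtain u where "one_shot_value d ?V u" using ex_one_shot_value by blast
    note u = one_shot_valueD[OF this]
    have "u \<le> v + \<epsilon>"
    proof (rule ccontr)
      assume "\<not> u \<le> v + \<epsilon>"
      then obtain \<mu> where \<mu>: "\<mu> \<in> mixed1" "\<And>j. j \<in> actions2 G \<Longrightarrow>
          v + \<epsilon> \<le> (\<integral>i. d * payoff G k0 i j + next_value G ?V k0 i j \<partial>\<mu>)"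
        using u(1)[of "u - (v + \<epsilon>)"] by auto
      define \<sigma> :: "nat \<Rightarrow> (nat \<Rightarrow> 'k \<times> 'i \<times> 'j) \<times> 'k \<Rightarrow> 'i measure" where "\<sigma> = (\<lambda>_ _. \<mu>)"
      have \<sigma>: "\<sigma> \<in> strategies1 G" unfolding \<sigma>_def using \<mu>(1) by (intro constant_strategies)
      have lower: "v + \<epsilon> \<le> expected_payoff G (discounted_weights d) k0 \<sigma> \<tau>"
        unfolding \<sigma>_def by (rule discounted_bounds(1)[OF d(1) d1 \<mu> \<tau>])
      interpret play G k0 \<sigma> \<tau> using G \<sigma> \<tau> by (rule play.intro)
      \<comment> \<open>For Player 2 the Abel bound is applied to the complementary payoffs, which
        are nonnegative as well.\<close>
      have "(1 - (v + \<epsilon> / 2)) - real N * d \<le> 1 - expected_payoff G (discounted_weights d) k0 \<sigma> \<tau>"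
      proof (rule abel_lower_bound[OF d(1) d1])
        show "0 \<le> 1 - stage_payoff G k0 \<sigma> \<tau> n" for n using stage_payoff_bounds by simp
        show "1 - (v + \<epsilon> / 2) \<le> 1" using v \<epsilon> by simp
        show "real n * (1 - (v + \<epsilon> / 2)) \<le> (\<Sum>m<n. 1 - stage_payoff G k0 \<sigma> \<tau> m)" if "N \<le> n" for n
          using mult_left_mono[OF unif[OF that \<sigma>], of "real n"] that N
          by (simp add: expected_payoff_average[OF G \<sigma> \<tau>] sum_subtractf algebra_simps)
        have \<pi>: "discounted_weights d \<in> weights" by (rule discounted_weights[OF d(1) d1])
        then show "(\<lambda>n. discounted_weights d n * (1 - stage_payoff G k0 \<sigma> \<tau> n)) sums
            (1 - expected_payoff G (discounted_weights d) k0 \<sigma> \<tau>)"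
          using sums_diff[OF _ expected_payoff_sums[OF \<pi>]] by (simp add: weights_def right_diff_distrib)
      qed
      with lower Nd \<epsilon> show False by simp
    qed
    then show ?thesis
      unfolding guarantee2_def using u(2) by (meson add_right_mono order_trans)
  qed
  have "guarantee2 d (v + \<epsilon>)" if "d \<in> {0..d0}" for d
    using that pos guarantee2_0[OF d0 pos] by (cases "d = 0") auto
  with d0 show ?thesis by blast
qed

end

section \<open>From the guarantees to the asymptotic value\<close>

text \<open>If every state is absorbing, any state can take the place of \<open>k0\<close>.\<close>

lemma absorbing_game_cases:
  assumes "absorbing_game G"
  obtains k0 c where "\<And>k i j. k \<noteq> k0 \<Longrightarrow> i \<in> actions1 G \<Longrightarrow> j \<in> actions2 G \<Longrightarrow> payoff G k i j = c k"
    "\<And>k i j. k \<noteq> k0 \<Longrightarrow> i \<in> actions1 G \<Longrightarrow> j \<in> actions2 G \<Longrightarrow> trans_law G k i j = return_pmf k"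
proof -
  have "\<exists>k0. {k. \<not> absorbing G k} \<subseteq> {k0}"
  proof (cases "{k. \<not> absorbing G k} = {}")
    case False
    then obtain k0 where "\<not> absorbing G k0" by blast
    moreover have "\<forall>x\<in>{k. \<not> absorbing G k}. \<forall>y\<in>{k. \<not> absorbing G k}. x = y"
      using assms by (simp add: absorbing_game_def card_le_Suc0_iff_eq)
    ultimately show ?thesis by (intro exI[of _ k0]) blast
  qed blast
  then obtain k0 where k0: "absorbing G k" if "k \<noteq> k0" for k by blast
  then have "\<forall>k. \<exists>c. k \<noteq> k0 \<longrightarrow> (\<forall>i\<in>actions1 G. \<forall>j\<in>actions2 G. payoff G k i j = c)"
    unfolding absorbing_def by meson
  then obtain c where "\<And>k i j. k \<noteq> k0 \<Longrightarrow> i \<in> actions1 G \<Longrightarrow> j \<in> actions2 G \<Longrightarrow> payoff G k i j = c k"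
    by metis
  moreover have "trans_law G k i j = return_pmf k" if "k \<noteq> k0" "i \<in> actions1 G" "j \<in> actions2 G" for k i j
    using k0[OF that(1)] that by (simp add: absorbing_def)
  ultimately show thesis by (rule that)
qed

theorem proposition2:
  fixes G :: "('k::finite, 'i::topological_space, 'j::topological_space) stoch_game"
    and v_inf :: "'k \<Rightarrow> real"
  assumes "stochastic_game G"
    and "absorbing_game G"
    and "compact (actions1 G)"
    and "compact (actions2 G)"
    and "separately_continuous G"
    and "uniform_value G v_inf"
  shows "\<forall>\<epsilon>>0. \<exists>\<alpha>>0. \<forall>\<pi>\<in>weights. (SUP m. \<pi> m) \<le> \<alpha> \<longrightarrow>
    (\<exists>v. (\<forall>k. is_value G \<pi> k (v k)) \<and> (MAX k. \<bar>v k - v_inf k\<bar>) \<le> \<epsilon>)"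
proof (intro allI impI)
  fix \<epsilon> :: real assume \<epsilon>: "\<epsilon> > 0"
  obtain k0 c where "\<And>k i j. k \<noteq> k0 \<Longrightarrow> i \<in> actions1 G \<Longrightarrow> j \<in> actions2 G \<Longrightarrow> payoff G k i j = c k"
    "\<And>k i j. k \<noteq> k0 \<Longrightarrow> i \<in> actions1 G \<Longrightarrow> j \<in> actions2 G \<Longrightarrow> trans_law G k i j = return_pmf k"
    using absorbing_game_cases[OF assms(2)] by blast
  then interpret compact_absorbing_game G k0 c
    using assms by unfold_locales auto
  have v01: "0 \<le> v_inf k" "v_inf k \<le> 1" for k using assms(6) by (auto simp: uniform_value_def)
  have unif: "\<exists>\<sigma>'\<in>strategies1 G. \<exists>\<tau>'\<in>strategies2 G. \<exists>N\<ge>1. \<forall>n\<ge>N. \<forall>\<sigma>\<in>strategies1 G. \<forall>\<tau>\<in>strategies2 G.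
      v_inf k - \<delta> \<le> expected_payoff G (average_weights n) k \<sigma>' \<tau> \<and>
      expected_payoff G (average_weights n) k \<sigma> \<tau>' \<le> v_inf k + \<delta>" if "\<delta> > 0" for \<delta> k
    using assms(6) that unfolding uniform_value_def by blast
  \<comment> \<open>The two inequalities of the uniform value come joined; an arbitrary strategy of
    the other player is inserted to extract each of them.\<close>
  obtain s0 t0 where s0: "s0 \<in> strategies1 G" and t0: "t0 \<in> strategies2 G"
    using strategies_nonempty[OF G] by auto
  have "\<epsilon> / 2 / 2 > 0" using \<epsilon> by simp
  from unif[OF this, of k0] obtain \<sigma>' \<tau>' N where \<sigma>': "\<sigma>' \<in> strategies1 G" and \<tau>': "\<tau>' \<in> strategies2 G"
    and N: "N \<ge> 1"
    and opt: "\<forall>n\<ge>N. \<forall>\<sigma>\<in>strategies1 G. \<forall>\<tau>\<in>strategies2 G.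
      v_inf k0 - \<epsilon> / 2 / 2 \<le> expected_payoff G (average_weights n) k0 \<sigma>' \<tau> \<and>
      expected_payoff G (average_weights n) k0 \<sigma> \<tau>' \<le> v_inf k0 + \<epsilon> / 2 / 2"
    by blast
  have \<epsilon>2: "\<epsilon> / 2 > 0" using \<epsilon> by simp
  obtain d1 where d1: "d1 > 0" "\<And>d. d \<in> {0..d1} \<Longrightarrow> guarantee1 d (v_inf k0 - \<epsilon> / 2)"
    using uniform_guarantee1[OF \<epsilon>2 v01(2) \<sigma>' N] opt s0 by blast
  obtain d2 where d2: "d2 > 0" "\<And>d. d \<in> {0..d2} \<Longrightarrow> guarantee2 d (v_inf k0 + \<epsilon> / 2)"
    using uniform_guarantee2[OF \<epsilon>2 v01(1) \<tau>' N] opt t0 by blast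
  define d where "d = min d1 d2"
  have d: "d > 0" using d1 d2 by (simp add: d_def)
  have w: "v_inf k0 - \<epsilon> / 2 \<le> 1" "0 \<le> v_inf k0 + \<epsilon> / 2" using v01[of k0] \<epsilon> by auto
  note lower = weighted_bounds(1)[where w = "v_inf k0 - \<epsilon> / 2" and b = d, OF _ _ _ _ w(1)]
    and upper = weighted_bounds(2)[where w = "v_inf k0 + \<epsilon> / 2" and b = d, OF _ _ _ _ w(2)]
  have g1: "guarantee1 d' (v_inf k0 - \<epsilon> / 2)" and g2: "guarantee2 d' (v_inf k0 + \<epsilon> / 2)"
    if "d' \<in> {0..d}" for d'
    using that d1(2) d2(2) by (auto simp: d_def)
  \<comment> \<open>Averages over many stages are weights with a small maximum, so the bounds with
    \<open>glue\<close> apply to them and confine their payoffs near \<open>c k\<close>, while the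
    uniform value confines them near \<open>v_inf k\<close>.\<close>
  have c_eq: "c k = v_inf k" if k: "k \<noteq> k0" for k
  proof -
    have "\<bar>v_inf k - c k\<bar> \<le> \<epsilon>'" if "\<epsilon>' > 0" for \<epsilon>'
    proof -
      define \<delta> where "\<delta> = \<epsilon>' / 4"
      have \<delta>: "\<delta> > 0" using \<open>\<epsilon>' > 0\<close> by (simp add: \<delta>_def)
      have "2 * \<delta> > 0" using \<delta> by simp
      from unif[OF this, of k] obtain s t M where s: "s \<in> strategies1 G" and t: "t \<in> strategies2 G"
        and M: "M \<ge> 1"
        and st: "\<forall>n\<ge>M. \<forall>\<sigma>\<in>strategies1 G. \<forall>\<tau>\<in>strategies2 G.
          v_inf k - 2 * \<delta> \<le> expected_payoff G (average_weights n) k s \<tau> \<and>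
          expected_payoff G (average_weights n) k \<sigma> t \<le> v_inf k + 2 * \<delta>"
        by blast
      \<comment> \<open>Makes \<open>1 / real n\<close>, the largest average weight, at most
        \<open>d * \<delta>\<close>.\<close>
      obtain m :: nat where m: "1 / (d * \<delta>) < real m" using reals_Archimedean2 by blast
      define n where "n = max M m"
      have n: "M \<le> n" "n \<ge> 1" "1 / (d * \<delta>) \<le> real n" using M m by (auto simp: n_def)
      have small: "average_weights n l \<le> d * \<delta>" for l
        using n d \<delta> by (auto simp: average_weights_def field_simps)
      note \<pi> = average_weights[OF n(2)]
      obtain \<sigma> where "\<sigma> \<in> strategies1 G" "c k - 2 * \<delta> \<le> expected_payoff G (average_weights n) k \<sigma> t"
        using lower[OF \<pi> \<delta> small g1, of k] t k by (auto simp: glue_def)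
      moreover obtain \<tau> where "\<tau> \<in> strategies2 G" "expected_payoff G (average_weights n) k s \<tau> \<le> c k + 2 * \<delta>"
        using upper[OF \<pi> \<delta> small g2, of k] s k by (auto simp: glue_def)
      ultimately have "c k - 2 * \<delta> \<le> v_inf k + 2 * \<delta>" "v_inf k - 2 * \<delta> \<le> c k + 2 * \<delta>"
        using st n(1) s t by (meson order_trans)+
      then show ?thesis by (simp add: \<delta>_def abs_le_iff)
    qed
    then have "\<bar>v_inf k - c k\<bar> \<le> 0" by (rule field_le_epsilon[where y = 0, simplified])
    then show ?thesis by simp
  qed
  \<comment> \<open>Half of \<open>\<epsilon>\<close> separates the guaranteed numbers from
    \<open>v_inf k0\<close>; the other half is the \<open>2 * \<delta>\<close> lost in the weighted
    game. With weights at most \<open>d * \<delta>\<close>, the relative weights stay below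
    \<open>d\<close> while at least \<open>\<delta>\<close> remains.\<close>
  define \<delta> where "\<delta> = \<epsilon> / 4"
  have \<delta>: "\<delta> > 0" using \<epsilon> by (simp add: \<delta>_def)
  show "\<exists>\<alpha>>0. \<forall>\<pi>\<in>weights. (SUP m. \<pi> m) \<le> \<alpha> \<longrightarrow>
    (\<exists>v. (\<forall>k. is_value G \<pi> k (v k)) \<and> (MAX k. \<bar>v k - v_inf k\<bar>) \<le> \<epsilon>)"
  proof (intro exI[of _ "d * \<delta>"] conjI ballI impI)
    show "0 < d * \<delta>" using d \<delta> by simp
    fix \<pi> assume \<pi>: "\<pi> \<in> weights" and sup: "(SUP m. \<pi> m) \<le> d * \<delta>"
    \<comment> \<open>A real \<open>SUP\<close> bounds its terms only when the family is bounded
      above.\<close>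
    have "\<pi> m \<le> 1" for m
      using tail_bounds[OF \<pi>, of m] tail_bounds[OF \<pi>, of "Suc m"] by (simp add: tail_Suc)
    then have "bdd_above (range \<pi>)" by (intro bdd_aboveI2)
    then have small: "\<pi> m \<le> d * \<delta>" for m
      using cSUP_upper[of m UNIV \<pi>] sup by simp
    obtain v where v: "\<And>k. is_value G \<pi> k (v k)" using ex_value[OF \<pi>] by metis
    have "\<bar>v k - v_inf k\<bar> \<le> \<epsilon>" for k
    proof -
      have "glue (v_inf k0 - \<epsilon> / 2) k - 2 * \<delta> \<le> v k"
        using lower[OF \<pi> \<delta> small g1, of k] sup_inf_ge[OF G \<pi>, of _ _ k] v[of k] by (auto simp: is_value_def)
      moreover have "v k \<le> glue (v_inf k0 + \<epsilon> / 2) k + 2 * \<delta>"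
        using upper[OF \<pi> \<delta> small g2, of k] inf_sup_le[OF G \<pi>, of _ k] v[of k] by (auto simp: is_value_def)
      ultimately show ?thesis using c_eq \<epsilon> by (auto simp: glue_def \<delta>_def abs_le_iff split: if_splits)
    qed
    with v show "\<exists>v. (\<forall>k. is_value G \<pi> k (v k)) \<and> (MAX k. \<bar>v k - v_inf k\<bar>) \<le> \<epsilon>"
      by (intro exI[of _ v]) auto
  qed
qed

end
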